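(* Let $A$, $\Lambda$, $E$, $r_N$, $z_k$, $w_k$, $W$, $\mathcal{V}$, $R_h(z)$, $S_N$, $S_N^h$, $P_h$ and $E_h=\operatorname{ran}P_h$ be as in the context, and suppose Assumptions 1, 2 and 3 stated in the context hold. Then there is a $C_N>0$ and an $h_0>0$ such that for all $h<h_0$, $$\operatorname{gap}_{\mathcal{V}}(E,E_h)\le C_N\,W\max_{k=0,\ldots,N-1}\Big\|\big[R(z_k)-R_h(z_k)\big]\big|_E\Big\|_{\mathcal{V}},$$ so, in particular, $\lim_{h\to0}\operatorname{gap}_{\mathcal{V}}(E,E_h)=0$.
   Context: Setting. $A:\operatorname{dom}(A)\subseteq\mathcal{H}\to\mathcal{H}$ is a linear, closed, selfadjoint (not necessarily bounded) operator in a complex Hilbert space $\mathcal{H}$, with spectrum $\Sigma(A)\subset\mathbb{R}$ and resolvent $R(z)=(z-A)^{-1}$. $\Lambda\subset\Sigma(A)$ is a finite collection of eigenvalues of finite multiplicity; $E$ is the span of all eigenvectors associated with elements of $\Lambda$; $m=\dim E$, assumed to satisfy $1\le m<\infty$; $\lambda_1,\ldots,\lambda_m$ are the elements of $\Lambda$ counted with multiplicity. Filter. $r_N(\xi)=w_N+\sum_{k=0}^{N-1}w_k(z_k-\xi)^{-1}$ with $w_k,z_k\in\mathbb{C}$, $W=\sum_{k=0}^N|w_k|$, and $S_N=r_N(A)=w_N+\sum_{k=0}^{N-1}w_kR(z_k)$ (the scalar $w_N$ means $w_N$ times the identity). For $y\in\mathbb{R}$, $\gamma,\delta>0$ let $I_\gamma^y=\{x\in\mathbb{R}:|x-y|\le\gamma\}$,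 $O_{\delta,\gamma}^y=\{x\in\mathbb{R}:|x-y|\ge(1+\delta)\gamma\}$, and $\hat\kappa=\sup_{x\in O_{\delta,\gamma}^y}|r_N(x)|\,/\,\inf_{x\in I_\gamma^y}|r_N(x)|$. Assumption 1. There are $y\in\mathbb{R}$, $\delta>0$, $\gamma>0$ such that $\Lambda\subset I_\gamma^y$ and $\Sigma(A)\setminus\Lambda\subset O_{\delta,\gamma}^y$; and $r_N$ is a rational function of the form $r_N(\xi)=w_N+\sum_{k=0}^{N-1}w_k(z_k-\xi)^{-1}$ with $z_k\notin\overline{\Sigma(A)}$, $W<\infty$, $\hat\kappa<1$. Assumption 2. There is a Hilbert space $\mathcal{V}\subseteq\mathcal{H}$ such that $E\subseteq\mathcal{V}$, there is $C_{\mathcal{V}}>0$ with $\|u\|_{\mathcal{H}}\le C_{\mathcal{V}}\|u\|_{\mathcal{V}}$ for all $u\in\mathcal{V}$, and $\mathcal{V}$ is an invariant subspace of $R(z)$ for $z$ in the resolvent set of $A$. Discretization. For each value of a parameter $h>0$ (tending to $0$), $\mathcal{V}_h$ is a finite-dimensional subspace of $\mathcal{V}$ and $R_h(z):\mathcal{H}\to\mathcal{V}_h$ is a finite-rank approximation of $R(z)$; $S_N^h=w_N+\sum_{k=0}^{N-1}w_kR_h(z_k)$. Assumption 3. The operators $R_h(z_k)$ and $R(z_k)$ are bounded in $\mathcal{V}$ and $\lim_{h\to0}\|R_h(z_k)-R(z_k)\|_{\mathcal{V}}=0$ for all $k=0,\ldots,N-1$ (operator norm on $\mathcal{V}$). $S_N$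 and $S_N^h$ are viewed as bounded operators on $\mathcal{V}$. Let $\mu_i=r_N(\lambda_i)$ and $\mu_*=\sup\{|\mu|:\mu\in\Sigma(S_N)\setminus\{\mu_1,\ldots,\mu_m\}\}$; Assumption 1 gives $\mu_*<|\mu_i|$ and $\mu_i\neq0$ for $i=1,\ldots,m$. Fix a simple rectifiable closed curve $\Theta$ in $\mathbb{C}$ that encloses $\{\mu_1,\ldots,\mu_m\}$, lies strictly outside the circle of radius $\mu_*$ centered at $0$, and encloses no other element of $\Sigma(S_N)$ (nor $0$). For sufficiently small $h$, $\Theta$ lies in the resolvent set of $S_N^h$ and encloses exactly $m$ eigenvalues (with multiplicity) of $S_N^h$; for such $h$ define $P_h=\frac{1}{2\pi i}\oint_\Theta(z-S_N^h)^{-1}\,dz$ and $E_h=\operatorname{ran}P_h$ (so $\dim E_h=m$). The constant $C_N$ does not depend on $h$. For a bounded operator $B$ on $\mathcal{V}$, $\|B|_E\|_{\mathcal{V}}=\sup_{0\ne e\in E}\|Be\|_{\mathcal{V}}/\|e\|_{\mathcal{V}}$. Gap. For linear subspaces $M,L$ of $\mathcal{V}$, with $U_M^{\mathcal{V}}=\{w\in M:\|w\|_{\mathcal{V}}=1\}$ and $\operatorname{dist}_{\mathcal{V}}(x,L)=\inf_{l\in L}\|x-l\|_{\mathcal{V}}$, $\operatorname{gap}_{\mathcal{V}}(M,L)=\max\big[\sup_{x\in U_M^{\mathcal{V}}}\operatorname{dist}_{\mathcal{V}}(x,L),\ \sup_{x\in U_L^{\mathcal{V}}}\operatorname{dist}_{\mathcal{V}}(x,M)\big]$.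 *)

theory Defs
  imports "HOL-Analysis.Analysis"
begin

(* The complex inner product is linear in its first argument.  The last axiom says that the
   norm of the underlying Banach space is the one induced by the inner product. *)
class complex_hilbert_space = banach +
  fixes scaleC :: "complex \<Rightarrow> 'a \<Rightarrow> 'a" (infixr \<open>*\<^sub>C\<close> 75)
    and cinner :: "'a \<Rightarrow> 'a \<Rightarrow> complex"
  assumes scaleC_add_right: "a *\<^sub>C (x + y) = a *\<^sub>C x + a *\<^sub>C y"
    and scaleC_add_left: "(a + b) *\<^sub>C x = a *\<^sub>C x + b *\<^sub>C x"
    and scaleC_scaleC: "a *\<^sub>C (b *\<^sub>C x) = (a * b) *\<^sub>C x"
    and scaleR_scaleC: "r *\<^sub>R x = complex_of_real r *\<^sub>C x"
    and cinner_commute: "cinner x y = cnj (cinner y x)"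
    and cinner_add_left: "cinner (x + y) u = cinner x u + cinner y u"
    and cinner_scaleC_left: "cinner (a *\<^sub>C x) u = a * cinner x u"
    and cinner_self: "cinner x x = complex_of_real ((norm x)\<^sup>2)"

abbreviation csubspace :: "'a::complex_hilbert_space set \<Rightarrow> bool"
  where "csubspace \<equiv> module.subspace scaleC"

abbreviation cspan :: "'a::complex_hilbert_space set \<Rightarrow> 'a set"
  where "cspan \<equiv> module.span scaleC"

abbreviation clinear :: "('a::complex_hilbert_space \<Rightarrow> 'b::complex_hilbert_space) \<Rightarrow> bool"
  where "clinear \<equiv> Vector_Spaces.linear scaleC scaleC"

definition finite_dim :: "'a::complex_hilbert_space set \<Rightarrow> bool"
  where "finite_dim L \<longleftrightarrow> (\<exists>B. finite B \<and> L \<subseteq> cspan B)"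


(* An unbounded operator is given by its domain D and a function A; only the values of A on D
   matter.  Everywhere defined operators have D = UNIV. *)

definition linear_op :: "'a::complex_hilbert_space set \<Rightarrow> ('a \<Rightarrow> 'a) \<Rightarrow> bool"
  where "linear_op D A \<longleftrightarrow> csubspace D
    \<and> (\<forall>x\<in>D. \<forall>y\<in>D. A (x + y) = A x + A y) \<and> (\<forall>c. \<forall>x\<in>D. A (c *\<^sub>C x) = c *\<^sub>C A x)"

definition op_graph :: "'a set \<Rightarrow> ('a \<Rightarrow> 'a) \<Rightarrow> ('a \<times> 'a) set"
  where "op_graph D A = {(x, A x) | x. x \<in> D}"

definition closed_op :: "'a::complex_hilbert_space set \<Rightarrow> ('a \<Rightarrow> 'a) \<Rightarrow> bool"
  where "closed_op D A \<longleftrightarrow> closed (op_graph D A)"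

definition adjoint_graph :: "'a::complex_hilbert_space set \<Rightarrow> ('a \<Rightarrow> 'a) \<Rightarrow> ('a \<times> 'a) set"
  where "adjoint_graph D A = {(y, u). \<forall>x\<in>D. cinner (A x) y = cinner x u}"

definition selfadjoint_op :: "'a::complex_hilbert_space set \<Rightarrow> ('a \<Rightarrow> 'a) \<Rightarrow> bool"
  where "selfadjoint_op D A \<longleftrightarrow> closure D = UNIV \<and> adjoint_graph D A = op_graph D A"

definition resolvent :: "'a::complex_hilbert_space set \<Rightarrow> ('a \<Rightarrow> 'a) \<Rightarrow> complex \<Rightarrow> 'a \<Rightarrow> 'a"
  where "resolvent D A \<zeta> = inv_into D (\<lambda>x. \<zeta> *\<^sub>C x - A x)"

definition resolvent_set :: "'a::complex_hilbert_space set \<Rightarrow> ('a \<Rightarrow> 'a) \<Rightarrow> complex set"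
  where "resolvent_set D A =
    {\<zeta>. bij_betw (\<lambda>x. \<zeta> *\<^sub>C x - A x) D UNIV \<and> bounded_linear (resolvent D A \<zeta>)}"

definition spectrum :: "'a::complex_hilbert_space set \<Rightarrow> ('a \<Rightarrow> 'a) \<Rightarrow> complex set"
  where "spectrum D A = - resolvent_set D A"

definition eigenspace :: "'a::complex_hilbert_space set \<Rightarrow> ('a \<Rightarrow> 'a) \<Rightarrow> complex \<Rightarrow> 'a set"
  where "eigenspace D A l = {x \<in> D. A x = l *\<^sub>C x}"


definition filter_fun :: "(nat \<Rightarrow> complex) \<Rightarrow> (nat \<Rightarrow> complex) \<Rightarrow> nat \<Rightarrow> complex \<Rightarrow> complex"
  where "filter_fun w z N \<xi> = w N + (\<Sum>k<N. w k * inverse (z k - \<xi>))"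

definition filter_weight :: "(nat \<Rightarrow> complex) \<Rightarrow> nat \<Rightarrow> real"
  where "filter_weight w N = (\<Sum>k\<le>N. cmod (w k))"

definition filter_op ::
    "(nat \<Rightarrow> complex) \<Rightarrow> (nat \<Rightarrow> complex) \<Rightarrow> nat \<Rightarrow> (complex \<Rightarrow> 'a \<Rightarrow> 'a) \<Rightarrow> 'a::complex_hilbert_space \<Rightarrow> 'a"
  where "filter_op w z N R v = w N *\<^sub>C v + (\<Sum>k<N. w k *\<^sub>C R (z k) v)"

definition inner_interval :: "real \<Rightarrow> real \<Rightarrow> real set"
  where "inner_interval y \<gamma> = {x. \<bar>x - y\<bar> \<le> \<gamma>}"

definition outer_region :: "real \<Rightarrow> real \<Rightarrow> real \<Rightarrow> real set"
  where "outer_region y \<delta> \<gamma> = {x. \<bar>x - y\<bar> \<ge> (1 + \<delta>) * \<gamma>}"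

(* The condition that the quotient sup/inf is less than 1.  Supremum and infimum run over the points
   at which the formula for the filter is defined (HOL would otherwise give it a finite value at a
   real z k); leaving out these finitely many points changes neither, also when |r| is read as
   infinite at a true pole.  The supremum may be infinite.  The infimum must be nonzero for
   the quotient to be defined (in ereal, 0 / 0 = 0). *)
definition filter_sup :: "(nat \<Rightarrow> complex) \<Rightarrow> (nat \<Rightarrow> complex) \<Rightarrow> nat \<Rightarrow> real set \<Rightarrow> ereal"
  where "filter_sup w z N X =
    (SUP x\<in>{x \<in> X. \<forall>k<N. complex_of_real x \<noteq> z k}. ereal (cmod (filter_fun w z N (complex_of_real x))))"

definition filter_inf :: "(nat \<Rightarrow> complex) \<Rightarrow> (nat \<Rightarrow> complex) \<Rightarrow> nat \<Rightarrow> real set \<Rightarrow> ereal"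
  where "filter_inf w z N X =
    (INF x\<in>{x \<in> X. \<forall>k<N. complex_of_real x \<noteq> z k}. ereal (cmod (filter_fun w z N (complex_of_real x))))"

definition kappa_hat_less_1 ::
    "(nat \<Rightarrow> complex) \<Rightarrow> (nat \<Rightarrow> complex) \<Rightarrow> nat \<Rightarrow> real \<Rightarrow> real \<Rightarrow> real \<Rightarrow> bool"
  where "kappa_hat_less_1 w z N y \<delta> \<gamma> \<longleftrightarrow>
    filter_inf w z N (inner_interval y \<gamma>) \<noteq> 0 \<and>
    filter_sup w z N (outer_region y \<delta> \<gamma>) / filter_inf w z N (inner_interval y \<gamma>) < 1"


(* The inclusion of V in H is an injection \<iota> between types.  This is the operator induced on V by
   an operator on H that leaves range \<iota> invariant. *)
definition restrict_op :: "('v \<Rightarrow> 'h) \<Rightarrow> ('h \<Rightarrow> 'h) \<Rightarrow> 'v \<Rightarrow> 'v"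
  where "restrict_op \<iota> T v = inv \<iota> (T (\<iota> v))"

definition norm_on :: "'v::complex_hilbert_space set \<Rightarrow> ('v \<Rightarrow> 'v) \<Rightarrow> real"
  where "norm_on M B = (SUP e\<in>M - {0}. norm (B e) / norm e)"

(* The inserted 0 only serves to make the supremum over the empty set 0. *)
definition directed_gap :: "'v::complex_hilbert_space set \<Rightarrow> 'v set \<Rightarrow> real"
  where "directed_gap M L = Sup (insert 0 ((\<lambda>x. infdist x L) ` {x \<in> M. norm x = 1}))"

definition gap :: "'v::complex_hilbert_space set \<Rightarrow> 'v set \<Rightarrow> real"
  where "gap M L = max (directed_gap M L) (directed_gap L M)"

(* The inserted 0 only matters if there is no spectrum outside M. *)
definition radius_outside :: "('v::complex_hilbert_space \<Rightarrow> 'v) \<Rightarrow> complex set \<Rightarrow> real"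
  where "radius_outside T M = Sup (insert 0 (cmod ` (spectrum UNIV T - M)))"


(* Bounded variation, i.e. bounded lengths of the inscribed polygons. *)
definition rectifiable :: "(real \<Rightarrow> complex) \<Rightarrow> bool"
  where "rectifiable \<theta> \<longleftrightarrow>
    (\<exists>l. \<forall>d. d division_of {0..1} \<longrightarrow> (\<Sum>K\<in>d. norm (\<theta> (Sup K) - \<theta> (Inf K))) \<le> l)"

(* The contour integral as limit of Riemann-Stieltjes sums.  The integral of the library uses the
   derivative of the path, which a rectifiable path need not have. *)
definition has_curve_integral ::
    "(complex \<Rightarrow> 'v::complex_hilbert_space) \<Rightarrow> 'v \<Rightarrow> (real \<Rightarrow> complex) \<Rightarrow> bool"
  where "has_curve_integral f I \<theta> \<longleftrightarrow>
    (\<forall>\<epsilon>>0. \<exists>\<eta>>0. \<forall>p. p tagged_division_of {0..1} \<and> (\<lambda>t. ball t \<eta>) fine p \<longrightarrow>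
      norm ((\<Sum>(t, K)\<in>p. (\<theta> (Sup K) - \<theta> (Inf K)) *\<^sub>C f (\<theta> t)) - I) < \<epsilon>)"

definition curve_integral :: "(real \<Rightarrow> complex) \<Rightarrow> (complex \<Rightarrow> 'v::complex_hilbert_space) \<Rightarrow> 'v"
  where "curve_integral \<theta> f = (THE I. has_curve_integral f I \<theta>)"

(* The operator-valued integral is evaluated pointwise; on a curve in the resolvent set the
   resolvent is continuous in operator norm, so this is also the norm-convergent integral. *)
definition riesz_projection :: "(real \<Rightarrow> complex) \<Rightarrow> ('v::complex_hilbert_space \<Rightarrow> 'v) \<Rightarrow> 'v \<Rightarrow> 'v"
  where "riesz_projection \<theta> T v =
    (1 / (2 * complex_of_real pi * \<i>)) *\<^sub>C curve_integral \<theta> (\<lambda>\<zeta>. resolvent UNIV T \<zeta> v)"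

end

theory Submission
  imports "HOL-Complex_Analysis.Complex_Analysis"
    "HOL-Computational_Algebra.Fundamental_Theorem_Algebra" Defs
begin

text \<open>Let \<open>V0\<close> be the set of the vectors in \<open>V\<close> that are orthogonal to \<open>E\<close> in \<open>H\<close>.  As \<open>E\<close> is finite
dimensional and contained in \<open>V\<close>, orthogonal projection in \<open>H\<close> splits \<open>V\<close> into \<open>E\<close> and \<open>V0\<close>, and both
are invariant under \<open>S = r(A)\<close>, where \<open>r\<close> is the filter.  The proof has three parts.

The Riesz projection \<open>P\<close> of \<open>S\<close> is, up to the sign \<open>s\<close> given by the orientation of the curve, the
projection onto \<open>E\<close> along \<open>V0\<close>.  On eigenvectors it is multiplication by a winding number.  For \<open>x\<close> in
\<open>V0\<close> and \<open>u\<close> in \<open>H\<close>, the function \<open>\<langle>(\<zeta> - S)\<inverse> x, u\<rangle>\<close> is holomorphic inside the curve except at the finitely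
many points \<open>\<mu> = r(l)\<close> with \<open>l\<close> in the cluster.  There it is bounded, because \<open>r(A) - \<mu>\<close> is
bounded below on the orthogonal complement of \<open>E\<close> in the norm of \<open>H\<close>.  So the singularities are
removable and the contour integral is zero (\<open>riesz_projection_eq_0\<close>).  The resolvents here are those
of \<open>S\<close> on \<open>V\<close>, while the lower bound is in \<open>H\<close>: as \<open>V\<close> may fail to be dense, the curve may meet the
spectrum of \<open>r(A)\<close> on \<open>H\<close>.

The lower bound for \<open>r(A) - \<mu>\<close> (\<open>filter_op_bounded_below_off_cluster\<close>) comes from factoring the
rational function \<open>r - \<mu>\<close> into quotients \<open>(\<xi> - \<xi> j) / (\<xi> - z j)\<close>.  No factor is missing in the
numerator, as the value of \<open>r\<close> at infinity is smaller than \<open>\<bar>\<mu>\<bar>\<close>.  A root \<open>\<xi> j\<close> in the spectrum of \<open>A\<close>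
belongs to the cluster, because \<open>\<bar>r\<bar>\<close> is smaller than \<open>\<bar>\<mu>\<bar>\<close> on the rest of the spectrum; so it is an isolated
point, and off its eigenspace \<open>A - \<xi> j\<close> is bounded below (\<open>bounded_below_isolated_point\<close>).  This follows
from an inequality between quadratic forms that expresses the gap in the spectrum.

The discrete operator \<open>S'\<close> is a multiple of the identity up to finite rank, so \<open>V\<close> is
spanned by its generalised eigenvectors (\<open>gen_eigenspan_finite_rank\<close>), and its Riesz projection
\<open>P'\<close> too is a projection up to the sign \<open>s\<close> (\<open>riesz_projection_square\<close>).  The resolvents of \<open>S'\<close> are
bounded on the curve uniformly in small \<open>h\<close>, hence \<open>P - P'\<close> tends to zero in norm, and on \<open>E\<close> it is
bounded by \<open>S - S'\<close> on \<open>E\<close>.  For projections this controls both halves of the gap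
(\<open>gap_range_le\<close>).

The curve is only rectifiable.  Integrals of holomorphic functions along it are equal to
integrals along a nearby smooth path (\<open>has_curve_integral_contour_integral\<close>), to which Cauchy's
theorem and the definition of the winding number apply.\<close>

section \<open>Complex Hilbert spaces\<close>

interpretation complex_vs: vector_space "scaleC :: complex \<Rightarrow> 'a \<Rightarrow> 'a::complex_hilbert_space"
proof
  show "1 *\<^sub>C x = x" for x :: 'a
    using scaleR_scaleC[of 1 x] by simp
qed (simp_all add: scaleC_add_right scaleC_add_left scaleC_scaleC)

lemma csubspace_iff:
  "csubspace L \<longleftrightarrow> 0 \<in> L \<and> (\<forall>x\<in>L. \<forall>y\<in>L. x + y \<in> L) \<and> (\<forall>c. \<forall>x\<in>L. c *\<^sub>C x \<in> L)"
  by (simp add: complex_vs.subspace_def)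

lemma clinear_iff:
  fixes f :: "'a::complex_hilbert_space \<Rightarrow> 'b::complex_hilbert_space"
  shows "clinear f \<longleftrightarrow> (\<forall>x y. f (x + y) = f x + f y) \<and> (\<forall>c x. f (c *\<^sub>C x) = c *\<^sub>C f x)"
  by (simp add: Vector_Spaces.linear_iff complex_vs.vector_space_axioms)

lemma cinner_add_right: "cinner x (u + v) = cinner x u + cinner x v"
  by (metis cinner_add_left cinner_commute complex_cnj_add)

lemma cinner_scaleC_right: "cinner x (a *\<^sub>C u) = cnj a * cinner x u"
  by (metis cinner_scaleC_left cinner_commute complex_cnj_mult)

lemma cinner_zero_left [simp]: "cinner 0 u = 0"
  using cinner_add_left[of 0 0 u] by simp

lemma cinner_zero_right [simp]: "cinner u 0 = 0"
  using cinner_add_right[of u 0 0] by simp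

lemma cinner_minus_left: "cinner (- x) u = - cinner x u"
  using cinner_add_left[of x "- x" u] by (simp add: eq_neg_iff_add_eq_0 add.commute)

lemma cinner_minus_right: "cinner x (- u) = - cinner x u"
  using cinner_add_right[of x u "- u"] by (simp add: eq_neg_iff_add_eq_0 add.commute)

lemma cinner_diff_left: "cinner (x - y) u = cinner x u - cinner y u"
  using cinner_add_left[of x "- y" u] by (simp add: cinner_minus_left)

lemma cinner_diff_right: "cinner x (u - v) = cinner x u - cinner x v"
  using cinner_add_right[of x u "- v"] by (simp add: cinner_minus_right)

lemmas cinner_algebra = cinner_add_left cinner_add_right cinner_diff_left cinner_diff_right
  cinner_scaleC_left cinner_scaleC_right cinner_minus_left cinner_minus_right

lemma Re_cinner_self: "Re (cinner x x) = (norm x)\<^sup>2"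
  by (simp add: cinner_self)

lemma norm_scaleC [simp]: "norm (a *\<^sub>C x) = cmod a * norm x" for x :: "'a::complex_hilbert_space"
proof -
  have "cinner (a *\<^sub>C x) (a *\<^sub>C x) = a * cnj a * cinner x x"
    by (simp add: cinner_algebra)
  then have "complex_of_real ((norm (a *\<^sub>C x))\<^sup>2) = complex_of_real ((cmod a * norm x)\<^sup>2)"
    by (simp only: cinner_self complex_norm_square[symmetric] power_mult_distrib of_real_mult)
  then show ?thesis
    by (metis norm_ge_zero mult_nonneg_nonneg of_real_eq_iff power2_eq_imp_eq)
qed

lemma bounded_linear_scaleC_right: "bounded_linear (\<lambda>x::'a::complex_hilbert_space. a *\<^sub>C x)"
  by (rule bounded_linear_intro[where K = "cmod a"])
     (simp_all add: scaleC_add_right scaleR_scaleC scaleC_scaleC mult.commute)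

lemma bounded_linear_scaleC_left: "bounded_linear (\<lambda>a. a *\<^sub>C (x::'a::complex_hilbert_space))"
  by (rule bounded_linear_intro[where K = "norm x"])
     (simp_all add: scaleC_add_left scaleR_scaleC scaleC_scaleC scaleR_conv_of_real)

lemma cauchy_schwarz: "cmod (cinner x y) \<le> norm x * norm y"
proof (cases "y = 0")
  case False
  define a where "a = cinner x y / complex_of_real ((norm y)\<^sup>2)"
  have 1: "cinner (x - a *\<^sub>C y) y = 0"
    using False by (simp add: cinner_algebra a_def cinner_self)
  have "cinner x x = cinner (x - a *\<^sub>C y) (x - a *\<^sub>C y) + a * cnj a * cinner y y"
    using 1 by (simp add: cinner_algebra) (metis cinner_commute complex_cnj_mult)
  then have "Re (cinner x x) = (norm (x - a *\<^sub>C y))\<^sup>2 + Re (a * cnj a * cinner y y)"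
    by (simp add: Re_cinner_self)
  also have "a * cnj a * cinner y y = complex_of_real ((cmod a * norm y)\<^sup>2)"
    by (simp only: cinner_self complex_norm_square[symmetric] power_mult_distrib of_real_mult)
  finally have "(cmod a * norm y)\<^sup>2 \<le> (norm x)\<^sup>2"
    by (simp add: Re_cinner_self)
  then have "cmod a * norm y \<le> norm x"
    by (rule power2_le_imp_le) simp
  then have "(cmod a * norm y) * norm y \<le> norm x * norm y"
    by (intro mult_right_mono) auto
  moreover have "(cmod a * norm y) * norm y = cmod (cinner x y)"
    using False by (simp add: a_def norm_divide power2_eq_square norm_mult)
  ultimately show ?thesis by simp
qed simp

lemma bounded_linear_cinner_left: "bounded_linear (\<lambda>x. cinner x u)"
  by (rule bounded_linear_intro[where K = "norm u"])
     (simp_all add: cinner_add_left scaleR_scaleC cinner_scaleC_left scaleR_conv_of_real cauchy_schwarz)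

lemma norm_add_sq:
  "(norm (x + y))\<^sup>2 = (norm x)\<^sup>2 + (norm y)\<^sup>2 + 2 * Re (cinner x y)"
  for x :: "'a::complex_hilbert_space"
proof -
  have "Re (cinner y x) = Re (cinner x y)"
    by (metis cinner_commute cnj.sel(1))
  then show ?thesis
    by (simp add: Re_cinner_self[symmetric] cinner_algebra)
qed

lemma norm_diff_sq:
  "(norm (x - y))\<^sup>2 = (norm x)\<^sup>2 + (norm y)\<^sup>2 - 2 * Re (cinner x y)"
  for x :: "'a::complex_hilbert_space"
  using norm_add_sq[of x "- y"] by (simp add: cinner_minus_right)

lemma cspan_insertE:
  assumes "x \<in> cspan (insert b B)"
  obtains c u where "u \<in> cspan B" "x = c *\<^sub>C b + u"
proof -
  obtain c where c: "x - c *\<^sub>C b \<in> cspan B"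
    using assms unfolding complex_vs.span_insert by blast
  show ?thesis
    by (rule that[OF c, of c]) simp
qed

text \<open>Gram-Schmidt, one vector at a time.\<close>

lemma orthogonal_projection_cspan:
  fixes B :: "'a::complex_hilbert_space set"
  assumes "finite B"
  shows "\<exists>e\<in>cspan B. \<forall>f\<in>cspan B. cinner (x - e) f = 0"
  using assms
proof (induction B arbitrary: x rule: finite_induct)
  case empty
  then show ?case by simp
next
  case (insert b B)
  obtain e where e: "e \<in> cspan B" "\<And>f. f \<in> cspan B \<Longrightarrow> cinner (x - e) f = 0"
    using insert.IH by blast
  obtain g where g: "g \<in> cspan B" "\<And>f. f \<in> cspan B \<Longrightarrow> cinner (b - g) f = 0"
    using insert.IH by blast
  define a where "a = cinner (x - e) (b - g) / complex_of_real ((norm (b - g))\<^sup>2)"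
  have sub: "u \<in> cspan (insert b B)" if "u \<in> cspan B" for u
    using that complex_vs.span_mono[of B "insert b B"] by blast
  have b: "b \<in> cspan (insert b B)"
    by (simp add: complex_vs.span_base)
  have 1: "cinner (x - (e + a *\<^sub>C (b - g))) (b - g) = 0"
    by (cases "b = g") (simp_all add: a_def cinner_self cinner_add_left cinner_diff_left[of x] cinner_scaleC_left)
  have 2: "cinner (x - (e + a *\<^sub>C (b - g))) f = 0" if "f \<in> cspan B" for f
    using e(2)[OF that] g(2)[OF that] by (simp add: cinner_diff_left cinner_add_left cinner_scaleC_left)
  have 3: "cinner (x - (e + a *\<^sub>C (b - g))) f = 0" if f: "f \<in> cspan (insert b B)" for f
  proof -
    obtain c u where u: "u \<in> cspan B" "f = c *\<^sub>C b + u"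
      using cspan_insertE[OF f] by blast
    have "f = c *\<^sub>C (b - g) + (c *\<^sub>C g + u)"
      by (simp add: u complex_vs.scale_right_diff_distrib)
    moreover have "c *\<^sub>C g + u \<in> cspan B"
      by (simp add: u g complex_vs.span_add complex_vs.span_scale)
    ultimately show ?thesis
      using 1 2 by (metis cinner_add_right cinner_scaleC_right add.right_neutral mult_zero_right)
  qed
  show ?case
    using 3 complex_vs.span_add[OF sub[OF e(1)]
        complex_vs.span_scale[OF complex_vs.span_diff[OF b sub[OF g(1)]]]] by blast
qed

lemma finite_dim_csubspace_eq_cspan:
  assumes "csubspace L" "finite_dim L"
  obtains B where "finite B" "L = cspan B"
proof -
  obtain C where C: "finite C" "L \<subseteq> cspan C"
    using assms(2) by (auto simp: finite_dim_def)
  obtain B where B: "B \<subseteq> L" "\<not> complex_vs.dependent B" "L \<subseteq> cspan B"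
    using complex_vs.basis_exists[of L] by metis
  have "finite B"
    using complex_vs.independent_span_bound[of C B] B C by auto
  moreover have "cspan B = L"
    using B assms(1) complex_vs.span_subspace by blast
  ultimately show ?thesis using that by blast
qed

lemma orthogonal_projection_finite_dim:
  fixes L :: "'a::complex_hilbert_space set"
  assumes "csubspace L" "finite_dim L"
  shows "\<exists>e\<in>L. \<forall>f\<in>L. cinner (x - e) f = 0"
  using finite_dim_csubspace_eq_cspan[OF assms] orthogonal_projection_cspan by metis

text \<open>The scalars as a Hilbert space, so that contour integrals of scalar functions are available.\<close>

instantiation complex :: complex_hilbert_space
begin

definition scaleC_complex :: "complex \<Rightarrow> complex \<Rightarrow> complex"
  where "scaleC_complex a x = a * x"

definition cinner_complex :: "complex \<Rightarrow> complex \<Rightarrow> complex"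
  where "cinner_complex x y = x * cnj y"

instance
proof
  show "cinner x x = complex_of_real ((norm x)\<^sup>2)" for x :: complex
    unfolding cinner_complex_def by (rule complex_norm_square[symmetric])
qed (simp_all add: scaleC_complex_def cinner_complex_def algebra_simps scaleR_conv_of_real)

end

definition bounded_clinear :: "('a::complex_hilbert_space \<Rightarrow> 'b::complex_hilbert_space) \<Rightarrow> bool"
  where "bounded_clinear f \<longleftrightarrow> bounded_linear f \<and> (\<forall>c x. f (c *\<^sub>C x) = c *\<^sub>C f x)"

lemma bounded_clinearD:
  assumes "bounded_clinear f"
  shows "bounded_linear f" "f (c *\<^sub>C x) = c *\<^sub>C f x" "f (x + y) = f x + f y"
    "f (x - y) = f x - f y" "f 0 = 0"
  using assms by (simp_all add: bounded_clinear_def linear_simps)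

lemma bounded_clinear_scaleC_left: "bounded_clinear (\<lambda>a. a *\<^sub>C (x::'a::complex_hilbert_space))"
  by (simp add: bounded_clinear_def bounded_linear_scaleC_left scaleC_complex_def scaleC_scaleC)

lemma bounded_clinear_cinner_left: "bounded_clinear (\<lambda>x. cinner x u)"
  by (simp add: bounded_clinear_def bounded_linear_cinner_left scaleC_complex_def cinner_scaleC_left)

lemma bounded_clinear_compose:
  "bounded_clinear f \<Longrightarrow> bounded_clinear g \<Longrightarrow> bounded_clinear (\<lambda>x. f (g x))"
  by (simp add: bounded_clinear_def bounded_linear_compose)

section \<open>Integrals along rectifiable curves\<close>

definition stieltjes_sum ::
    "(real \<Rightarrow> complex) \<Rightarrow> (complex \<Rightarrow> 'v::complex_hilbert_space) \<Rightarrow> (real \<times> real set) set \<Rightarrow> 'v"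
  where "stieltjes_sum \<theta> f p = (\<Sum>(t, K)\<in>p. (\<theta> (Sup K) - \<theta> (Inf K)) *\<^sub>C f (\<theta> t))"

definition variation_le :: "(real \<Rightarrow> complex) \<Rightarrow> real \<Rightarrow> bool"
  where "variation_le \<theta> l \<longleftrightarrow>
    (\<forall>d. d division_of {0..1} \<longrightarrow> (\<Sum>K\<in>d. norm (\<theta> (Sup K) - \<theta> (Inf K))) \<le> l)"

lemma rectifiable_variation_le: "rectifiable \<theta> \<longleftrightarrow> (\<exists>l. variation_le \<theta> l)"
  by (simp add: rectifiable_def variation_le_def)

text \<open>Convergence along this filter is convergence as the mesh tends to 0.  It makes the limit
  theorems for filters available for the integral.\<close>

definition mesh_filter :: "(real \<times> real set) set filter"
  where "mesh_filter = (INF \<eta>\<in>{0<..}. principal {p. p tagged_division_of {0..1} \<and> (\<lambda>t. ball t \<eta>) fine p})"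

lemma eventually_mesh_filter:
  "eventually P mesh_filter \<longleftrightarrow>
    (\<exists>\<eta>>0. \<forall>p. p tagged_division_of {0..1} \<and> (\<lambda>t. ball t \<eta>) fine p \<longrightarrow> P p)"
proof -
  have "eventually P mesh_filter \<longleftrightarrow> (\<exists>\<eta>\<in>{0<..}. eventually P
      (principal {p. p tagged_division_of {0..1::real} \<and> (\<lambda>t. ball t \<eta>) fine p}))"
    unfolding mesh_filter_def
  proof (rule eventually_INF_base)
    fix a b :: real assume "a \<in> {0<..}" "b \<in> {0<..}"
    then show "\<exists>x\<in>{0<..}. principal {p. p tagged_division_of {0..1} \<and> (\<lambda>t. ball t x) fine p}
        \<le> inf (principal {p. p tagged_division_of {0..1} \<and> (\<lambda>t. ball t a) fine p})
            (principal {p. p tagged_division_of {0..1} \<and> (\<lambda>t. ball t b) fine p})"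
      by (intro bexI[of _ "min a b"]) (auto simp: fine_def subset_iff)
  qed auto
  then show ?thesis by (simp add: eventually_principal Bex_def)
qed

lemma mesh_filter_neq_bot: "mesh_filter \<noteq> bot"
proof -
  have "\<exists>p. p tagged_division_of {0..1::real} \<and> (\<lambda>t. ball t \<eta>) fine p" if "\<eta> > 0" for \<eta>
    using fine_division_exists_real[of "\<lambda>t. ball t \<eta>" 0 1] that by (metis gauge_ball)
  then show ?thesis
    unfolding trivial_limit_def eventually_mesh_filter by blast
qed

lemma tagged_division_mesh_filter: "eventually (\<lambda>p. p tagged_division_of {0..1}) mesh_filter"
  unfolding eventually_mesh_filter by (intro exI[of _ 1]) auto

lemma has_curve_integral_iff_tendsto:
  "has_curve_integral f I \<theta> \<longleftrightarrow> (stieltjes_sum \<theta> f \<longlongrightarrow> I) mesh_filter"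
  by (simp add: has_curve_integral_def stieltjes_sum_def tendsto_iff eventually_mesh_filter dist_norm)

lemma tagged_division_01D:
  assumes "p tagged_division_of {0..1::real}" "(t, K) \<in> p"
  shows "K = {Inf K..Sup K}" "Inf K \<le> Sup K" "Inf K \<le> t" "t \<le> Sup K" "0 \<le> Inf K" "Sup K \<le> 1"
    "Sup K \<in> K" "Inf K \<in> K" "t \<in> K" "K \<subseteq> {0..1}"
proof -
  obtain a b where ab: "K = {a..b}"
    using tagged_division_ofD(4)[OF assms] by auto
  have tK: "t \<in> K" "K \<subseteq> {0..1}"
    using tagged_division_ofD(2,3)[OF assms] by auto
  with ab have "a \<le> b" by auto
  with ab tK show "K = {Inf K..Sup K}" "Inf K \<le> Sup K" "Inf K \<le> t" "t \<le> Sup K" "0 \<le> Inf K"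
    "Sup K \<le> 1" "Sup K \<in> K" "Inf K \<in> K" "t \<in> K" "K \<subseteq> {0..1}"
    by auto
qed

lemma fine_ballD:
  assumes "(\<lambda>t. ball t \<eta>) fine p" "(t, K) \<in> p" "s \<in> K"
  shows "\<bar>t - s\<bar> < \<eta>"
  using assms by (force simp: fine_def dist_real_def)

lemma variation_tagged:
  assumes "variation_le \<theta> l" "p tagged_division_of {0..1}"
  shows "(\<Sum>(t, K)\<in>p. cmod (\<theta> (Sup K) - \<theta> (Inf K))) \<le> l"
proof -
  define d where "d = (\<lambda>K. if K = {} then 0 else cmod (\<theta> (Sup K) - \<theta> (Inf K)))"
  have *: "d K = cmod (\<theta> (Sup K) - \<theta> (Inf K))" if "(t, K) \<in> p" for t K
    using tagged_division_01D(9)[OF assms(2) that] by (auto simp: d_def)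
  have "(\<Sum>(t, K)\<in>p. cmod (\<theta> (Sup K) - \<theta> (Inf K))) = (\<Sum>(t, K)\<in>p. d K)"
    by (intro sum.cong) (auto simp: *)
  also have "\<dots> = (\<Sum>K\<in>snd ` p. d K)"
    by (rule sum.over_tagged_division_lemma[OF assms(2)]) (auto simp: d_def)
  also have "\<dots> = (\<Sum>K\<in>snd ` p. cmod (\<theta> (Sup K) - \<theta> (Inf K)))"
    by (intro sum.cong) (auto simp: *)
  also have "\<dots> \<le> l"
    using assms(1) division_of_tagged_division[OF assms(2)] by (auto simp: variation_le_def)
  finally show ?thesis .
qed

lemma variation_le_nonneg:
  assumes "variation_le \<theta> l"
  shows "l \<ge> 0"
proof -
  obtain p where p: "p tagged_division_of {0..1::real}"
    using eventually_happens[OF tagged_division_mesh_filter] mesh_filter_neq_bot by auto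
  have "0 \<le> (\<Sum>(t, K)\<in>p. cmod (\<theta> (Sup K) - \<theta> (Inf K)))"
    by (intro sum_nonneg) auto
  with variation_tagged[OF assms p] show ?thesis by linarith
qed

lemma norm_stieltjes_sum_le:
  assumes "variation_le \<theta> l" "p tagged_division_of {0..1}"
    and "\<And>\<zeta>. \<zeta> \<in> path_image \<theta> \<Longrightarrow> norm (f \<zeta>) \<le> B"
  shows "norm (stieltjes_sum \<theta> f p) \<le> l * B"
proof -
  have "\<theta> 0 \<in> path_image \<theta>" by (simp add: path_image_def)
  then have B: "B \<ge> 0" using assms(3) norm_ge_zero order_trans by blast
  have "norm (stieltjes_sum \<theta> f p) \<le> (\<Sum>(t, K)\<in>p. cmod (\<theta> (Sup K) - \<theta> (Inf K)) * B)"
    unfolding stieltjes_sum_def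
  proof (rule sum_norm_le, clarsimp)
    fix t K assume tK: "(t, K) \<in> p"
    have "\<theta> t \<in> path_image \<theta>"
      using tagged_division_01D(9,10)[OF assms(2) tK] by (auto simp: path_image_def)
    then show "cmod (\<theta> (Sup K) - \<theta> (Inf K)) * norm (f (\<theta> t)) \<le> cmod (\<theta> (Sup K) - \<theta> (Inf K)) * B"
      by (intro mult_left_mono assms(3)) auto
  qed
  also have "\<dots> = (\<Sum>(t, K)\<in>p. cmod (\<theta> (Sup K) - \<theta> (Inf K))) * B"
    by (simp add: sum_distrib_right case_prod_unfold)
  also have "\<dots> \<le> l * B"
    using variation_tagged[OF assms(1,2)] B by (intro mult_right_mono) auto
  finally show ?thesis .
qed

lemma has_curve_integral_unique:
  "has_curve_integral f I \<theta> \<Longrightarrow> has_curve_integral f J \<theta> \<Longrightarrow> I = J"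
  unfolding has_curve_integral_iff_tendsto by (rule tendsto_unique[OF mesh_filter_neq_bot])

lemma curve_integral_eq: "has_curve_integral f I \<theta> \<Longrightarrow> curve_integral \<theta> f = I"
  unfolding curve_integral_def by (rule the_equality) (auto intro: has_curve_integral_unique)

lemma has_curve_integral_linear:
  assumes "has_curve_integral f I \<theta>" "bounded_clinear T"
  shows "has_curve_integral (\<lambda>\<zeta>. T (f \<zeta>)) (T I) \<theta>"
proof -
  interpret T: bounded_linear T
    using assms(2) by (simp add: bounded_clinear_def)
  have "stieltjes_sum \<theta> (\<lambda>\<zeta>. T (f \<zeta>)) = (\<lambda>p. T (stieltjes_sum \<theta> f p))"
    by (simp add: stieltjes_sum_def T.sum case_prod_unfold bounded_clinearD(2)[OF assms(2)] fun_eq_iff)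
  then show ?thesis
    using T.tendsto assms(1) by (simp add: has_curve_integral_iff_tendsto)
qed

lemma has_curve_integral_add:
  assumes "has_curve_integral f I \<theta>" "has_curve_integral g J \<theta>"
  shows "has_curve_integral (\<lambda>\<zeta>. f \<zeta> + g \<zeta>) (I + J) \<theta>"
proof -
  have "stieltjes_sum \<theta> (\<lambda>\<zeta>. f \<zeta> + g \<zeta>) = (\<lambda>p. stieltjes_sum \<theta> f p + stieltjes_sum \<theta> g p)"
    by (simp add: stieltjes_sum_def sum.distrib[symmetric] case_prod_unfold scaleC_add_right fun_eq_iff)
  then show ?thesis
    using tendsto_add assms by (simp add: has_curve_integral_iff_tendsto)
qed

lemma has_curve_integral_scaleC:
  assumes "has_curve_integral f I \<theta>"
  shows "has_curve_integral (\<lambda>\<zeta>. c *\<^sub>C f \<zeta>) (c *\<^sub>C I) \<theta>"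
  using assms
  by (rule has_curve_integral_linear)
     (simp add: bounded_clinear_def bounded_linear_scaleC_right scaleC_scaleC mult.commute)

lemma has_curve_integral_diff:
  assumes "has_curve_integral f I \<theta>" "has_curve_integral g J \<theta>"
  shows "has_curve_integral (\<lambda>\<zeta>. f \<zeta> - g \<zeta>) (I - J) \<theta>"
  using has_curve_integral_add[OF assms(1) has_curve_integral_scaleC[OF assms(2), of "-1"]] by simp

lemma has_curve_integral_0: "has_curve_integral (\<lambda>\<zeta>. 0 :: 'v::complex_hilbert_space) 0 \<theta>"
proof -
  have "stieltjes_sum \<theta> (\<lambda>\<zeta>. 0 :: 'v) = (\<lambda>p. 0)"
    by (rule ext) (simp add: stieltjes_sum_def case_prod_unfold)
  then show ?thesis by (simp add: has_curve_integral_iff_tendsto)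
qed

lemma has_curve_integral_sum:
  assumes "finite X" "\<And>i. i \<in> X \<Longrightarrow> has_curve_integral (f i) (I i) \<theta>"
  shows "has_curve_integral (\<lambda>\<zeta>. \<Sum>i\<in>X. f i \<zeta>) (\<Sum>i\<in>X. I i) \<theta>"
  using assms
  by (induction X rule: finite_induct) (auto intro!: has_curve_integral_0 has_curve_integral_add)

lemma has_curve_integral_cong:
  assumes "has_curve_integral f I \<theta>" "\<And>\<zeta>. \<zeta> \<in> path_image \<theta> \<Longrightarrow> f \<zeta> = g \<zeta>"
  shows "has_curve_integral g I \<theta>"
proof -
  have "stieltjes_sum \<theta> f p = stieltjes_sum \<theta> g p" if p: "p tagged_division_of {0..1}" for p
  proof -
    have "\<theta> t \<in> path_image \<theta>" if "(t, K) \<in> p" for t K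
      using tagged_division_01D(9,10)[OF p that] by (auto simp: path_image_def)
    then show ?thesis
      unfolding stieltjes_sum_def by (intro sum.cong) (auto simp: assms(2))
  qed
  then have "eventually (\<lambda>p. stieltjes_sum \<theta> f p = stieltjes_sum \<theta> g p) mesh_filter"
    using tagged_division_mesh_filter by (auto elim: eventually_mono)
  then show ?thesis
    using assms(1) tendsto_cong unfolding has_curve_integral_iff_tendsto by blast
qed

lemma norm_curve_integral_le:
  assumes "has_curve_integral f I \<theta>" "variation_le \<theta> l"
    and "\<And>\<zeta>. \<zeta> \<in> path_image \<theta> \<Longrightarrow> norm (f \<zeta>) \<le> B"
  shows "norm I \<le> l * B"
proof (rule tendsto_upperbound[OF _ _ mesh_filter_neq_bot])
  show "((\<lambda>p. norm (stieltjes_sum \<theta> f p)) \<longlongrightarrow> norm I) mesh_filter"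
    using assms(1) unfolding has_curve_integral_iff_tendsto by (rule tendsto_norm)
  show "eventually (\<lambda>p. norm (stieltjes_sum \<theta> f p) \<le> l * B) mesh_filter"
    using tagged_division_mesh_filter
    by (rule eventually_mono) (rule norm_stieltjes_sum_le[OF assms(2) _ assms(3)])
qed

text \<open>The increment of \<open>\<theta>\<close> over the intersection of the intervals \<open>K\<close> and \<open>L\<close>.
  Clamping the end points of \<open>L\<close> to \<open>K\<close> gives the value 0 automatically when the
  intervals do not meet, and makes the increments telescope in \<open>L\<close>.\<close>

definition clamp_to :: "real set \<Rightarrow> real \<Rightarrow> real"
  where "clamp_to K x = max (Inf K) (min (Sup K) x)"

definition overlap :: "(real \<Rightarrow> complex) \<Rightarrow> real set \<Rightarrow> real set \<Rightarrow> complex"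
  where "overlap \<theta> K L = \<theta> (clamp_to K (Sup L)) - \<theta> (clamp_to K (Inf L))"

lemma overlap_interval:
  assumes "K = {Inf K..Sup K}" "Inf K \<le> Sup K" "L = {Inf L..Sup L}" "Inf L \<le> Sup L"
  shows "overlap \<theta> K L = (if K \<inter> L = {} then 0 else \<theta> (Sup (K \<inter> L)) - \<theta> (Inf (K \<inter> L)))"
proof -
  have KL: "K \<inter> L = {max (Inf K) (Inf L)..min (Sup K) (Sup L)}"
    by (subst assms(1), subst assms(3)) auto
  show ?thesis
  proof (cases "max (Inf K) (Inf L) \<le> min (Sup K) (Sup L)")
    case True
    then have "Sup (K \<inter> L) = clamp_to K (Sup L)" "Inf (K \<inter> L) = clamp_to K (Inf L)"
      unfolding KL clamp_to_def using assms by auto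
    with True show ?thesis by (auto simp: overlap_def KL)
  next
    case False
    then have "clamp_to K (Sup L) = clamp_to K (Inf L)"
      unfolding clamp_to_def using assms by (auto simp: max_def min_def)
    moreover have "K \<inter> L = {}" using False unfolding KL by auto
    ultimately show ?thesis by (simp add: overlap_def)
  qed
qed

lemma sum_overlap:
  assumes "q tagged_division_of {0..1}" "Inf K \<le> Sup K" "0 \<le> Inf K" "Sup K \<le> 1"
  shows "(\<Sum>(t, L)\<in>q. overlap \<theta> K L) = \<theta> (Sup K) - \<theta> (Inf K)"
  using additive_tagged_division_1[of 0 1 q "\<lambda>x. \<theta> (clamp_to K x)"] assms
  by (simp add: overlap_def clamp_to_def max_def)

text \<open>The nonempty intersections of the intervals of two divisions form a division.  Two pairs of intervals
  have the same intersection only if it is degenerate, and then its increment is 0.\<close>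

lemma sum_norm_overlap_le:
  assumes \<theta>: "variation_le \<theta> l" and p: "p tagged_division_of {0..1}" and q: "q tagged_division_of {0..1}"
  shows "(\<Sum>(x, y)\<in>p \<times> q. cmod (overlap \<theta> (snd x) (snd y))) \<le> l"
proof -
  have fin: "finite p" "finite q"
    using p q by auto
  define g where "g = (\<lambda>K. cmod (\<theta> (Sup K) - \<theta> (Inf K)))"
  define Q where "Q = {(x, y) \<in> p \<times> q. snd x \<inter> snd y \<noteq> {}}"
  define m where "m = (\<lambda>(x :: real \<times> real set, y :: real \<times> real set). snd x \<inter> snd y)"
  have finQ: "finite Q"
    using fin by (auto simp: Q_def intro: finite_subset[of _ "p \<times> q"])
  have ov: "overlap \<theta> (snd x) (snd y) = (if snd x \<inter> snd y = {} then 0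
      else \<theta> (Sup (snd x \<inter> snd y)) - \<theta> (Inf (snd x \<inter> snd y)))" if "x \<in> p" "y \<in> q" for x y
    using tagged_division_01D(1,2)[OF p, of "fst x" "snd x"] tagged_division_01D(1,2)[OF q, of "fst y" "snd y"] that
    by (intro overlap_interval) auto
  have deg: "g (A \<inter> B) = 0" if AB0: "interior (A \<inter> B) = {}" "A \<inter> B \<noteq> {}"
      "A = {Inf A..Sup A}" "B = {Inf B..Sup B}" for A B :: "real set"
  proof -
    obtain a b where AB: "A \<inter> B = {a..b}"
      using Int_atLeastAtMost[of "Inf A" "Sup A" "Inf B" "Sup B"] unfolding AB0(3,4)[symmetric] by blast
    have "a = b"
      using AB0(1,2) unfolding AB by (auto simp: interior_atLeastAtMost_real)
    then show ?thesis unfolding g_def AB by simp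
  qed
  have mQ: "m ` Q = {k1 \<inter> k2 | k1 k2. k1 \<in> snd ` p \<and> k2 \<in> snd ` q \<and> k1 \<inter> k2 \<noteq> {}}" (is "_ = ?D")
  proof (intro equalityI subsetI)
    fix X assume "X \<in> m ` Q"
    then obtain z where z: "z \<in> Q" "X = m z" by auto
    then have "snd (fst z) \<in> snd ` p" "snd (snd z) \<in> snd ` q" "snd (fst z) \<inter> snd (snd z) \<noteq> {}"
        "X = snd (fst z) \<inter> snd (snd z)"
      by (auto simp: Q_def m_def case_prod_unfold)
    then show "X \<in> ?D" by blast
  next
    fix X assume "X \<in> ?D"
    then obtain x y where xy: "x \<in> p" "y \<in> q" "X = snd x \<inter> snd y" "snd x \<inter> snd y \<noteq> {}"
      by blast
    then have "(x, y) \<in> Q" "m (x, y) = X"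
      by (auto simp: Q_def m_def)
    then show "X \<in> m ` Q" by (rule_tac image_eqI) auto
  qed
  have "(\<Sum>(x, y)\<in>p \<times> q. cmod (overlap \<theta> (snd x) (snd y))) = (\<Sum>z\<in>p \<times> q. cmod (overlap \<theta> (snd (fst z)) (snd (snd z))))"
    by (simp add: case_prod_unfold)
  also have "\<dots> = (\<Sum>z\<in>Q. g (m z))"
  proof (rule sum.mono_neutral_cong_right)
    show "finite (p \<times> q)" "Q \<subseteq> p \<times> q"
      using fin unfolding Q_def by auto
    show "\<forall>z\<in>p \<times> q - Q. cmod (overlap \<theta> (snd (fst z)) (snd (snd z))) = 0"
    proof
      fix z assume "z \<in> p \<times> q - Q"
      then have "fst z \<in> p" "snd z \<in> q" "snd (fst z) \<inter> snd (snd z) = {}"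
        by (auto simp: Q_def)
      then show "cmod (overlap \<theta> (snd (fst z)) (snd (snd z))) = 0"
        by (simp add: ov)
    qed
    fix z assume "z \<in> Q"
    then have "fst z \<in> p" "snd z \<in> q" "snd (fst z) \<inter> snd (snd z) \<noteq> {}"
      by (auto simp: Q_def)
    then show "cmod (overlap \<theta> (snd (fst z)) (snd (snd z))) = g (m z)"
      by (simp add: ov g_def m_def case_prod_unfold)
  qed
  also have "\<dots> = (\<Sum>K\<in>m ` Q. g K)"
  proof (rule sum.reindex_nontrivial[OF finQ, symmetric, unfolded o_def])
    fix z z' assume z: "z \<in> Q" "z' \<in> Q" "z \<noteq> z'" "m z = m z'"
    obtain s K t L s' K' t' L' where zz: "z = ((s, K), (t, L))" "z' = ((s', K'), (t', L'))"
      by (metis surj_pair)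
    have mem: "(s, K) \<in> p" "(t, L) \<in> q" "(s', K') \<in> p" "(t', L') \<in> q" "K \<inter> L \<noteq> {}" "K \<inter> L = K' \<inter> L'"
      using z by (auto simp: zz Q_def m_def)
    have int: "interior (K \<inter> L) \<subseteq> interior K" "interior (K \<inter> L) \<subseteq> interior L"
      by (auto intro!: interior_mono[THEN subsetD])
    have int': "interior (K \<inter> L) \<subseteq> interior K'" "interior (K \<inter> L) \<subseteq> interior L'"
      unfolding mem(6) by (auto intro!: interior_mono[THEN subsetD])
    have "interior (K \<inter> L) = {}"
    proof (cases "(s, K) = (s', K')")
      case False
      then have "interior K \<inter> interior K' = {}"
        using tagged_division_ofD(5)[OF p mem(1,3)] by auto
      then show ?thesis
        using int int' by blast
    next
      case True
      then have "(t, L) \<noteq> (t', L')" using z(3) zz by auto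
      then have "interior L \<inter> interior L' = {}"
        using tagged_division_ofD(5)[OF q mem(2,4)] by auto
      then show ?thesis
        using int int' by blast
    qed
    then show "g (m z) = 0"
      using deg[OF _ mem(5) tagged_division_01D(1)[OF p mem(1)] tagged_division_01D(1)[OF q mem(2)]]
      by (simp add: m_def zz)
  qed
  also have "\<dots> \<le> l"
    unfolding mQ
    using division_inter[OF division_of_tagged_division[OF p] division_of_tagged_division[OF q]] \<theta>
    by (simp add: variation_le_def g_def)
  finally show ?thesis .
qed

lemma stieltjes_sum_refine:
  assumes p: "p tagged_division_of {0..1}" and q: "q tagged_division_of {0..1}"
  shows "stieltjes_sum \<theta> f p = (\<Sum>x\<in>p. \<Sum>y\<in>q. overlap \<theta> (snd x) (snd y) *\<^sub>C f (\<theta> (fst x)))"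
proof -
  have "(\<theta> (Sup (snd x)) - \<theta> (Inf (snd x))) *\<^sub>C f (\<theta> (fst x)) =
      (\<Sum>y\<in>q. overlap \<theta> (snd x) (snd y) *\<^sub>C f (\<theta> (fst x)))" if "x \<in> p" for x
    using sum_overlap[OF q, of "snd x" \<theta>] tagged_division_01D(2,5,6)[OF p, of "fst x" "snd x"] that
    by (simp add: complex_vs.scale_sum_left[symmetric] case_prod_unfold)
  then show ?thesis
    unfolding stieltjes_sum_def by (simp add: case_prod_unfold)
qed

text \<open>Two Riemann-Stieltjes sums are compared on the common refinement of their divisions.\<close>

lemma stieltjes_sum_close:
  assumes \<theta>: "variation_le \<theta> l" and p: "p tagged_division_of {0..1}" and q: "q tagged_division_of {0..1}"
    and fine: "(\<lambda>t. ball t \<eta>) fine p" "(\<lambda>t. ball t \<eta>) fine q"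
    and osc: "\<And>s t. s \<in> {0..1} \<Longrightarrow> t \<in> {0..1} \<Longrightarrow> \<bar>s - t\<bar> < 2 * \<eta> \<Longrightarrow> norm (f (\<theta> s) - f (\<theta> t)) \<le> \<epsilon>"
    and \<epsilon>: "\<epsilon> \<ge> 0"
  shows "norm (stieltjes_sum \<theta> f p - stieltjes_sum \<theta> f q) \<le> l * \<epsilon>"
proof -
  have sym: "overlap \<theta> (snd y) (snd x) = overlap \<theta> (snd x) (snd y)" if "x \<in> p" "y \<in> q" for x y
    using tagged_division_01D(1,2)[OF p, of "fst x" "snd x"] tagged_division_01D(1,2)[OF q, of "fst y" "snd y"] that
    by (simp add: overlap_interval Int_commute)
  have "stieltjes_sum \<theta> f q = (\<Sum>x\<in>p. \<Sum>y\<in>q. overlap \<theta> (snd x) (snd y) *\<^sub>C f (\<theta> (fst y)))"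
    unfolding stieltjes_sum_refine[OF q p] by (subst sum.swap) (simp add: sym cong: sum.cong)
  then have "stieltjes_sum \<theta> f p - stieltjes_sum \<theta> f q =
      (\<Sum>(x, y)\<in>p \<times> q. overlap \<theta> (snd x) (snd y) *\<^sub>C (f (\<theta> (fst x)) - f (\<theta> (fst y))))"
    unfolding stieltjes_sum_refine[OF p q]
    by (simp add: sum.cartesian_product[symmetric] sum_subtractf[symmetric] complex_vs.scale_right_diff_distrib)
  also have "norm \<dots> \<le> (\<Sum>(x, y)\<in>p \<times> q. cmod (overlap \<theta> (snd x) (snd y)) * \<epsilon>)"
  proof (rule sum_norm_le, clarify)
    fix s K t L assume mem: "(s, K) \<in> p" "(t, L) \<in> q"
    note K = tagged_division_01D[OF p mem(1)] and L = tagged_division_01D[OF q mem(2)]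
    show "norm (overlap \<theta> (snd (s, K)) (snd (t, L)) *\<^sub>C (f (\<theta> (fst (s, K))) - f (\<theta> (fst (t, L)))))
        \<le> cmod (overlap \<theta> (snd (s, K)) (snd (t, L))) * \<epsilon>"
    proof (cases "K \<inter> L = {}")
      case True
      then show ?thesis using overlap_interval[OF K(1,2) L(1,2)] by simp
    next
      case False
      then obtain x where "x \<in> K" "x \<in> L" by auto
      then have "\<bar>s - t\<bar> < 2 * \<eta>"
        using fine_ballD[OF fine(1) mem(1), of x] fine_ballD[OF fine(2) mem(2), of x] by linarith
      then have "norm (f (\<theta> s) - f (\<theta> t)) \<le> \<epsilon>"
        using K(9,10) L(9,10) by (intro osc) auto
      then show ?thesis by (auto intro!: mult_left_mono)
    qed
  qed
  also have "\<dots> = (\<Sum>(x, y)\<in>p \<times> q. cmod (overlap \<theta> (snd x) (snd y))) * \<epsilon>"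
    by (simp add: sum_distrib_right case_prod_unfold)
  also have "\<dots> \<le> l * \<epsilon>"
    using sum_norm_overlap_le[OF \<theta> p q] \<epsilon> by (rule mult_right_mono)
  finally show ?thesis .
qed

text \<open>The Riemann-Stieltjes sums are Cauchy along the mesh filter.\<close>

theorem curve_integral_exists:
  fixes f :: "complex \<Rightarrow> 'v::complex_hilbert_space"
  assumes "path \<theta>" "variation_le \<theta> l" "continuous_on (path_image \<theta>) f"
  shows "\<exists>I. has_curve_integral f I \<theta>"
proof -
  have "l \<ge> 0" using assms(2) by (rule variation_le_nonneg)
  have uc: "uniformly_continuous_on {0..1} (\<lambda>t. f (\<theta> t))"
    using assms(1,3) by (auto intro!: compact_uniformly_continuous continuous_on_compose2[of "path_image \<theta>" f "{0..1}" \<theta>] simp: path_def path_image_def)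
  have "cauchy_filter (filtermap (stieltjes_sum \<theta> f) mesh_filter)"
    unfolding cauchy_filter_metric_filtermap
  proof (intro allI impI)
    fix \<epsilon> :: real assume "\<epsilon> > 0"
    then have "\<epsilon> / (l + 1) > 0" using \<open>l \<ge> 0\<close> by simp
    from uc[unfolded uniformly_continuous_on_def, rule_format, OF this] obtain \<eta> where \<eta>: "\<eta> > 0"
        "\<And>s t. s \<in> {0..1} \<Longrightarrow> t \<in> {0..1} \<Longrightarrow> \<bar>s - t\<bar> < \<eta> \<Longrightarrow> norm (f (\<theta> s) - f (\<theta> t)) < \<epsilon> / (l + 1)"
      unfolding dist_norm real_norm_def by auto
    define F where "F = (\<lambda>p. p tagged_division_of {0..1::real} \<and> (\<lambda>t. ball t (\<eta> / 2)) fine p)"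
    have "dist (stieltjes_sum \<theta> f p) (stieltjes_sum \<theta> f q) < \<epsilon>" if "F p" "F q" for p q
    proof -
      have "norm (stieltjes_sum \<theta> f p - stieltjes_sum \<theta> f q) \<le> l * (\<epsilon> / (l + 1))"
      proof (rule stieltjes_sum_close[OF assms(2)])
        show "norm (f (\<theta> s) - f (\<theta> t)) \<le> \<epsilon> / (l + 1)"
          if "s \<in> {0..1}" "t \<in> {0..1}" "\<bar>s - t\<bar> < 2 * (\<eta> / 2)" for s t
          using \<eta>(2)[of s t] that by simp
      qed (use that \<open>\<epsilon> / (l + 1) > 0\<close> in \<open>auto simp: F_def\<close>)
      also have "\<dots> < \<epsilon>" using \<open>\<epsilon> > 0\<close> \<open>l \<ge> 0\<close> by (simp add: field_simps)
      finally show ?thesis by (simp add: dist_norm)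
    qed
    moreover have "eventually F mesh_filter"
      unfolding eventually_mesh_filter F_def using \<eta>(1) by (intro exI[of _ "\<eta> / 2"]) auto
    ultimately show "\<exists>P. eventually P mesh_filter \<and>
        (\<forall>p q. P p \<and> P q \<longrightarrow> dist (stieltjes_sum \<theta> f p) (stieltjes_sum \<theta> f q) < \<epsilon>)" by blast
  qed
  then have "\<exists>I. filtermap (stieltjes_sum \<theta> f) mesh_filter \<le> nhds I"
    by (rule cauchy_filter_complete_converges[OF _ complete_UNIV])
       (auto simp: filtermap_bot_iff mesh_filter_neq_bot)
  then show ?thesis by (simp add: has_curve_integral_iff_tendsto filterlim_def)
qed

text \<open>The functional \<open>H x\<close>, the integral of \<open>f\<close> over the part of \<open>g\<close> up to parameter \<open>x\<close> followed by the
  segment from \<open>g x\<close> to \<open>\<theta> x\<close>, telescopes over every tagged division.  Over a short interval its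
  increment is that of a local primitive of \<open>f\<close> along \<open>\<theta>\<close>, hence close to a term of the
  Riemann-Stieltjes sum.\<close>

theorem has_curve_integral_contour_integral:
  assumes \<theta>: "path \<theta>" "pathfinish \<theta> = pathstart \<theta>" "rectifiable \<theta>"
    and U: "open U" "path_image \<theta> \<subseteq> U"
  shows "\<exists>d>0. \<forall>g. valid_path g \<and> pathfinish g = pathstart g \<and> (\<forall>t\<in>{0..1}. cmod (g t - \<theta> t) < d) \<longrightarrow>
    path_image g \<subseteq> U \<and> (\<forall>f. f holomorphic_on U \<longrightarrow> has_curve_integral f (contour_integral g f) \<theta>)"
proof -
  obtain l where l: "variation_le \<theta> l"
    using \<theta>(3) by (auto simp: rectifiable_variation_le)
  have "l \<ge> 0" using l by (rule variation_le_nonneg)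
  have cont\<theta>: "continuous_on {0..1} \<theta>"
    using \<theta>(1) by (simp add: path_def)
  have compact: "compact (path_image \<theta>)"
    using \<theta>(1) by (rule compact_path_image)
  obtain e where e: "e > 0" "(\<Union>x\<in>path_image \<theta>. cball x e) \<subseteq> U"
    using compact_subset_open_imp_cball_epsilon_subset[OF compact U] by blast
  define C where "C = {x + y | x y. x \<in> path_image \<theta> \<and> y \<in> cball 0 e}"
  have C: "compact C" "C \<subseteq> U" "\<And>t x. t \<in> {0..1} \<Longrightarrow> dist (\<theta> t) x \<le> e \<Longrightarrow> x \<in> C"
  proof -
    show "compact C"
      unfolding C_def by (intro compact_sums compact compact_cball)
    show "C \<subseteq> U"
    proof
      fix z assume "z \<in> C"
      then obtain x y where xy: "z = x + y" "x \<in> path_image \<theta>" "norm y \<le> e"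
        by (auto simp: C_def)
      then have "z \<in> cball x e" by (simp add: dist_norm)
      then show "z \<in> U" using e(2) xy(2) by blast
    qed
    show "x \<in> C" if "t \<in> {0..1}" "dist (\<theta> t) x \<le> e" for t x
    proof -
      have "x = \<theta> t + (x - \<theta> t)" "\<theta> t \<in> path_image \<theta>" "x - \<theta> t \<in> cball 0 e"
        using that by (auto simp: path_image_def dist_norm norm_minus_commute)
      then show ?thesis unfolding C_def by blast
    qed
  qed
  have "path_image g \<subseteq> U \<and> (\<forall>f. f holomorphic_on U \<longrightarrow> has_curve_integral f (contour_integral g f) \<theta>)"
    if g: "valid_path g" "pathfinish g = pathstart g" "\<And>t. t \<in> {0..1} \<Longrightarrow> cmod (g t - \<theta> t) < e / 2" for g
  proof (intro conjI allI impI)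
    show gU: "path_image g \<subseteq> U"
    proof
      fix z assume "z \<in> path_image g"
      then obtain t where t: "t \<in> {0..1}" "z = g t" by (auto simp: path_image_def)
      have "dist (\<theta> t) z \<le> e"
        using g(3)[OF t(1)] e(1) t(2) by (simp add: dist_norm norm_minus_commute)
      then show "z \<in> U" using C(2,3) t(1) by blast
    qed
    fix f assume f: "f holomorphic_on U"
    have contf: "continuous_on U f" using f by (rule holomorphic_on_imp_continuous_on)
    have f_int: "f contour_integrable_on g"
      using contour_integrable_holomorphic_simple[OF f U(1) g(1) gU] .
    define H where "H = (\<lambda>x. contour_integral (subpath 0 x g) f + contour_integral (linepath (g x) (\<theta> x)) f)"
    have H01: "H 1 - H 0 = contour_integral g f"
      using g(2) \<theta>(2) by (simp add: H_def pathfinish_def pathstart_def)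
    show "has_curve_integral f (contour_integral g f) \<theta>"
      unfolding has_curve_integral_iff_tendsto tendsto_iff eventually_mesh_filter dist_norm
    proof (intro allI impI)
      fix \<epsilon> :: real assume "\<epsilon> > 0"
      define \<epsilon>' where "\<epsilon>' = \<epsilon> / (l + 1)"
      have \<epsilon>': "\<epsilon>' > 0" "l * \<epsilon>' < \<epsilon>"
        using \<open>\<epsilon> > 0\<close> \<open>l \<ge> 0\<close> by (simp_all add: \<epsilon>'_def field_simps)
      have "uniformly_continuous_on C f"
        using C contf by (intro compact_uniformly_continuous) (auto intro: continuous_on_subset)
      then obtain \<tau> where \<tau>: "\<tau> > 0" "\<And>x y. x \<in> C \<Longrightarrow> y \<in> C \<Longrightarrow> dist y x < \<tau> \<Longrightarrow> dist (f y) (f x) < \<epsilon>'"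
        unfolding uniformly_continuous_on_def using \<epsilon>'(1) by meson
      define r where "r = min (e / 2) \<tau>"
      have r: "r > 0" using e \<tau> by (simp add: r_def)
      have "uniformly_continuous_on {0..1} \<theta>"
        using cont\<theta> by (intro compact_uniformly_continuous) auto
      then obtain \<eta> where \<eta>: "\<eta> > 0" "\<And>s t. s \<in> {0..1} \<Longrightarrow> t \<in> {0..1} \<Longrightarrow> dist t s < \<eta> \<Longrightarrow> dist (\<theta> t) (\<theta> s) < r"
        unfolding uniformly_continuous_on_def using r by meson
      have main: "norm (stieltjes_sum \<theta> f p - contour_integral g f) < \<epsilon>"
        if p: "p tagged_division_of {0..1}" "(\<lambda>t. ball t \<eta>) fine p" for p
      proof -
        have trm: "norm ((\<theta> (Sup K) - \<theta> (Inf K)) * f (\<theta> s) - (H (Sup K) - H (Inf K))) \<le> cmod (\<theta> (Sup K) - \<theta> (Inf K)) * \<epsilon>'"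
          if sK: "(s, K) \<in> p" for s K
        proof -
          define a b where "a = Inf K" and "b = Sup K"
          note K = tagged_division_01D[OF p(1) sK]
          have ab: "a \<le> b" "a \<in> {0..1}" "b \<in> {0..1}" "s \<in> {0..1}"
            using K by (auto simp: a_def b_def)
          have near: "dist (\<theta> s) (\<theta> t) < r" "dist (\<theta> s) (g t) < e" if "t \<in> {a..b}" for t
          proof -
            have "t \<in> K" "t \<in> {0..1}" using that K(1,10) by (auto simp: a_def b_def)
            then show 1: "dist (\<theta> s) (\<theta> t) < r"
              using \<eta>(2)[of s t] ab fine_ballD[OF p(2) sK, of t]
              by (simp add: dist_commute dist_real_def)
            have "dist (\<theta> t) (g t) < e / 2"
              using g(3) \<open>t \<in> {0..1}\<close> by (simp add: dist_norm norm_minus_commute)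
            then show "dist (\<theta> s) (g t) < e"
              using 1 dist_triangle[of "\<theta> s" "g t" "\<theta> t"] by (simp add: r_def)
          qed
          have ballU: "ball (\<theta> s) e \<subseteq> C"
            using C(3) ab(4) by (auto intro: less_imp_le)
          obtain F where F: "\<And>x. x \<in> ball (\<theta> s) e \<Longrightarrow> (F has_field_derivative f x) (at x within ball (\<theta> s) e)"
            using holomorphic_convex_primitive'[of "ball (\<theta> s) e" f] ballU C(2) f
            by (meson convex_ball holomorphic_on_subset open_ball order_trans)
          have prim: "contour_integral c f = F (pathfinish c) - F (pathstart c)"
            if "valid_path c" "path_image c \<subseteq> ball (\<theta> s) e" for c
            using contour_integral_primitive[of "ball (\<theta> s) e" F f c] F that
            by (intro contour_integral_unique) blast
          have "g ` {a..b} \<subseteq> ball (\<theta> s) e" using near(2) by auto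
          then have sub: "contour_integral (subpath a b g) f = F (g b) - F (g a)"
            using prim[OF valid_path_subpath[OF g(1) ab(2,3)]] ab(1) by (simp add: path_image_subpath)
          have comb: "contour_integral (subpath 0 a g) f + contour_integral (subpath a b g) f = contour_integral (subpath 0 b g) f"
            using ab by (intro contour_integral_subpath_combine f_int g(1)) auto
          have line: "contour_integral (linepath (g t) (\<theta> t)) f = F (\<theta> t) - F (g t)" if "t \<in> {a..b}" for t
          proof -
            have "g t \<in> ball (\<theta> s) e" "\<theta> t \<in> ball (\<theta> s) e"
              using near[OF that] e(1) by (auto simp: r_def)
            then have "closed_segment (g t) (\<theta> t) \<subseteq> ball (\<theta> s) e"
              by (rule closed_segment_subset[OF _ _ convex_ball])
            then show ?thesis
              using prim[of "linepath (g t) (\<theta> t)"] by simp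
          qed
          have "a \<in> {a..b}" "b \<in> {a..b}" using ab(1) by auto
          then have H: "H b - H a = F (\<theta> b) - F (\<theta> a)"
            unfolding H_def comb[symmetric] sub by (simp add: line)
          have "norm ((F (\<theta> b) - f (\<theta> s) * \<theta> b) - (F (\<theta> a) - f (\<theta> s) * \<theta> a)) \<le> \<epsilon>' * norm (\<theta> b - \<theta> a)"
          proof (rule field_differentiable_bound[of "ball (\<theta> s) r" "\<lambda>x. F x - f (\<theta> s) * x" "\<lambda>x. f x - f (\<theta> s)"])
            show "((\<lambda>x. F x - f (\<theta> s) * x) has_field_derivative f x - f (\<theta> s)) (at x within ball (\<theta> s) r)"
              if "x \<in> ball (\<theta> s) r" for x
            proof -
              have "ball (\<theta> s) r \<subseteq> ball (\<theta> s) e" using e(1) by (intro subset_ball) (simp add: r_def)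
              then have "(F has_field_derivative f x) (at x within ball (\<theta> s) r)"
                using F that has_field_derivative_subset by blast
              then show ?thesis
                by (auto intro!: derivative_eq_intros)
            qed
            show "cmod (f x - f (\<theta> s)) \<le> \<epsilon>'" if "x \<in> ball (\<theta> s) r" for x
            proof -
              have "dist (\<theta> s) x \<le> e" "dist (\<theta> s) x < \<tau>" using that e(1) by (auto simp: r_def)
              then show ?thesis
                using \<tau>(2)[of "\<theta> s" x] C(3)[of s] ab(4) e(1)
                by (simp add: dist_commute dist_norm[symmetric] less_imp_le)
            qed
          qed (use near ab(1) in auto)
          then show ?thesis
            unfolding a_def[symmetric] b_def[symmetric] H by (simp add: algebra_simps norm_minus_commute)
        qed
        have "contour_integral g f = (\<Sum>(s, K)\<in>p. H (Sup K) - H (Inf K))"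
          using additive_tagged_division_1[OF _ p(1), of H] H01 by simp
        then have "stieltjes_sum \<theta> f p - contour_integral g f =
            (\<Sum>(s, K)\<in>p. (\<theta> (Sup K) - \<theta> (Inf K)) * f (\<theta> s) - (H (Sup K) - H (Inf K)))"
          by (simp add: stieltjes_sum_def scaleC_complex_def sum_subtractf case_prod_unfold)
        also have "norm \<dots> \<le> (\<Sum>(s, K)\<in>p. cmod (\<theta> (Sup K) - \<theta> (Inf K)) * \<epsilon>')"
          by (rule sum_norm_le) (use trm in auto)
        also have "\<dots> = (\<Sum>(s, K)\<in>p. cmod (\<theta> (Sup K) - \<theta> (Inf K))) * \<epsilon>'"
          by (simp add: sum_distrib_right case_prod_unfold)
        also have "\<dots> \<le> l * \<epsilon>'"
          using variation_tagged[OF l p(1)] \<epsilon>'(1) by (intro mult_right_mono) auto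
        finally show ?thesis using \<epsilon>'(2) by linarith
      qed
      with \<eta>(1) show "\<exists>\<eta>>0. \<forall>p. p tagged_division_of {0..1} \<and> (\<lambda>t. ball t \<eta>) fine p \<longrightarrow>
          norm (stieltjes_sum \<theta> f p - contour_integral g f) < \<epsilon>"
        by (intro exI[where x = \<eta>]) simp
    qed
  qed
  then show ?thesis
    using e(1) by (intro exI[where x = "e / 2"]) simp
qed

text \<open>The winding number of a continuous curve is, by definition, read off integrals along nearby smooth
  paths.\<close>

lemma has_curve_integral_winding_number:
  assumes "path \<theta>" "pathfinish \<theta> = pathstart \<theta>" "rectifiable \<theta>" "\<kappa> \<notin> path_image \<theta>"
  shows "has_curve_integral (\<lambda>\<zeta>. inverse (\<zeta> - \<kappa>)) (2 * pi * \<i> * winding_number \<theta> \<kappa>) \<theta>"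
proof -
  obtain d where d: "d > 0" "\<And>g f. valid_path g \<Longrightarrow> pathfinish g = pathstart g \<Longrightarrow> (\<forall>t\<in>{0..1}. cmod (g t - \<theta> t) < d) \<Longrightarrow>
      f holomorphic_on - {\<kappa>} \<Longrightarrow> has_curve_integral f (contour_integral g f) \<theta>"
    using has_curve_integral_contour_integral[OF assms(1-3), of "- {\<kappa>}"] assms(4)
    by (auto simp: open_Compl)
  obtain g where g: "winding_number_prop \<theta> \<kappa> d g (winding_number \<theta> \<kappa>)"
    using winding_number[OF assms(1,4) d(1)] by blast
  have "has_curve_integral (\<lambda>\<zeta>. 1 / (\<zeta> - \<kappa>)) (contour_integral g (\<lambda>\<zeta>. 1 / (\<zeta> - \<kappa>))) \<theta>"
    using g assms(2) by (intro d(2)) (auto simp: winding_number_prop_def norm_minus_commute intro!: holomorphic_intros)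
  then show ?thesis
    using g by (simp add: winding_number_prop_def inverse_eq_divide)
qed

text \<open>The integrand has a primitive off \<open>\<kappa>\<close>.\<close>

lemma has_curve_integral_power_zero:
  assumes "path \<theta>" "pathfinish \<theta> = pathstart \<theta>" "rectifiable \<theta>" "\<kappa> \<notin> path_image \<theta>"
  shows "has_curve_integral (\<lambda>\<zeta>. inverse (\<zeta> - \<kappa>) ^ (n + 2)) 0 \<theta>"
proof -
  obtain d where d: "d > 0" "\<And>g. valid_path g \<Longrightarrow> pathfinish g = pathstart g \<Longrightarrow> (\<forall>t\<in>{0..1}. cmod (g t - \<theta> t) < d) \<Longrightarrow>
      path_image g \<subseteq> - {\<kappa>} \<and> (\<forall>f. f holomorphic_on - {\<kappa>} \<longrightarrow> has_curve_integral f (contour_integral g f) \<theta>)"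
    using has_curve_integral_contour_integral[OF assms(1-3), of "- {\<kappa>}"] assms(4)
    by (auto simp: open_Compl)
  obtain g where g: "winding_number_prop \<theta> \<kappa> d g (winding_number \<theta> \<kappa>)"
    using winding_number[OF assms(1,4) d(1)] by blast
  have g': "valid_path g" "pathfinish g = pathstart g" "\<forall>t\<in>{0..1}. cmod (g t - \<theta> t) < d"
    using g assms(2) by (auto simp: winding_number_prop_def norm_minus_commute)
  have deriv: "((\<lambda>\<zeta>. - (inverse (\<zeta> - \<kappa>) ^ (n + 1) / of_nat (n + 1))) has_field_derivative inverse (x - \<kappa>) ^ (n + 2))
      (at x within - {\<kappa>})" if "x \<in> - {\<kappa>}" for x
  proof -
    define u where "u = inverse (x - \<kappa>)"
    have "((\<lambda>\<zeta>. inverse (\<zeta> - \<kappa>)) has_field_derivative - (u * u)) (at x within - {\<kappa>})"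
      using that by (auto intro!: derivative_eq_intros simp: u_def)
    then have "((\<lambda>\<zeta>. inverse (\<zeta> - \<kappa>) ^ Suc n) has_field_derivative (1 + of_nat n) * (- (u * u) * u ^ n)) (at x within - {\<kappa>})"
      unfolding u_def by (rule DERIV_power_Suc)
    then have "((\<lambda>\<zeta>. - (inverse (\<zeta> - \<kappa>) ^ Suc n / of_nat (Suc n))) has_field_derivative
        - ((1 + of_nat n) * (- (u * u) * u ^ n) / of_nat (Suc n))) (at x within - {\<kappa>})"
      by (intro DERIV_minus DERIV_cdivide)
    moreover have "- ((1 + of_nat n) * (- (u * u) * u ^ n) / of_nat (Suc n)) = u ^ (n + 2)"
    proof -
      have "1 + complex_of_nat n = of_nat (Suc n)" by simp
      then show ?thesis by (simp del: of_nat_Suc)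
    qed
    ultimately show ?thesis by (simp add: u_def)
  qed
  have "((\<lambda>\<zeta>. inverse (\<zeta> - \<kappa>) ^ (n + 2)) has_contour_integral 0) g"
    using Cauchy_theorem_primitive[OF deriv g'(1) _ g'(2)] d(2)[OF g'] by blast
  moreover have "(\<lambda>\<zeta>. inverse (\<zeta> - \<kappa>) ^ (n + 2)) holomorphic_on - {\<kappa>}"
    by (auto intro!: holomorphic_intros)
  ultimately show ?thesis
    using d(2)[OF g'] contour_integral_unique by metis
qed

text \<open>Cauchy's theorem for a rectifiable curve.  The winding number of the approximating smooth path
  around a point off \<open>U\<close> is read off the integral of \<open>1 / (\<zeta> - w)\<close> along \<open>\<theta>\<close> itself.\<close>

theorem Cauchy_theorem_rectifiable:
  assumes "path \<theta>" "pathfinish \<theta> = pathstart \<theta>" "rectifiable \<theta>"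
    and U: "open U" "path_image \<theta> \<subseteq> U" "f holomorphic_on U"
    and zero: "\<And>w. w \<notin> U \<Longrightarrow> winding_number \<theta> w = 0"
  shows "has_curve_integral f 0 \<theta>"
proof -
  obtain d where d: "d > 0" "\<And>g. valid_path g \<Longrightarrow> pathfinish g = pathstart g \<Longrightarrow> (\<forall>t\<in>{0..1}. cmod (g t - \<theta> t) < d) \<Longrightarrow>
      path_image g \<subseteq> U \<and> (\<forall>f. f holomorphic_on U \<longrightarrow> has_curve_integral f (contour_integral g f) \<theta>)"
    using has_curve_integral_contour_integral[OF assms(1-5)] by auto
  obtain g where "polynomial_function g" "pathstart g = pathstart \<theta>" "pathfinish g = pathfinish \<theta>"
      "\<forall>t\<in>{0..1}. cmod (g t - \<theta> t) < d"
    using path_approx_polynomial_function[OF assms(1) d(1)] by metis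
  then have g: "valid_path g" "pathfinish g = pathstart g" "\<forall>t\<in>{0..1}. cmod (g t - \<theta> t) < d"
    using assms(2) by (auto intro: valid_path_polynomial_function)
  have gU: "path_image g \<subseteq> U" and int: "\<And>f. f holomorphic_on U \<Longrightarrow> has_curve_integral f (contour_integral g f) \<theta>"
    using d(2)[OF g] by auto
  have "winding_number g w = 0" if "w \<notin> U" for w
  proof -
    have "has_curve_integral (\<lambda>\<zeta>. inverse (\<zeta> - w)) (contour_integral g (\<lambda>\<zeta>. inverse (\<zeta> - w))) \<theta>"
      using that by (intro int holomorphic_intros) auto
    moreover have "has_curve_integral (\<lambda>\<zeta>. inverse (\<zeta> - w)) 0 \<theta>"
      using has_curve_integral_winding_number[OF assms(1-3), of w] zero[OF that] that U(2) by auto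
    ultimately have "contour_integral g (\<lambda>\<zeta>. inverse (\<zeta> - w)) = 0"
      by (rule has_curve_integral_unique)
    then show ?thesis
      using winding_number_valid_path[OF g(1), of w] gU that by (auto simp: inverse_eq_divide)
  qed
  then have "(f has_contour_integral 0) g"
    by (intro Cauchy_theorem_global[OF U(1,3) g(1,2) gU])
  then show ?thesis
    using int[OF U(3)] contour_integral_unique by metis
qed

section \<open>Resolvents and symmetric operators\<close>

lemma linear_opD:
  assumes "linear_op D A"
  shows "csubspace D" "x \<in> D \<Longrightarrow> y \<in> D \<Longrightarrow> A (x + y) = A x + A y"
    "x \<in> D \<Longrightarrow> A (c *\<^sub>C x) = c *\<^sub>C A x" "x \<in> D \<Longrightarrow> y \<in> D \<Longrightarrow> A (x - y) = A x - A y"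
    "x \<in> D \<Longrightarrow> y \<in> D \<Longrightarrow> x + y \<in> D" "x \<in> D \<Longrightarrow> c *\<^sub>C x \<in> D" "x \<in> D \<Longrightarrow> y \<in> D \<Longrightarrow> x - y \<in> D"
    "0 \<in> D" "A 0 = 0"
proof -
  show sub: "csubspace D" and add: "x \<in> D \<Longrightarrow> y \<in> D \<Longrightarrow> A (x + y) = A x + A y"
    and scale: "x \<in> D \<Longrightarrow> A (c *\<^sub>C x) = c *\<^sub>C A x" for x y c
    using assms by (auto simp: linear_op_def)
  show "x \<in> D \<Longrightarrow> y \<in> D \<Longrightarrow> x + y \<in> D" "x \<in> D \<Longrightarrow> c *\<^sub>C x \<in> D" "x \<in> D \<Longrightarrow> y \<in> D \<Longrightarrow> x - y \<in> D" "0 \<in> D"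
    using sub by (auto intro: complex_vs.subspace_add complex_vs.subspace_scale complex_vs.subspace_diff complex_vs.subspace_0)
  show "A (x - y) = A x - A y" if "x \<in> D" "y \<in> D"
  proof -
    have "A (x + (-1) *\<^sub>C y) = A x + (-1) *\<^sub>C A y"
      using that sub by (simp only: add scale complex_vs.subspace_scale)
    then show ?thesis by simp
  qed
  show "A 0 = 0"
    using scale[of 0 0] complex_vs.subspace_0[OF sub] by simp
qed

lemma resolventD:
  assumes "\<zeta> \<in> resolvent_set D A"
  shows "resolvent D A \<zeta> y \<in> D" "\<zeta> *\<^sub>C resolvent D A \<zeta> y - A (resolvent D A \<zeta> y) = y"
    "x \<in> D \<Longrightarrow> resolvent D A \<zeta> (\<zeta> *\<^sub>C x - A x) = x" "bounded_linear (resolvent D A \<zeta>)"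
proof -
  let ?f = "\<lambda>x. \<zeta> *\<^sub>C x - A x"
  have b: "bij_betw ?f D UNIV" and bl: "bounded_linear (resolvent D A \<zeta>)"
    using assms by (auto simp: resolvent_set_def)
  show "bounded_linear (resolvent D A \<zeta>)" by (rule bl)
  have y: "y \<in> ?f ` D" using b by (auto simp: bij_betw_def)
  show "resolvent D A \<zeta> y \<in> D"
    unfolding resolvent_def by (rule inv_into_into[OF y])
  show "\<zeta> *\<^sub>C resolvent D A \<zeta> y - A (resolvent D A \<zeta> y) = y"
    unfolding resolvent_def by (rule f_inv_into_f[OF y])
  show "resolvent D A \<zeta> (\<zeta> *\<^sub>C x - A x) = x" if "x \<in> D"
    unfolding resolvent_def using b that by (intro inv_into_f_f[of ?f]) (auto simp: bij_betw_def)
qed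

lemma resolvent_eqI:
  assumes "\<zeta> \<in> resolvent_set D A" "x \<in> D" "\<zeta> *\<^sub>C x - A x = y"
  shows "resolvent D A \<zeta> y = x"
  using resolventD(3)[OF assms(1,2)] assms(3) by simp

lemma resolvent_scaleC:
  assumes "linear_op D A" "\<zeta> \<in> resolvent_set D A"
  shows "resolvent D A \<zeta> (c *\<^sub>C y) = c *\<^sub>C resolvent D A \<zeta> y"
proof (rule resolvent_eqI[OF assms(2)])
  have "\<zeta> *\<^sub>C c *\<^sub>C resolvent D A \<zeta> y - A (c *\<^sub>C resolvent D A \<zeta> y) =
      c *\<^sub>C (\<zeta> *\<^sub>C resolvent D A \<zeta> y - A (resolvent D A \<zeta> y))"
    using linear_opD(3)[OF assms(1)] resolventD(1)[OF assms(2)]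
    by (simp add: complex_vs.scale_right_diff_distrib mult.commute)
  then show "\<zeta> *\<^sub>C c *\<^sub>C resolvent D A \<zeta> y - A (c *\<^sub>C resolvent D A \<zeta> y) = c *\<^sub>C y"
    using resolventD(2)[OF assms(2)] by simp
qed (auto intro: linear_opD(6)[OF assms(1)] resolventD(1)[OF assms(2)])

lemma bounded_clinear_resolvent:
  assumes "linear_op D A" "\<zeta> \<in> resolvent_set D A"
  shows "bounded_clinear (resolvent D A \<zeta>)"
  using resolvent_scaleC[OF assms] resolventD(4)[OF assms(2)] by (simp add: bounded_clinear_def)

lemma bounded_below_resolvent_set:
  assumes "\<zeta> \<in> resolvent_set D A"
  shows "\<exists>c>0. \<forall>x\<in>D. c * norm x \<le> norm (A x - \<zeta> *\<^sub>C x)"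
proof -
  obtain K where K: "K > 0" "\<And>y. norm (resolvent D A \<zeta> y) \<le> norm y * K"
    using bounded_linear.pos_bounded[OF resolventD(4)[OF assms]] by blast
  have "1 / K * norm x \<le> norm (A x - \<zeta> *\<^sub>C x)" if "x \<in> D" for x
    using K(2)[of "\<zeta> *\<^sub>C x - A x"] resolventD(3)[OF assms that] K(1)
    by (simp add: field_simps norm_minus_commute)
  then show ?thesis using K(1) by (intro exI[where x = "1 / K"]) auto
qed

definition symmetric_op :: "'a::complex_hilbert_space set \<Rightarrow> ('a \<Rightarrow> 'a) \<Rightarrow> bool"
  where "symmetric_op D A \<longleftrightarrow> (\<forall>x\<in>D. \<forall>y\<in>D. cinner (A x) y = cinner x (A y))"

lemma selfadjoint_imp_symmetric:
  assumes "selfadjoint_op D A"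
  shows "symmetric_op D A"
proof -
  have "(y, A y) \<in> adjoint_graph D A" if "y \<in> D" for y
    using assms that by (auto simp: selfadjoint_op_def op_graph_def)
  then show ?thesis by (auto simp: symmetric_op_def adjoint_graph_def)
qed

text \<open>For a symmetric operator the distance of a real point \<open>s\<close> to the spectrum is a lower bound of
  \<open>A - s\<close>.  If the norm \<open>t\<close> of \<open>T = (s - A)\<inverse>\<close> exceeded \<open>1 / d\<close>, then both \<open>t\<close> and \<open>- t\<close> would lie in the
  resolvent set of \<open>T\<close>, so \<open>t\<^sup>2 - T\<^sup>2\<close> would be bounded below; but \<open>T\<close> is symmetric, and
  \<open>\<parallel>(t\<^sup>2 - T\<^sup>2) x\<parallel>\<^sup>2 \<le> t\<^sup>2 (t\<^sup>2 \<parallel>x\<parallel>\<^sup>2 - \<parallel>T x\<parallel>\<^sup>2)\<close>, which would make the norm of \<open>T\<close> smaller than \<open>t\<close>.\<close>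

lemma symmetric_spectral_gap_bound:
  assumes lin: "linear_op D A" and sym: "symmetric_op D A" and "d > 0"
    and gap: "\<And>t. \<bar>t - s\<bar> < d \<Longrightarrow> complex_of_real t \<in> resolvent_set D A"
    and "x \<in> D"
  shows "d * norm x \<le> norm (A x - complex_of_real s *\<^sub>C x)"
proof -
  let ?s = "complex_of_real s"
  define T where "T = resolvent D A ?s"
  have s: "?s \<in> resolvent_set D A" using gap[of s] \<open>d > 0\<close> by simp
  have T: "bounded_clinear T" "\<And>y. T y \<in> D" "\<And>y. ?s *\<^sub>C T y - A (T y) = y"
    unfolding T_def using bounded_clinear_resolvent[OF lin s] resolventD[OF s] by auto
  have Tbl: "bounded_linear T" using T(1) by (simp add: bounded_clinear_def)
  have Tsym: "cinner (T u) v = cinner u (T v)" for u v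
  proof -
    have "cinner (T u) v = cinner (T u) (?s *\<^sub>C T v - A (T v))" by (simp add: T(3))
    also have "\<dots> = cinner (?s *\<^sub>C T u - A (T u)) (T v)"
      using sym T(2) by (simp add: symmetric_op_def cinner_algebra)
    finally show ?thesis by (simp add: T(3))
  qed
  define t where "t = onorm T"
  have Tt: "norm (T y) \<le> t * norm y" for y
    unfolding t_def by (rule onorm[OF Tbl])
  have "t \<le> 1 / d"
  proof (rule ccontr)
    assume "\<not> t \<le> 1 / d"
    then have t: "t > 1 / d" "t > 0" using \<open>d > 0\<close> by (auto intro: less_trans[of 0 "1 / d"])
    \<comment> \<open>For \<open>u = T y\<close> one has \<open>\<tau> y - u = \<tau> ((s - 1 / \<tau>) - A) u\<close>, and \<open>s - 1 / \<tau>\<close> has distance less than \<open>d\<close> from \<open>s\<close>.\<close>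
    have below: "\<exists>c>0. \<forall>y. c * norm y \<le> norm (\<tau> *\<^sub>R y - T y)" if \<tau>: "\<bar>\<tau>\<bar> = t" for \<tau>
    proof -
      have "\<tau> \<noteq> 0" using t \<tau> by auto
      have "\<bar>(s - 1 / \<tau>) - s\<bar> < d"
        using t \<tau> \<open>d > 0\<close> by (simp add: abs_divide field_simps)
      then obtain c0 where c0: "c0 > 0"
          "\<And>u. u \<in> D \<Longrightarrow> c0 * norm u \<le> norm (A u - complex_of_real (s - 1 / \<tau>) *\<^sub>C u)"
        using bounded_below_resolvent_set[OF gap] by blast
      define C where "C = 1 / t + 1 / (t * t * c0)"
      have C: "C > 0" unfolding C_def using t c0(1) by (intro add_pos_pos) auto
      have "norm y \<le> C * norm (\<tau> *\<^sub>R y - T y)" for y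
      proof -
        define u where "u = T y"
        have y: "y = ?s *\<^sub>C u - A u" by (simp add: u_def T(3))
        have "\<tau> *\<^sub>R (A u - complex_of_real (s - 1 / \<tau>) *\<^sub>C u) = u - \<tau> *\<^sub>R y"
          unfolding y using \<open>\<tau> \<noteq> 0\<close>
          by (simp add: scaleR_right_diff_distrib scaleR_scaleC complex_vs.scale_left_diff_distrib
              complex_vs.scale_right_diff_distrib right_diff_distrib)
        then have "t * norm (A u - complex_of_real (s - 1 / \<tau>) *\<^sub>C u) = norm (\<tau> *\<^sub>R y - u)"
          using \<tau> by (metis norm_minus_commute norm_scaleR)
        moreover have "c0 * norm u \<le> norm (A u - complex_of_real (s - 1 / \<tau>) *\<^sub>C u)"
          using c0(2) T(2) by (simp add: u_def)
        ultimately have 1: "t * (c0 * norm u) \<le> norm (\<tau> *\<^sub>R y - u)"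
          using t by (metis less_imp_le mult_left_mono)
        have "t * norm y = norm ((\<tau> *\<^sub>R y - u) + u)" using \<tau> by simp
        also have "\<dots> \<le> norm (\<tau> *\<^sub>R y - u) + norm u" by (rule norm_triangle_ineq)
        also have "norm u \<le> norm (\<tau> *\<^sub>R y - u) / (t * c0)"
          using 1 t c0(1) by (simp add: field_simps)
        finally have "norm y \<le> (norm (\<tau> *\<^sub>R y - u) + norm (\<tau> *\<^sub>R y - u) / (t * c0)) / t"
          using t by (simp add: field_simps)
        also have "\<dots> = C * norm (\<tau> *\<^sub>R y - u)"
          using t c0(1) by (simp add: C_def field_simps)
        finally show ?thesis by (simp add: u_def)
      qed
      then show ?thesis
        using C by (intro exI[where x = "1 / C"]) (simp add: field_simps)
    qed
    obtain c1 where c1: "c1 > 0" "\<And>y. c1 * norm y \<le> norm (t *\<^sub>R y - T y)"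
      using below[of t] t by auto
    obtain c2 where c2: "c2 > 0" "\<And>y. c2 * norm y \<le> norm ((- t) *\<^sub>R y - T y)"
      using below[of "- t"] t by auto
    define c where "c = c1 * c2"
    have "c > 0" using c1(1) c2(1) by (simp add: c_def)
    have sq: "(norm (T y))\<^sup>2 \<le> (t\<^sup>2 - c\<^sup>2 / t\<^sup>2) * (norm y)\<^sup>2" for y
    proof -
      have "c1 * (c2 * norm y) \<le> c1 * norm ((- t) *\<^sub>R y - T y)"
        using c2(2) c1(1) by (intro mult_left_mono) auto
      also have "\<dots> \<le> norm (t *\<^sub>R ((- t) *\<^sub>R y - T y) - T ((- t) *\<^sub>R y - T y))"
        by (rule c1(2))
      also have "t *\<^sub>R ((- t) *\<^sub>R y - T y) - T ((- t) *\<^sub>R y - T y) = T (T y) - t\<^sup>2 *\<^sub>R y"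
        by (simp add: linear_simps[OF Tbl] scaleR_right_diff_distrib power2_eq_square)
      finally have "c * norm y \<le> norm (T (T y) - t\<^sup>2 *\<^sub>R y)" by (simp add: c_def)
      then have "(c * norm y)\<^sup>2 \<le> (norm (T (T y) - t\<^sup>2 *\<^sub>R y))\<^sup>2"
        using \<open>c > 0\<close> by (intro power_mono) auto
      also have "\<dots> = (norm (T (T y)))\<^sup>2 + (t\<^sup>2 * norm y)\<^sup>2 - 2 * t\<^sup>2 * (norm (T y))\<^sup>2"
        unfolding norm_diff_sq scaleR_scaleC
        by (simp add: cinner_scaleC_right Tsym[of "T y" y] cinner_self norm_power)
      also have "(norm (T (T y)))\<^sup>2 \<le> (t * norm (T y))\<^sup>2"
        using Tt by (intro power_mono) auto
      finally have "c\<^sup>2 * (norm y)\<^sup>2 \<le> t\<^sup>2 * (t\<^sup>2 * (norm y)\<^sup>2 - (norm (T y))\<^sup>2)"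
        by (simp add: power_mult_distrib algebra_simps power2_eq_square)
      then show ?thesis using t(2) by (simp add: field_simps)
    qed
    define q where "q = max 0 (t\<^sup>2 - c\<^sup>2 / t\<^sup>2)"
    have "q < t\<^sup>2" using t(2) \<open>c > 0\<close> by (simp add: q_def)
    have "norm (T y) \<le> sqrt q * norm y" for y
    proof -
      have "(norm (T y))\<^sup>2 \<le> q * (norm y)\<^sup>2"
        using sq[of y] mult_right_mono[of "t\<^sup>2 - c\<^sup>2 / t\<^sup>2" q "(norm y)\<^sup>2"] by (simp add: q_def)
      then have "(norm (T y))\<^sup>2 \<le> (sqrt q * norm y)\<^sup>2"
        by (simp add: power_mult_distrib q_def)
      then show ?thesis by (rule power2_le_imp_le) (simp add: q_def)
    qed
    then have "t \<le> sqrt q"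
      unfolding t_def by (intro onorm_bound) (auto simp: q_def)
    also have "sqrt q < t"
      using real_sqrt_less_mono[OF \<open>q < t\<^sup>2\<close>] t(2) by simp
    finally show False by simp
  qed
  have "x = T (?s *\<^sub>C x - A x)"
    unfolding T_def using resolventD(3)[OF s \<open>x \<in> D\<close>] by simp
  then have "norm x \<le> t * norm (?s *\<^sub>C x - A x)" using Tt by metis
  also have "\<dots> \<le> 1 / d * norm (?s *\<^sub>C x - A x)"
    using \<open>t \<le> 1 / d\<close> by (intro mult_right_mono) auto
  finally show ?thesis using \<open>d > 0\<close> by (simp add: field_simps norm_minus_commute)
qed

text \<open>Off its eigenspace, a symmetric operator is bounded below at an isolated point of the spectrum.
  The gap bound at the points \<open>l \<plusminus> r / 2\<close> says \<open>r \<bar>\<langle>G x, x\<rangle>\<bar> \<le> \<parallel>G x\<parallel>\<^sup>2\<close> for \<open>G = A - l\<close>; polarising gives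
  \<open>r \<parallel>y\<parallel> \<le> \<parallel>G y\<parallel>\<close> for \<open>y\<close> in the range of \<open>G\<close>.  A vector \<open>y\<close> of the domain that is orthogonal to the kernel is the limit of
  \<open>y - v \<epsilon>\<close>, with \<open>v \<epsilon> = i \<epsilon> (i \<epsilon> - G)\<inverse> y\<close>, as \<open>\<epsilon>\<close> tends to 0: these vectors are in the range of \<open>G\<close> and,
  by the bound just found, Cauchy; closedness of \<open>A\<close> puts the limit of \<open>v \<epsilon>\<close> into the kernel, and it is
  orthogonal to the kernel.\<close>

lemma bounded_below_isolated_point:
  assumes lin: "linear_op D A" and clo: "closed_op D A" and sym: "symmetric_op D A" and "r > 0"
    and gap: "\<And>t. 0 < \<bar>t - l\<bar> \<Longrightarrow> \<bar>t - l\<bar> < r \<Longrightarrow> complex_of_real t \<in> resolvent_set D A"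
    and nonreal: "\<And>\<zeta>. Im \<zeta> \<noteq> 0 \<Longrightarrow> \<zeta> \<in> resolvent_set D A"
    and y: "y \<in> D" "\<And>e. e \<in> eigenspace D A (complex_of_real l) \<Longrightarrow> cinner y e = 0"
  shows "r * norm y \<le> norm (A y - complex_of_real l *\<^sub>C y)"
proof -
  define G where "G = (\<lambda>x. A x - complex_of_real l *\<^sub>C x)"
  note D = linear_opD[OF lin]
  have Gadd: "G (x + u) = G x + G u" and Gdiff: "G (x - u) = G x - G u" and Gscale: "G (c *\<^sub>C x) = c *\<^sub>C G x"
    if "x \<in> D" "u \<in> D" for x u c
    using that by (auto simp: G_def D scaleC_add_right complex_vs.scale_right_diff_distrib mult.commute)
  have Gsym: "cinner (G x) u = cinner x (G u)" if "x \<in> D" "u \<in> D" for x u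
    using sym that by (simp add: symmetric_op_def G_def cinner_algebra)
  have form: "\<sigma> * r * Re (cinner (G x) x) \<le> (norm (G x))\<^sup>2" if "x \<in> D" "\<bar>\<sigma>\<bar> = 1" for x \<sigma>
  proof -
    have "complex_of_real t \<in> resolvent_set D A" if "\<bar>t - (l + \<sigma> * (r / 2))\<bar> < r / 2" for t
      using that \<open>\<bar>\<sigma>\<bar> = 1\<close> by (intro gap) (auto simp: abs_if split: if_splits)
    then have "r / 2 * norm x \<le> norm (A x - complex_of_real (l + \<sigma> * (r / 2)) *\<^sub>C x)"
      using \<open>r > 0\<close> \<open>x \<in> D\<close> by (intro symmetric_spectral_gap_bound[OF lin sym]) auto
    also have "A x - complex_of_real (l + \<sigma> * (r / 2)) *\<^sub>C x = G x - complex_of_real (\<sigma> * (r / 2)) *\<^sub>C x"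
      by (simp add: G_def scaleC_add_left)
    finally have "(r / 2 * norm x)\<^sup>2 \<le> (norm (G x - complex_of_real (\<sigma> * (r / 2)) *\<^sub>C x))\<^sup>2"
      using \<open>r > 0\<close> by (intro power_mono) auto
    also have "\<dots> = (norm (G x))\<^sup>2 + (\<bar>\<sigma>\<bar> * (r / 2) * norm x)\<^sup>2 - \<sigma> * r * Re (cinner (G x) x)"
      unfolding norm_diff_sq using \<open>r > 0\<close>
      by (simp add: cinner_scaleC_right norm_mult abs_mult power_mult_distrib)
    finally show ?thesis using \<open>\<bar>\<sigma>\<bar> = 1\<close> by simp
  qed
  have range: "r * norm v \<le> norm (G v)" if "x \<in> D" "v = G x" "v \<in> D" for x v
  proof -
    \<comment> \<open>The form inequality for \<open>v - r x\<close> and, with the other sign, for \<open>v + r x\<close>; in the sum the mixed terms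
      combine to \<open>\<langle>G x, v\<rangle> = \<parallel>v\<parallel>\<^sup>2\<close>.\<close>
    define u1 u2 where "u1 = v - complex_of_real r *\<^sub>C x" and "u2 = v + complex_of_real r *\<^sub>C x"
    have u: "u1 \<in> D" "u2 \<in> D" using that D(5-7) by (auto simp: u1_def u2_def)
    have Gu: "G u1 = G v - complex_of_real r *\<^sub>C v" "G u2 = G v + complex_of_real r *\<^sub>C v"
      using that D(6) by (auto simp: u1_def u2_def Gadd Gdiff Gscale[of _ _])
    have Gvx: "cinner (G v) x = cinner v v" "cinner x (G v) = cinner v v"
      using Gsym[of v x] Gsym[of x v] that by auto
    have "1 * r * Re (cinner (G u2) u2) \<le> (norm (G u2))\<^sup>2" "(-1) * r * Re (cinner (G u1) u1) \<le> (norm (G u1))\<^sup>2"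
      using form[OF u(2), of 1] form[OF u(1), of "-1"] by simp_all
    moreover have "Re (cinner (G u2) u2) - Re (cinner (G u1) u1) = 4 * r * (norm v)\<^sup>2"
      unfolding Gu by (simp add: u1_def u2_def cinner_algebra Gvx cinner_self algebra_simps)
    moreover have "(norm (G u2))\<^sup>2 + (norm (G u1))\<^sup>2 = 2 * (norm (G v))\<^sup>2 + 2 * (r * norm v)\<^sup>2"
      unfolding Gu norm_add_sq norm_diff_sq using \<open>r > 0\<close> by simp
    ultimately have "r * (4 * r * (norm v)\<^sup>2) \<le> 2 * (norm (G v))\<^sup>2 + 2 * (r * norm v)\<^sup>2"
      by (metis (no_types, opaque_lifting) add_mono mult_minus_left mult_1 right_diff_distrib' uminus_add_conv_diff add.commute)
    then have "(r * norm v)\<^sup>2 \<le> (norm (G v))\<^sup>2"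
      by (simp add: power2_eq_square algebra_simps)
    then show ?thesis by (rule power2_le_imp_le) simp
  qed
  define \<epsilon> where "\<epsilon> = (\<lambda>n. 1 / real (Suc n))"
  define x where "x = (\<lambda>n. resolvent D A (complex_of_real l + \<i> * complex_of_real (\<epsilon> n)) y)"
  define v where "v = (\<lambda>n. (\<i> * complex_of_real (\<epsilon> n)) *\<^sub>C x n)"
  have \<epsilon>: "\<epsilon> n > 0" for n by (simp add: \<epsilon>_def)
  have \<epsilon>0: "\<epsilon> \<longlonglongrightarrow> 0" unfolding \<epsilon>_def using LIMSEQ_inverse_real_of_nat by (simp add: inverse_eq_divide)
  have res: "complex_of_real l + \<i> * complex_of_real (\<epsilon> n) \<in> resolvent_set D A" for n
    using \<epsilon>[of n] by (intro nonreal) simp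
  have xD: "x n \<in> D" for n unfolding x_def by (rule resolventD(1)[OF res])
  have vD: "v n \<in> D" for n unfolding v_def using xD D(6) by auto
  have Gx: "G (x n) = v n - y" for n
    using resolventD(2)[OF res[of n], of y]
    by (simp add: G_def v_def x_def scaleC_add_left algebra_simps)
  have Gv: "G (v n) = (\<i> * complex_of_real (\<epsilon> n)) *\<^sub>C (v n - y)" for n
    by (subst (1) v_def) (simp add: Gscale[OF xD xD] Gx)
  have bound: "norm (v n - y) \<le> norm y" for n
  proof -
    have "cnj (cinner (v n - y) (x n)) = cinner (v n - y) (x n)"
      using Gsym[OF xD xD, of n n] Gx[of n] by (metis cinner_commute)
    then have "Im (cinner (v n - y) (x n)) = 0"
      by (metis Reals_cnj_iff complex_is_Real_iff)
    then have "Re (cinner (v n - y) (v n)) = 0"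
      by (subst (2) v_def) (simp add: cinner_scaleC_right)
    then have "(norm (v n - y))\<^sup>2 \<le> (norm ((v n - y) - v n))\<^sup>2"
      unfolding norm_diff_sq[of "v n - y" "v n"] by simp
    then show ?thesis by (simp add: power2_le_iff_abs_le)
  qed
  have Gvn: "norm (G (v n)) \<le> \<epsilon> n * norm y" for n
    unfolding Gv using bound[of n] \<epsilon>[of n] by (simp add: norm_mult)
  have diff: "r * norm (v n - v m) \<le> (\<epsilon> n + \<epsilon> m) * norm y" for n m
  proof -
    have "r * norm (v n - v m) \<le> norm (G (v n - v m))"
    proof (rule range)
      show "x n - x m \<in> D" "v n - v m \<in> D" using xD vD D(7) by auto
      show "v n - v m = G (x n - x m)" by (simp add: Gdiff xD Gx)
    qed
    also have "\<dots> = norm (G (v n) - G (v m))" by (simp add: Gdiff vD)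
    also have "\<dots> \<le> norm (G (v n)) + norm (G (v m))" by (rule norm_triangle_ineq4)
    also have "\<dots> \<le> (\<epsilon> n + \<epsilon> m) * norm y" using Gvn[of n] Gvn[of m] by (simp add: distrib_right)
    finally show ?thesis .
  qed
  have "Cauchy v"
  proof (rule CauchyI)
    fix e :: real assume "e > 0"
    define b where "b = norm y + 1"
    have b: "b > 0" by (simp add: b_def add_nonneg_pos)
    define e' where "e' = e * r / (2 * b)"
    have e': "e' > 0" using \<open>e > 0\<close> \<open>r > 0\<close> b by (simp add: e'_def)
    then have "eventually (\<lambda>n. \<epsilon> n < e') sequentially"
      using order_tendstoD(2)[OF \<epsilon>0] by blast
    then obtain M where M: "\<And>n. n \<ge> M \<Longrightarrow> \<epsilon> n < e'" by (auto simp: eventually_sequentially)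
    have "norm (v m - v n) < e" if "m \<ge> M" "n \<ge> M" for m n
    proof -
      have "r * norm (v m - v n) \<le> (\<epsilon> m + \<epsilon> n) * norm y" by (rule diff)
      also have "\<dots> \<le> (\<epsilon> m + \<epsilon> n) * b" using \<epsilon>[of m] \<epsilon>[of n] by (intro mult_left_mono) (auto simp: b_def)
      also have "\<dots> < (2 * e') * b"
        using M[OF that(1)] M[OF that(2)] b by (intro mult_strict_right_mono) auto
      also have "\<dots> = r * e" using b by (simp add: e'_def)
      finally show ?thesis using \<open>r > 0\<close> by simp
    qed
    then show "\<exists>M. \<forall>m\<ge>M. \<forall>n\<ge>M. norm (v m - v n) < e" by blast
  qed
  then obtain v0 where v0: "v \<longlonglongrightarrow> v0"
    using Cauchy_convergent_iff convergentD by blast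
  have Gv0: "(\<lambda>n. G (v n)) \<longlonglongrightarrow> 0"
  proof (rule Lim_null_comparison)
    show "(\<lambda>n. \<epsilon> n * norm y) \<longlonglongrightarrow> 0" using tendsto_mult[OF \<epsilon>0 tendsto_const[of "norm y"]] by simp
  qed (use Gvn in auto)
  have "(\<lambda>n. G (v n) + complex_of_real l *\<^sub>C v n) \<longlonglongrightarrow> 0 + complex_of_real l *\<^sub>C v0"
    by (intro tendsto_add Gv0 bounded_linear.tendsto[OF bounded_linear_scaleC_right] v0)
  then have "(\<lambda>n. A (v n)) \<longlonglongrightarrow> complex_of_real l *\<^sub>C v0" by (simp add: G_def)
  then have "(\<lambda>n. (v n, A (v n))) \<longlonglongrightarrow> (v0, complex_of_real l *\<^sub>C v0)"
    by (intro tendsto_Pair v0)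
  moreover have "(v n, A (v n)) \<in> op_graph D A" for n using vD by (auto simp: op_graph_def)
  ultimately have "(v0, complex_of_real l *\<^sub>C v0) \<in> op_graph D A"
    using closed_sequentially[of "op_graph D A" "\<lambda>n. (v n, A (v n))"] clo
    by (simp add: closed_op_def)
  then have v0e: "v0 \<in> eigenspace D A (complex_of_real l)"
    by (auto simp: op_graph_def eigenspace_def)
  then have "v0 \<in> D" "G v0 = 0" by (auto simp: eigenspace_def G_def)
  have "cinner (v n) v0 = 0" for n
  proof -
    have "cinner (v n - y) v0 = 0"
      using Gsym[OF xD \<open>v0 \<in> D\<close>, of n] by (simp add: Gx \<open>G v0 = 0\<close>)
    then show ?thesis using y(2)[OF v0e] by (simp add: cinner_diff_left)
  qed
  moreover have "(\<lambda>n. cinner (v n) v0) \<longlonglongrightarrow> cinner v0 v0"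
    by (intro bounded_linear.tendsto[OF bounded_linear_cinner_left] v0)
  ultimately have "cinner v0 v0 = 0" by (simp add: LIMSEQ_const_iff)
  then have "v0 = 0" by (simp add: cinner_self)
  have "r * norm (y - v n) \<le> norm (G y) + \<epsilon> n * norm y" for n
  proof -
    have "r * norm (v n - y) \<le> norm (G (v n - y))"
      using range[OF xD, of "v n - y" n] Gx[of n] D(7)[OF vD y(1)] by simp
    also have "\<dots> = norm (G (v n) - G y)" by (simp add: Gdiff vD y(1))
    also have "\<dots> \<le> norm (G (v n)) + norm (G y)" by (rule norm_triangle_ineq4)
    also have "\<dots> \<le> norm (G y) + \<epsilon> n * norm y" using Gvn[of n] by simp
    finally show ?thesis by (simp add: norm_minus_commute)
  qed
  moreover have "(\<lambda>n. r * norm (y - v n)) \<longlonglongrightarrow> r * norm (y - 0)"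
    using v0 \<open>v0 = 0\<close> by (intro tendsto_intros) auto
  moreover have "(\<lambda>n. norm (G y) + \<epsilon> n * norm y) \<longlonglongrightarrow> norm (G y) + 0 * norm y"
    by (intro tendsto_intros \<epsilon>0)
  ultimately have "r * norm (y - 0) \<le> norm (G y) + 0 * norm y"
    by (intro LIMSEQ_le) auto
  then show ?thesis by (simp add: G_def)
qed

section \<open>Resolvents of bounded operators and Riesz projections\<close>

lemma bounded_clinear_imp_linear_op: "bounded_clinear T \<Longrightarrow> linear_op UNIV T"
  by (simp add: linear_op_def csubspace_iff bounded_clinearD)

lemma resolvent_setI:
  assumes T: "bounded_clinear T" and surj: "\<And>y. \<exists>x. \<zeta> *\<^sub>C x - T x = y"
    and K: "\<And>x. norm x \<le> K * norm (\<zeta> *\<^sub>C x - T x)"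
  shows "\<zeta> \<in> resolvent_set UNIV T" "norm (resolvent UNIV T \<zeta> y) \<le> K * norm y"
proof -
  let ?G = "\<lambda>x. \<zeta> *\<^sub>C x - T x"
  have diff: "?G (x - x') = ?G x - ?G x'" and add: "?G (x + x') = ?G x + ?G x'" for x x'
    by (simp_all add: bounded_clinearD[OF T] complex_vs.scale_right_diff_distrib scaleC_add_right)
  have scale: "?G (r *\<^sub>R x) = r *\<^sub>R ?G x" for r x
    by (simp add: scaleR_scaleC bounded_clinearD[OF T] complex_vs.scale_right_diff_distrib mult.commute)
  have inj: "inj ?G"
  proof (rule injI)
    fix x x' assume "?G x = ?G x'"
    then have "norm (x - x') \<le> 0"
      using K[of "x - x'"] unfolding diff by simp
    then show "x = x'" by simp
  qed
  have "surj ?G" using surj unfolding surj_def by metis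
  then have bij: "bij ?G" using inj by (simp add: bij_def)
  have G: "?G (resolvent UNIV T \<zeta> y) = y" for y
    unfolding resolvent_def by (rule surj_f_inv_f[OF \<open>surj ?G\<close>])
  have bound: "norm (resolvent UNIV T \<zeta> y) \<le> K * norm y" for y
    using K[of "resolvent UNIV T \<zeta> y"] unfolding G .
  then show "norm (resolvent UNIV T \<zeta> y) \<le> K * norm y" .
  have "bounded_linear (resolvent UNIV T \<zeta>)"
  proof (rule bounded_linear_intro[where K = K])
    show "resolvent UNIV T \<zeta> (x + y) = resolvent UNIV T \<zeta> x + resolvent UNIV T \<zeta> y" for x y
      by (rule injD[OF inj]) (simp only: G add)
    show "resolvent UNIV T \<zeta> (r *\<^sub>R x) = r *\<^sub>R resolvent UNIV T \<zeta> x" for r x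
      by (rule injD[OF inj]) (simp only: G scale)
    show "norm (resolvent UNIV T \<zeta> x) \<le> norm x * K" for x
      using bound[of x] by (simp add: mult.commute)
  qed
  then show "\<zeta> \<in> resolvent_set UNIV T" using bij by (simp add: resolvent_set_def)
qed

text \<open>A perturbation of \<open>\<zeta> - T\<close> that is small compared with its inverse is again invertible:
  \<open>x\<close> solves the perturbed equation if it is a fixed point of a contraction.\<close>

lemma resolvent_perturbation:
  assumes T: "bounded_clinear T" "bounded_clinear T'" and \<zeta>: "\<zeta> \<in> resolvent_set UNIV T"
    and K: "K > 0" "\<And>y. norm (resolvent UNIV T \<zeta> y) \<le> K * norm y"
    and close: "\<And>x. norm ((\<zeta> *\<^sub>C x - T x) - (\<zeta>' *\<^sub>C x - T' x)) \<le> 1 / (2 * K) * norm x"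
  shows "\<zeta>' \<in> resolvent_set UNIV T'" "norm (resolvent UNIV T' \<zeta>' y) \<le> 2 * K * norm y"
proof -
  define G where "G = (\<lambda>x. \<zeta> *\<^sub>C x - T x)"
  define G' where "G' = (\<lambda>x. \<zeta>' *\<^sub>C x - T' x)"
  define R where "R = resolvent UNIV T \<zeta>"
  have R: "bounded_linear R" "\<And>y. G (R y) = y" "\<And>x. R (G x) = x"
    using resolventD[OF \<zeta>] by (auto simp: R_def G_def)
  have Gdiff: "G (x - y) = G x - G y" "G' (x - y) = G' x - G' y" for x y
    by (simp_all add: G_def G'_def bounded_clinearD[OF T(1)] bounded_clinearD[OF T(2)]
        complex_vs.scale_right_diff_distrib)
  have half: "K * norm (G x - G' x) \<le> 1 / 2 * norm x" for x
  proof -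
    have "K * norm (G x - G' x) \<le> K * (1 / (2 * K) * norm x)"
      using close[of x] K(1) by (intro mult_left_mono) (auto simp: G_def G'_def)
    then show ?thesis using K(1) by simp
  qed
  have below: "norm x \<le> 2 * K * norm (G' x)" for x
  proof -
    have "norm x \<le> K * norm (G x)" using K(2)[of "G x"] R(3) by (simp add: R_def)
    also have "\<dots> \<le> K * (norm (G' x) + norm (G x - G' x))"
      using K(1) norm_triangle_ineq[of "G' x" "G x - G' x"] by (intro mult_left_mono) auto
    also have "\<dots> \<le> K * norm (G' x) + 1 / 2 * norm x"
      using half[of x] by (simp add: distrib_left)
    finally show ?thesis by simp
  qed
  have surj: "\<exists>x. G' x = y" for y
  proof -
    have "\<exists>!x. R (y + (G x - G' x)) = x"
    proof (rule banach_fix_type[where c = "1 / 2"])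
      show "\<forall>x x'. dist (R (y + (G x - G' x))) (R (y + (G x' - G' x'))) \<le> 1 / 2 * dist x x'"
      proof (intro allI)
        fix x x'
        have "R (y + (G x - G' x)) - R (y + (G x' - G' x')) = R (G (x - x') - G' (x - x'))"
          by (simp add: linear_simps(2)[OF R(1), symmetric] Gdiff algebra_simps)
        also have "norm \<dots> \<le> K * norm (G (x - x') - G' (x - x'))" using K(2) by (simp add: R_def)
        also have "\<dots> \<le> 1 / 2 * norm (x - x')" by (rule half)
        finally show "dist (R (y + (G x - G' x))) (R (y + (G x' - G' x'))) \<le> 1 / 2 * dist x x'"
          by (simp add: dist_norm)
      qed
    qed auto
    then obtain x where "R (y + (G x - G' x)) = x" by blast
    then have "G x = y + (G x - G' x)" using R(2) by metis
    then have "G' x = y" by (simp add: algebra_simps)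
    then show ?thesis ..
  qed
  show "\<zeta>' \<in> resolvent_set UNIV T'" "norm (resolvent UNIV T' \<zeta>' y) \<le> 2 * K * norm y"
    using resolvent_setI(1)[OF T(2), of \<zeta>' "2 * K"] resolvent_setI(2)[OF T(2), of \<zeta>' "2 * K" y]
      surj below by (auto simp: G'_def)
qed

lemma resolvent_locally_bounded:
  assumes T: "bounded_clinear T" and \<zeta>: "\<zeta> \<in> resolvent_set UNIV T"
  shows "\<exists>r>0. \<exists>K>0. \<forall>\<zeta>'\<in>ball \<zeta> r. \<zeta>' \<in> resolvent_set UNIV T \<and> (\<forall>y. norm (resolvent UNIV T \<zeta>' y) \<le> K * norm y)"
proof -
  obtain K where K: "K > 0" "\<And>y. norm (resolvent UNIV T \<zeta> y) \<le> norm y * K"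
    using bounded_linear.pos_bounded[OF resolventD(4)[OF \<zeta>]] by blast
  have "\<zeta>' \<in> resolvent_set UNIV T \<and> (\<forall>y. norm (resolvent UNIV T \<zeta>' y) \<le> 2 * K * norm y)"
    if "\<zeta>' \<in> ball \<zeta> (1 / (2 * K))" for \<zeta>'
  proof -
    have "norm ((\<zeta> *\<^sub>C x - T x) - (\<zeta>' *\<^sub>C x - T x)) \<le> 1 / (2 * K) * norm x" for x
    proof -
      have "(\<zeta> *\<^sub>C x - T x) - (\<zeta>' *\<^sub>C x - T x) = (\<zeta> - \<zeta>') *\<^sub>C x"
        by (simp add: complex_vs.scale_left_diff_distrib)
      moreover have "cmod (\<zeta> - \<zeta>') \<le> 1 / (2 * K)" using that by (simp add: dist_norm)
      ultimately show ?thesis by (simp only: norm_scaleC) (rule mult_right_mono, auto)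
    qed
    then show ?thesis
      using resolvent_perturbation[OF T T \<zeta> K(1), of \<zeta>'] K(2) by (auto simp: mult.commute)
  qed
  then show ?thesis using K(1) by (intro exI[of _ "1 / (2 * K)"] conjI exI[of _ "2 * K"]) auto
qed

lemma open_resolvent_set:
  assumes "bounded_clinear T"
  shows "open (resolvent_set UNIV T)"
  unfolding open_contains_ball using resolvent_locally_bounded[OF assms] by (meson subsetI)

lemma resolvent_bounded_on_compact:
  assumes T: "bounded_clinear T" and C: "compact C" "C \<subseteq> resolvent_set UNIV T"
  shows "\<exists>K>0. \<forall>\<zeta>\<in>C. \<forall>y. norm (resolvent UNIV T \<zeta> y) \<le> K * norm y"
proof -
  obtain r K where rK: "\<And>\<zeta>. \<zeta> \<in> C \<Longrightarrow> r \<zeta> > 0" "\<And>\<zeta>. \<zeta> \<in> C \<Longrightarrow> K \<zeta> > 0"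
      "\<And>\<zeta> \<zeta>' y. \<zeta> \<in> C \<Longrightarrow> \<zeta>' \<in> ball \<zeta> (r \<zeta>) \<Longrightarrow> norm (resolvent UNIV T \<zeta>' y) \<le> K \<zeta> * norm y"
    using resolvent_locally_bounded[OF T] C(2) by (metis subsetD)
  obtain C' where C': "C' \<subseteq> C" "finite C'" "C \<subseteq> (\<Union>\<zeta>\<in>C'. ball \<zeta> (r \<zeta>))"
    by (rule compactE_image[OF C(1), of C "\<lambda>\<zeta>. ball \<zeta> (r \<zeta>)"]) (use rK(1) in force)+
  define B where "B = 1 + (\<Sum>\<zeta>\<in>C'. K \<zeta>)"
  have pos: "K \<zeta> \<ge> 0" if "\<zeta> \<in> C'" for \<zeta> using rK(2) C'(1) that by (auto intro: less_imp_le)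
  have "B > 0" unfolding B_def using pos by (intro add_pos_nonneg sum_nonneg) auto
  moreover have "norm (resolvent UNIV T \<zeta> y) \<le> B * norm y" if \<zeta>: "\<zeta> \<in> C" for \<zeta> y
  proof -
    obtain \<zeta>0 where \<zeta>0: "\<zeta>0 \<in> C'" "\<zeta> \<in> ball \<zeta>0 (r \<zeta>0)" using C'(3) \<zeta> by blast
    have "K \<zeta>0 \<le> (\<Sum>\<zeta>\<in>C'. K \<zeta>)" using pos \<zeta>0(1) C'(2) by (intro member_le_sum) auto
    then have "K \<zeta>0 \<le> B" by (simp add: B_def)
    then show ?thesis
      using rK(3)[of \<zeta>0 \<zeta> y] \<zeta>0 C'(1) by (meson mult_right_mono norm_ge_zero order_trans subsetD)
  qed
  ultimately show ?thesis by blast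
qed

text \<open>For large \<open>\<zeta>\<close> the operator \<open>\<zeta> - T\<close> is a small perturbation of the scalar \<open>\<zeta>\<close>.\<close>

lemma spectrum_bounded:
  assumes T: "bounded_clinear T"
  shows "\<exists>B. \<forall>\<zeta>\<in>spectrum UNIV T. cmod \<zeta> \<le> B"
proof -
  obtain K where K: "K > 0" "\<And>x. norm (T x) \<le> norm x * K"
    using bounded_linear.pos_bounded T unfolding bounded_clinear_def by blast
  have "\<zeta> \<in> resolvent_set UNIV T" if \<zeta>: "cmod \<zeta> > 2 * K" for \<zeta>
  proof -
    have "\<zeta> \<noteq> 0" "cmod \<zeta> > 0" using \<zeta> K(1) by auto
    have Z: "bounded_clinear (\<lambda>x::'a. 0 :: 'a)" by (simp add: bounded_clinear_def)
    have "\<exists>x. \<zeta> *\<^sub>C x - 0 = y" for y :: 'a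
      using \<open>\<zeta> \<noteq> 0\<close> by (intro exI[of _ "inverse \<zeta> *\<^sub>C y"]) simp
    moreover have "norm x \<le> 1 / cmod \<zeta> * norm (\<zeta> *\<^sub>C x - 0)" for x :: 'a
      using \<open>\<zeta> \<noteq> 0\<close> by simp
    ultimately have *: "\<zeta> \<in> resolvent_set UNIV (\<lambda>x::'a. 0)"
        "norm (resolvent UNIV (\<lambda>x. 0) \<zeta> y) \<le> 1 / cmod \<zeta> * norm y" for y :: 'a
      using resolvent_setI[OF Z, of \<zeta> "1 / cmod \<zeta>"] by auto
    have "norm ((\<zeta> *\<^sub>C x - 0) - (\<zeta> *\<^sub>C x - T x)) \<le> 1 / (2 * (1 / cmod \<zeta>)) * norm x" for x
    proof -
      have "norm (T x) \<le> norm x * K" by (rule K(2))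
      also have "\<dots> \<le> norm x * (cmod \<zeta> / 2)" using \<zeta> by (intro mult_left_mono) auto
      finally show ?thesis by (simp add: mult.commute)
    qed
    then show ?thesis
      using resolvent_perturbation(1)[OF Z T *(1) _ *(2), of \<zeta>] \<open>cmod \<zeta> > 0\<close> by simp
  qed
  then have "cmod \<zeta> \<le> 2 * K" if "\<zeta> \<in> spectrum UNIV T" for \<zeta>
    using that unfolding spectrum_def by force
  then show ?thesis by blast
qed

lemma resolvent_identity:
  assumes T: "bounded_clinear T" and "\<zeta> \<in> resolvent_set UNIV T" "\<zeta>' \<in> resolvent_set UNIV T"
  shows "resolvent UNIV T \<zeta> y - resolvent UNIV T \<zeta>' y =
    (\<zeta>' - \<zeta>) *\<^sub>C resolvent UNIV T \<zeta> (resolvent UNIV T \<zeta>' y)"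
proof -
  define x where "x = resolvent UNIV T \<zeta>' y"
  note R = bounded_clinear_resolvent[OF bounded_clinear_imp_linear_op[OF T] assms(2)]
  have "\<zeta>' *\<^sub>C x - T x = y" unfolding x_def by (rule resolventD(2)[OF assms(3)])
  then have "y - (\<zeta> *\<^sub>C x - T x) = (\<zeta>' - \<zeta>) *\<^sub>C x"
    by (simp add: complex_vs.scale_left_diff_distrib algebra_simps)
  then have "resolvent UNIV T \<zeta> (y - (\<zeta> *\<^sub>C x - T x)) = resolvent UNIV T \<zeta> ((\<zeta>' - \<zeta>) *\<^sub>C x)"
    by simp
  then show ?thesis
    using resolventD(3)[OF assms(2), of x] by (simp add: bounded_clinearD[OF R] x_def)
qed

lemma resolvent_difference:
  assumes T: "bounded_clinear T" "bounded_clinear T'"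
    and "\<zeta> \<in> resolvent_set UNIV T" "\<zeta> \<in> resolvent_set UNIV T'"
  shows "resolvent UNIV T \<zeta> y - resolvent UNIV T' \<zeta> y =
    resolvent UNIV T' \<zeta> (T (resolvent UNIV T \<zeta> y) - T' (resolvent UNIV T \<zeta> y))"
proof -
  define x where "x = resolvent UNIV T \<zeta> y"
  note R = bounded_clinear_resolvent[OF bounded_clinear_imp_linear_op[OF T(2)] assms(4)]
  have "\<zeta> *\<^sub>C x - T x = y" unfolding x_def by (rule resolventD(2)[OF assms(3)])
  then have "T x - T' x = (\<zeta> *\<^sub>C x - T' x) - y"
    by (simp add: algebra_simps)
  then have "resolvent UNIV T' \<zeta> (T x - T' x) = resolvent UNIV T' \<zeta> ((\<zeta> *\<^sub>C x - T' x) - y)"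
    by (rule arg_cong)
  then show ?thesis
    using resolventD(3)[OF assms(4), of x] unfolding x_def[symmetric] by (simp add: bounded_clinearD[OF R])
qed

lemma tendsto_resolvent:
  assumes T: "bounded_clinear T" and \<zeta>: "\<zeta> \<in> resolvent_set UNIV T"
  shows "((\<lambda>\<xi>. resolvent UNIV T \<xi> y) \<longlongrightarrow> resolvent UNIV T \<zeta> y) (at \<zeta>)"
proof -
  obtain r K where rK: "r > 0" "K > 0" "\<And>\<zeta>'. \<zeta>' \<in> ball \<zeta> r \<Longrightarrow> \<zeta>' \<in> resolvent_set UNIV T"
      "\<And>\<zeta>' y. \<zeta>' \<in> ball \<zeta> r \<Longrightarrow> norm (resolvent UNIV T \<zeta>' y) \<le> K * norm y"
    using resolvent_locally_bounded[OF T \<zeta>] by blast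
  have "((\<lambda>\<xi>. resolvent UNIV T \<xi> y - resolvent UNIV T \<zeta> y) \<longlongrightarrow> 0) (at \<zeta>)"
  proof (rule Lim_null_comparison)
    have "eventually (\<lambda>\<xi>. \<xi> \<in> ball \<zeta> r) (at \<zeta>)"
      using rK(1) by (intro eventually_at_in_open') auto
    then show "eventually (\<lambda>\<xi>. norm (resolvent UNIV T \<xi> y - resolvent UNIV T \<zeta> y) \<le>
        cmod (\<zeta> - \<xi>) * (K * norm (resolvent UNIV T \<zeta> y))) (at \<zeta>)"
    proof eventually_elim
      case (elim \<xi>)
      have "norm (resolvent UNIV T \<xi> y - resolvent UNIV T \<zeta> y) =
          cmod (\<zeta> - \<xi>) * norm (resolvent UNIV T \<xi> (resolvent UNIV T \<zeta> y))"
        unfolding resolvent_identity[OF T rK(3)[OF elim] \<zeta>] by simp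
      also have "\<dots> \<le> cmod (\<zeta> - \<xi>) * (K * norm (resolvent UNIV T \<zeta> y))"
        by (intro mult_left_mono rK(4)[OF elim]) auto
      finally show ?case .
    qed
    have "((\<lambda>\<xi>. cmod (\<zeta> - \<xi>) * (K * norm (resolvent UNIV T \<zeta> y))) \<longlongrightarrow>
        cmod (\<zeta> - \<zeta>) * (K * norm (resolvent UNIV T \<zeta> y))) (at \<zeta>)"
      by (intro tendsto_intros)
    then show "((\<lambda>\<xi>. cmod (\<zeta> - \<xi>) * (K * norm (resolvent UNIV T \<zeta> y))) \<longlongrightarrow> 0) (at \<zeta>)" by simp
  qed
  then show ?thesis by (simp add: LIM_zero_iff)
qed

lemma continuous_on_resolvent:
  assumes "bounded_clinear T" "C \<subseteq> resolvent_set UNIV T"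
  shows "continuous_on C (\<lambda>\<xi>. resolvent UNIV T \<xi> y)"
  using tendsto_resolvent[OF assms(1)] assms(2) unfolding continuous_on_def
  by (meson subsetD tendsto_within_subset subset_UNIV)

text \<open>By the resolvent identity, the difference quotients converge to \<open>- f ((\<zeta> - T)\<inverse> (\<zeta> - T)\<inverse> y)\<close>.\<close>

lemma resolvent_holomorphic:
  fixes f :: "'v::complex_hilbert_space \<Rightarrow> complex"
  assumes T: "bounded_clinear T" and f: "bounded_clinear f"
  shows "(\<lambda>\<xi>. f (resolvent UNIV T \<xi> y)) holomorphic_on resolvent_set UNIV T"
proof (rule holomorphic_onI)
  fix \<zeta> assume \<zeta>: "\<zeta> \<in> resolvent_set UNIV T"
  define y' where "y' = resolvent UNIV T \<zeta> y"
  have "((\<lambda>\<xi>. (f (resolvent UNIV T \<xi> y) - f (resolvent UNIV T \<zeta> y)) / (\<xi> - \<zeta>)) \<longlongrightarrow> - f (resolvent UNIV T \<zeta> y')) (at \<zeta>)"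
  proof (rule Lim_transform_eventually)
    show "((\<lambda>\<xi>. - f (resolvent UNIV T \<xi> y')) \<longlongrightarrow> - f (resolvent UNIV T \<zeta> y')) (at \<zeta>)"
      using f by (intro tendsto_minus bounded_linear.tendsto[of f] tendsto_resolvent[OF T \<zeta>])
        (simp add: bounded_clinear_def)
    have "eventually (\<lambda>\<xi>. \<xi> \<in> resolvent_set UNIV T - {\<zeta>}) (at \<zeta>)"
      using eventually_at_in_open[OF open_resolvent_set[OF T] \<zeta>] .
    then show "eventually (\<lambda>\<xi>. - f (resolvent UNIV T \<xi> y') =
        (f (resolvent UNIV T \<xi> y) - f (resolvent UNIV T \<zeta> y)) / (\<xi> - \<zeta>)) (at \<zeta>)"
    proof eventually_elim
      case (elim \<xi>)
      then have \<xi>: "\<xi> \<in> resolvent_set UNIV T" "\<xi> \<noteq> \<zeta>" by auto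
      have "f (resolvent UNIV T \<xi> y) - f (resolvent UNIV T \<zeta> y) = (\<zeta> - \<xi>) * f (resolvent UNIV T \<xi> y')"
        using arg_cong[OF resolvent_identity[OF T \<xi>(1) \<zeta>, of y], of f]
        by (simp add: bounded_clinearD[OF f] scaleC_complex_def y'_def)
      then show ?case using \<xi>(2) by (simp add: field_simps)
    qed
  qed
  then have "((\<lambda>\<xi>. f (resolvent UNIV T \<xi> y)) has_field_derivative - f (resolvent UNIV T \<zeta> y')) (at \<zeta>)"
    by (simp add: has_field_derivative_iff)
  then show "(\<lambda>\<xi>. f (resolvent UNIV T \<xi> y)) field_differentiable at \<zeta> within resolvent_set UNIV T"
    using field_differentiable_at_within field_differentiable_def by blast
qed

abbreviation two_pi_i :: complex where "two_pi_i \<equiv> 2 * complex_of_real pi * \<i>"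

lemma riesz_projection_eqI:
  assumes "has_curve_integral (\<lambda>\<zeta>. resolvent UNIV T \<zeta> x) (two_pi_i *\<^sub>C y) \<theta>"
  shows "riesz_projection \<theta> T x = y"
  using curve_integral_eq[OF assms] by (simp add: riesz_projection_def)

lemma has_curve_integral_riesz_projection:
  assumes "path \<theta>" "rectifiable \<theta>" "bounded_clinear T" "path_image \<theta> \<subseteq> resolvent_set UNIV T"
  shows "has_curve_integral (\<lambda>\<zeta>. resolvent UNIV T \<zeta> x) (two_pi_i *\<^sub>C riesz_projection \<theta> T x) \<theta>"
proof -
  obtain l where "variation_le \<theta> l" using assms(2) by (auto simp: rectifiable_variation_le)
  then obtain I where I: "has_curve_integral (\<lambda>\<zeta>. resolvent UNIV T \<zeta> x) I \<theta>"
    using curve_integral_exists[OF assms(1) _ continuous_on_resolvent[OF assms(3,4)]] by blast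
  then have "two_pi_i *\<^sub>C riesz_projection \<theta> T x = I"
    using curve_integral_eq[OF I] by (simp add: riesz_projection_def)
  then show ?thesis using I by simp
qed

lemma riesz_projection_clinear:
  assumes "path \<theta>" "rectifiable \<theta>" "bounded_clinear T" "path_image \<theta> \<subseteq> resolvent_set UNIV T"
  shows "riesz_projection \<theta> T (x + y) = riesz_projection \<theta> T x + riesz_projection \<theta> T y"
    "riesz_projection \<theta> T (c *\<^sub>C x) = c *\<^sub>C riesz_projection \<theta> T x"
proof -
  note int = has_curve_integral_riesz_projection[OF assms]
  have R: "bounded_clinear (resolvent UNIV T \<zeta>)" if "\<zeta> \<in> path_image \<theta>" for \<zeta>
    using bounded_clinear_resolvent[OF bounded_clinear_imp_linear_op[OF assms(3)]] assms(4) that by blast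
  show "riesz_projection \<theta> T (x + y) = riesz_projection \<theta> T x + riesz_projection \<theta> T y"
    using has_curve_integral_add[OF int[of x] int[of y]]
    by (intro riesz_projection_eqI)
       (auto simp: scaleC_add_right bounded_clinearD[OF R] elim!: has_curve_integral_cong)
  show "riesz_projection \<theta> T (c *\<^sub>C x) = c *\<^sub>C riesz_projection \<theta> T x"
    using has_curve_integral_scaleC[OF int[of x], of c]
    by (intro riesz_projection_eqI)
       (auto simp: mult.commute bounded_clinearD[OF R] elim!: has_curve_integral_cong)
qed

text \<open>The factor \<open>1 / (2 \<pi>)\<close> is dropped in the bounds.\<close>

lemma norm_riesz_projection_le:
  assumes "path \<theta>" "rectifiable \<theta>" "bounded_clinear T" "path_image \<theta> \<subseteq> resolvent_set UNIV T"
    and "variation_le \<theta> l" "\<And>\<zeta>. \<zeta> \<in> path_image \<theta> \<Longrightarrow> norm (resolvent UNIV T \<zeta> x) \<le> B"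
  shows "norm (riesz_projection \<theta> T x) \<le> l * B"
proof -
  have "2 * pi * norm (riesz_projection \<theta> T x) \<le> l * B"
    using norm_curve_integral_le[OF has_curve_integral_riesz_projection[OF assms(1-4), of x] assms(5,6)]
    by (simp add: norm_mult)
  moreover have "1 * norm (riesz_projection \<theta> T x) \<le> 2 * pi * norm (riesz_projection \<theta> T x)"
    using pi_ge_two by (intro mult_right_mono) auto
  ultimately show ?thesis by simp
qed

lemma norm_riesz_projection_diff_le:
  assumes "path \<theta>" "rectifiable \<theta>"
    and "bounded_clinear T" "path_image \<theta> \<subseteq> resolvent_set UNIV T"
    and "bounded_clinear T'" "path_image \<theta> \<subseteq> resolvent_set UNIV T'"
    and "variation_le \<theta> l"
    and "\<And>\<zeta>. \<zeta> \<in> path_image \<theta> \<Longrightarrow> norm (resolvent UNIV T \<zeta> x - resolvent UNIV T' \<zeta> x) \<le> B"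
  shows "norm (riesz_projection \<theta> T x - riesz_projection \<theta> T' x) \<le> l * B"
proof -
  have "2 * pi * norm (riesz_projection \<theta> T x - riesz_projection \<theta> T' x) \<le> l * B"
    using norm_curve_integral_le[OF has_curve_integral_diff[OF
        has_curve_integral_riesz_projection[OF assms(1-4), of x]
        has_curve_integral_riesz_projection[OF assms(1,2,5,6), of x]] assms(7,8)]
    by (simp add: norm_mult flip: complex_vs.scale_right_diff_distrib)
  moreover have "1 * norm (riesz_projection \<theta> T x - riesz_projection \<theta> T' x) \<le> 2 * pi * norm (riesz_projection \<theta> T x - riesz_projection \<theta> T' x)"
    using pi_ge_two by (intro mult_right_mono) auto
  ultimately show ?thesis by simp
qed

section \<open>Polynomials of an operator\<close>

fun dom_pow :: "'a set \<Rightarrow> ('a \<Rightarrow> 'a) \<Rightarrow> nat \<Rightarrow> 'a set"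
  where "dom_pow D A 0 = UNIV" | "dom_pow D A (Suc n) = {x \<in> D. A x \<in> dom_pow D A n}"

definition poly_op :: "('a \<Rightarrow> 'a) \<Rightarrow> complex poly \<Rightarrow> 'a \<Rightarrow> 'a::complex_hilbert_space"
  where "poly_op A q x = (\<Sum>i\<le>degree q. coeff q i *\<^sub>C (A ^^ i) x)"

lemma poly_op_eq_sum:
  assumes "degree q \<le> n"
  shows "poly_op A q x = (\<Sum>i\<le>n. coeff q i *\<^sub>C (A ^^ i) x)"
  unfolding poly_op_def using assms
  by (intro sum.mono_neutral_left) (auto simp: coeff_eq_0)

lemma poly_op_0 [simp]: "poly_op A 0 x = 0"
  by (simp add: poly_op_def)

lemma poly_op_1 [simp]: "poly_op A 1 x = x"
  by (simp add: poly_op_def)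

lemma poly_op_add: "poly_op A (p + q) x = poly_op A p x + poly_op A q x"
proof -
  define n where "n = max (degree p) (degree q)"
  have "degree p \<le> n" "degree q \<le> n" "degree (p + q) \<le> n"
    by (auto simp: n_def degree_add_le)
  then show ?thesis
    by (simp add: poly_op_eq_sum scaleC_add_left sum.distrib)
qed

lemma poly_op_smult: "poly_op A (smult c q) x = c *\<^sub>C poly_op A q x"
proof -
  have "poly_op A (smult c q) x = (\<Sum>i\<le>degree q. coeff (smult c q) i *\<^sub>C (A ^^ i) x)"
    by (rule poly_op_eq_sum) (rule degree_smult_le)
  then show ?thesis
    by (simp add: poly_op_def complex_vs.scale_sum_right)
qed

lemma poly_op_diff: "poly_op A (p - q) x = poly_op A p x - poly_op A q x"
  using poly_op_add[of A "p - q" q x] by simp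

lemma poly_op_sum: "poly_op A (\<Sum>i\<in>I. f i) x = (\<Sum>i\<in>I. poly_op A (f i) x)"
  by (induction I rule: infinite_finite_induct) (auto simp: poly_op_add)

lemma linear_op_sum:
  assumes "linear_op D A" "finite I" "\<And>i. i \<in> I \<Longrightarrow> f i \<in> D"
  shows "(\<Sum>i\<in>I. c i *\<^sub>C f i) \<in> D \<and> A (\<Sum>i\<in>I. c i *\<^sub>C f i) = (\<Sum>i\<in>I. c i *\<^sub>C A (f i))"
  using assms(2,3) by (induction I rule: finite_induct) (auto simp: linear_opD[OF assms(1)])

lemma funpow_dom_pow: "x \<in> dom_pow D A (Suc n) \<Longrightarrow> i \<le> n \<Longrightarrow> (A ^^ i) x \<in> D"
proof (induction i arbitrary: x n)
  case (Suc i)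
  then obtain n' where n': "n = Suc n'" by (cases n) auto
  have "A x \<in> dom_pow D A (Suc n')" using Suc.prems(1) n' by simp
  then have "(A ^^ i) (A x) \<in> D" using Suc.IH[of "A x" n'] Suc.prems(2) n' by simp
  then show ?case by (simp add: funpow_swap1)
qed simp

lemma dom_pow_Suc_subset: "dom_pow D A (Suc n) \<subseteq> dom_pow D A n"
  by (induction n) auto

lemma csubspace_dom_pow:
  assumes "linear_op D A"
  shows "csubspace (dom_pow D A n)"
proof (induction n)
  case (Suc n)
  then show ?case
    unfolding csubspace_iff by (auto simp: linear_opD[OF assms])
qed (auto simp: csubspace_iff)

lemma poly_op_pCons_0:
  assumes "linear_op D A" "x \<in> dom_pow D A (Suc n)" "degree q \<le> n"
  shows "poly_op A q x \<in> D" "A (poly_op A q x) = poly_op A (pCons 0 q) x"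
proof -
  have *: "poly_op A q x = (\<Sum>i\<le>n. coeff q i *\<^sub>C (A ^^ i) x)"
    using assms(3) by (rule poly_op_eq_sum)
  have **: "(\<Sum>i\<le>n. coeff q i *\<^sub>C (A ^^ i) x) \<in> D \<and>
      A (\<Sum>i\<le>n. coeff q i *\<^sub>C (A ^^ i) x) = (\<Sum>i\<le>n. coeff q i *\<^sub>C A ((A ^^ i) x))"
    using funpow_dom_pow[OF assms(2)] by (intro linear_op_sum assms(1)) auto
  then show "poly_op A q x \<in> D" by (simp add: *)
  have "degree (pCons 0 q) \<le> Suc n"
    using assms(3) degree_pCons_le[of 0 q] by linarith
  then have "poly_op A (pCons 0 q) x = (\<Sum>i\<le>Suc n. coeff (pCons 0 q) i *\<^sub>C (A ^^ i) x)"
    by (rule poly_op_eq_sum)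
  also have "\<dots> = (\<Sum>i\<le>n. coeff q i *\<^sub>C A ((A ^^ i) x))"
    by (subst sum.atMost_Suc_shift) simp
  finally show "A (poly_op A q x) = poly_op A (pCons 0 q) x" using ** * by simp
qed

lemma poly_op_linear_factor:
  assumes "linear_op D A" "x \<in> dom_pow D A (Suc n)" "degree q \<le> n"
  shows "poly_op A ([:- c, 1:] * q) x = A (poly_op A q x) - c *\<^sub>C poly_op A q x"
proof -
  have "[:- c, 1:] * q = pCons 0 q - smult c q" by simp
  then show ?thesis
    using poly_op_pCons_0(2)[OF assms] by (simp only: poly_op_diff poly_op_smult)
qed

lemma poly_op_invariant:
  assumes "linear_op D A" "csubspace W" "\<And>v. v \<in> D \<Longrightarrow> v \<in> W \<Longrightarrow> A v \<in> W"
    and "x \<in> dom_pow D A n" "x \<in> W" "degree q \<le> n"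
  shows "poly_op A q x \<in> W"
proof -
  have "(A ^^ i) x \<in> W" if "i \<le> n" for i
    using that
  proof (induction i)
    case (Suc i)
    then obtain n' where "n = Suc n'" by (cases n) auto
    then have "(A ^^ i) x \<in> D" using Suc.prems assms(4) funpow_dom_pow[of x D A n' i] by simp
    then show ?case using Suc assms(3) by simp
  qed (simp add: assms(5))
  then show ?thesis
    unfolding poly_op_eq_sum[OF assms(6)]
    by (intro complex_vs.subspace_sum assms(2) complex_vs.subspace_scale) auto
qed

lemma resolvent_dom_pow:
  assumes "linear_op D A" "\<zeta> \<in> resolvent_set D A"
  shows "y \<in> dom_pow D A n \<Longrightarrow> resolvent D A \<zeta> y \<in> dom_pow D A (Suc n)"
proof (induction n)
  case 0
  then show ?case using resolventD(1)[OF assms(2)] by simp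
next
  case (Suc n)
  let ?x = "resolvent D A \<zeta> y"
  have x: "?x \<in> dom_pow D A (Suc n)" using Suc.IH[OF subsetD[OF dom_pow_Suc_subset Suc.prems]] .
  have "A ?x = \<zeta> *\<^sub>C ?x - y" using resolventD(2)[OF assms(2), of y] by (simp add: algebra_simps)
  then have "A ?x \<in> dom_pow D A (Suc n)"
    using x Suc.prems csubspace_dom_pow[OF assms(1)]
    by (metis complex_vs.subspace_diff complex_vs.subspace_scale)
  then show ?case using resolventD(1)[OF assms(2)] by simp
qed

abbreviation root_poly :: "complex list \<Rightarrow> complex poly"
  where "root_poly zs \<equiv> (\<Prod>z\<leftarrow>zs. [:- z, 1:])"

lemma degree_root_poly [simp]: "degree (root_poly zs) = length zs"
proof (induction zs)
  case (Cons z zs)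
  have "root_poly zs \<noteq> 0" by (auto simp: prod_list_zero_iff)
  then have "degree ([:- z, 1:] * root_poly zs) = Suc (degree (root_poly zs))"
    by (subst degree_mult_eq) auto
  then show ?case using Cons by (simp only: list.map prod_list.Cons list.size)
qed simp

lemma poly_root_poly: "\<xi> \<in> set zs \<Longrightarrow> poly (root_poly zs) \<xi> = 0"
  by (induction zs) auto

text \<open>The factors are inverted one by one by resolvents, each of which raises the power of the domain by
  one and preserves \<open>W\<close>.\<close>

lemma root_poly_op_surj:
  assumes lin: "linear_op D A" and W: "csubspace W"
    and zs: "\<And>\<zeta>. \<zeta> \<in> set zs \<Longrightarrow> \<zeta> \<in> resolvent_set D A \<and> resolvent D A \<zeta> ` W \<subseteq> W"
    and y: "y \<in> dom_pow D A k" "y \<in> W"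
  shows "\<exists>u\<in>dom_pow D A (k + length zs) \<inter> W. poly_op A (root_poly zs) u = y"
  using zs y
proof (induction zs arbitrary: y k)
  case (Cons z zs)
  have z: "z \<in> resolvent_set D A" "resolvent D A z ` W \<subseteq> W" using Cons.prems(1) by auto
  define y1 where "y1 = (- 1) *\<^sub>C resolvent D A z y"
  have "resolvent D A z y \<in> dom_pow D A (Suc k) \<inter> W"
    using resolvent_dom_pow[OF lin z(1) Cons.prems(2)] z(2) Cons.prems(3) by auto
  then have "y1 \<in> dom_pow D A (Suc k) \<inter> W"
    unfolding y1_def using csubspace_dom_pow[OF lin] W complex_vs.subspace_scale
    by (metis IntD1 IntD2 IntI)
  then obtain u where u: "u \<in> dom_pow D A (Suc k + length zs)" "u \<in> W" "poly_op A (root_poly zs) u = y1"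
    using Cons.IH[of y1 "Suc k"] Cons.prems(1) by auto
  have "poly_op A (root_poly (z # zs)) u = A y1 - z *\<^sub>C y1"
    using poly_op_linear_factor[OF lin, of u "k + length zs" "root_poly zs" z] u
    by (simp del: mult_pCons_left)
  also have "\<dots> = y"
    using resolventD(2)[OF z(1), of y] linear_opD(3)[OF lin resolventD(1)[OF z(1)], of "-1" y]
    by (simp add: y1_def)
  finally show ?case using u(1,2) by (intro bexI[of _ u]) auto
qed auto

text \<open>If \<open>A - x\<close> is bounded below on \<open>W\<close> for each \<open>x\<close> in the list \<open>xs\<close>, then the factors \<open>A - x\<close> may be
  exchanged for factors \<open>A - z\<close> one by one, because
  \<open>\<parallel>(A - z) v\<parallel> \<le> \<parallel>(A - x) v\<parallel> + \<bar>x - z\<bar> \<parallel>v\<parallel>\<close>.\<close>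

lemma root_poly_op_exchange:
  assumes lin: "linear_op D A" and W: "csubspace W" "\<And>v. v \<in> D \<Longrightarrow> v \<in> W \<Longrightarrow> A v \<in> W"
    and len: "length zs = length xs"
    and below: "\<And>\<xi>. \<xi> \<in> set xs \<Longrightarrow> \<exists>c>0. \<forall>v\<in>D \<inter> W. c * norm v \<le> norm (A v - \<xi> *\<^sub>C v)"
  shows "\<exists>C\<ge>0. \<forall>n. \<forall>u\<in>dom_pow D A n \<inter> W. \<forall>q. degree q + length zs \<le> n \<longrightarrow>
      norm (poly_op A (root_poly zs * q) u) \<le> C * norm (poly_op A (root_poly xs * q) u)"
  using len below
proof (induction zs xs rule: list_induct2)
  case Nil
  show ?case by (intro exI[of _ 1]) auto
next
  case (Cons z zs \<xi> xs)
  obtain C where C: "C \<ge> 0" "\<And>n u q. u \<in> dom_pow D A n \<inter> W \<Longrightarrow> degree q + length zs \<le> n \<Longrightarrow>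
      norm (poly_op A (root_poly zs * q) u) \<le> C * norm (poly_op A (root_poly xs * q) u)"
    using Cons.IH Cons.prems by (metis list.set_intros(2))
  obtain c where c: "c > 0" "\<And>v. v \<in> D \<inter> W \<Longrightarrow> c * norm v \<le> norm (A v - \<xi> *\<^sub>C v)"
    using Cons.prems[of \<xi>] by auto
  define C' where "C' = 1 + cmod (\<xi> - z) / c"
  have C': "C' \<ge> 0" using c(1) by (simp add: C'_def add_nonneg_nonneg)
  have "norm (poly_op A (root_poly (z # zs) * q) u) \<le> (C * C') * norm (poly_op A (root_poly (\<xi> # xs) * q) u)"
    if u: "u \<in> dom_pow D A n \<inter> W" and deg: "degree q + length (z # zs) \<le> n" for n u q
  proof -
    obtain n' where n': "n = Suc n'" using deg by (cases n) auto
    define v where "v = poly_op A (root_poly xs * q) u"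
    have dq: "degree (root_poly xs * q) \<le> n'"
      using degree_mult_le[of "root_poly xs" q] deg n' Cons.hyps by simp
    have un: "u \<in> dom_pow D A (Suc n')" "u \<in> W" using u n' by auto
    have v: "v \<in> D" "v \<in> W"
      unfolding v_def
      using poly_op_pCons_0(1)[OF lin un(1) dq] poly_op_invariant[OF lin W, of u n "root_poly xs * q"] u dq n' by auto
    have "norm (poly_op A (root_poly (z # zs) * q) u) = norm (poly_op A (root_poly zs * ([:- z, 1:] * q)) u)"
      by (simp only: list.map prod_list.Cons mult.assoc mult.left_commute)
    also have "\<dots> \<le> C * norm (poly_op A (root_poly xs * ([:- z, 1:] * q)) u)"
      using deg degree_mult_le[of "[:- z, 1:]" q] by (intro C(2)[OF u]) (simp del: mult_pCons_left)
    also have "root_poly xs * ([:- z, 1:] * q) = [:- z, 1:] * (root_poly xs * q)"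
      by (rule mult.left_commute)
    also have "poly_op A \<dots> u = A v - z *\<^sub>C v"
      unfolding v_def by (rule poly_op_linear_factor[OF lin un(1) dq])
    also have "norm (A v - z *\<^sub>C v) \<le> C' * norm (A v - \<xi> *\<^sub>C v)"
    proof -
      have "A v - z *\<^sub>C v = (A v - \<xi> *\<^sub>C v) + (\<xi> - z) *\<^sub>C v"
        by (simp add: complex_vs.scale_left_diff_distrib)
      then have "norm (A v - z *\<^sub>C v) \<le> norm (A v - \<xi> *\<^sub>C v) + cmod (\<xi> - z) * norm v"
        by (metis norm_scaleC norm_triangle_ineq)
      also have "\<dots> \<le> norm (A v - \<xi> *\<^sub>C v) + cmod (\<xi> - z) * (norm (A v - \<xi> *\<^sub>C v) / c)"
        using c v by (intro add_left_mono mult_left_mono) (auto simp: field_simps)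
      finally show ?thesis by (simp add: C'_def algebra_simps)
    qed
    also have "A v - \<xi> *\<^sub>C v = poly_op A ([:- \<xi>, 1:] * (root_poly xs * q)) u"
      unfolding v_def by (rule poly_op_linear_factor[OF lin un(1) dq, symmetric])
    also have "[:- \<xi>, 1:] * (root_poly xs * q) = root_poly (\<xi> # xs) * q"
      by (simp only: list.map prod_list.Cons mult.assoc)
    finally show ?thesis using C(1) by (simp add: mult_left_mono mult.assoc)
  qed
  then show ?case using C(1) C' by (intro exI[of _ "C * C'"]) auto
qed

text \<open>With \<open>u\<close> such that \<open>y = \<Prod> (A - z k) u\<close>, the filter minus \<open>\<mu>\<close> becomes a polynomial \<open>p\<close> in \<open>A\<close> of
  degree \<open>N\<close> applied to \<open>u\<close>; its degree does not drop as \<open>w N\<close>, the value of the filter at infinity,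
  differs from \<open>\<mu>\<close>.  The roots of \<open>p\<close> are exchanged for the poles \<open>z k\<close>.\<close>

theorem filter_op_bounded_below:
  assumes lin: "linear_op D A" and W: "csubspace W" "\<And>v. v \<in> D \<Longrightarrow> v \<in> W \<Longrightarrow> A v \<in> W"
    and z: "\<And>k. k < N \<Longrightarrow> z k \<in> resolvent_set D A" "\<And>k. k < N \<Longrightarrow> resolvent D A (z k) ` W \<subseteq> W"
    and w: "w N \<noteq> \<mu>"
    and below: "\<And>\<xi>. (\<And>k. k < N \<Longrightarrow> \<xi> \<noteq> z k) \<Longrightarrow> filter_fun w z N \<xi> = \<mu> \<Longrightarrow>
      \<exists>c>0. \<forall>v\<in>D \<inter> W. c * norm v \<le> norm (A v - \<xi> *\<^sub>C v)"
  shows "\<exists>c>0. \<forall>y\<in>W. c * norm y \<le> norm (filter_op w z N (resolvent D A) y - \<mu> *\<^sub>C y)"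
proof -
  define zs where "zs = map z [0..<N]"
  define \<pi> where "\<pi> = root_poly zs"
  define q where "q = (\<lambda>k. \<Prod>j\<in>{..<N} - {k}. [:- z j, 1:])"
  define p where "p = smult (w N - \<mu>) \<pi> - (\<Sum>k<N. smult (w k) (q k))"
  have \<pi>_prod: "\<pi> = (\<Prod>j<N. [:- z j, 1:])"
    unfolding \<pi>_def zs_def by (simp add: prod.distinct_set_conv_list[symmetric] o_def atLeast0LessThan)
  have \<pi>q: "\<pi> = [:- z k, 1:] * q k" if "k < N" for k
    unfolding \<pi>_prod q_def using that by (intro prod.remove) auto
  have deg\<pi>: "degree \<pi> = N" unfolding \<pi>_def degree_root_poly by (simp add: zs_def)
  have degq: "degree (q k) < N" if "k < N" for k
  proof -
    have "degree (q k) \<le> (\<Sum>j\<in>{..<N} - {k}. degree [:- z j, 1:])"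
      unfolding q_def by (rule degree_prod_sum_le[unfolded o_def]) auto
    also have "\<dots> = card ({..<N} - {k})" by simp
    also have "\<dots> < N" using that by (simp add: card_Diff_singleton)
    finally show ?thesis .
  qed
  have lead: "coeff \<pi> N = 1"
  proof -
    have "lead_coeff \<pi> = 1" unfolding \<pi>_prod by (simp add: lead_coeff_prod)
    then show ?thesis by (simp add: deg\<pi>)
  qed
  have coeffp: "coeff p N = w N - \<mu>"
    unfolding p_def by (simp add: coeff_sum lead coeff_eq_0 degq)
  have "degree p \<le> N"
  proof -
    have "degree (\<Sum>k<N. smult (w k) (q k)) \<le> N"
      by (intro degree_sum_le) (auto intro!: order_trans[OF degree_smult_le] less_imp_le degq)
    then show ?thesis unfolding p_def
      by (intro degree_diff_le order_trans[OF degree_smult_le]) (auto simp: deg\<pi>)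
  qed
  then have degp: "degree p = N"
    using w coeffp le_degree[of p N] by auto
  obtain root where root: "smult (lead_coeff p) (\<Prod>i<degree p. [:- root i, 1:]) = p"
    by (rule complex_poly_decompose')
  define xs where "xs = map root [0..<N]"
  have p_xs: "p = smult (w N - \<mu>) (root_poly xs)"
    using root unfolding xs_def degp coeffp
    by (simp add: prod.distinct_set_conv_list[symmetric] o_def atLeast0LessThan)
  have poly_p: "poly p \<xi> = (filter_fun w z N \<xi> - \<mu>) * poly \<pi> \<xi>" if \<xi>: "\<And>k. k < N \<Longrightarrow> \<xi> \<noteq> z k" for \<xi>
  proof -
    have "poly (q k) \<xi> = - inverse (z k - \<xi>) * poly \<pi> \<xi>" if "k < N" for k
    proof -
      have "poly \<pi> \<xi> = (\<xi> - z k) * poly (q k) \<xi>"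
        unfolding \<pi>q[OF that] by (simp add: algebra_simps)
      moreover have "- inverse (z k - \<xi>) * (\<xi> - z k) = 1"
        using \<xi>[OF that] by (simp add: field_simps)
      ultimately show ?thesis by (metis mult.assoc mult_1)
    qed
    then show ?thesis
      unfolding p_def filter_fun_def
      by (simp add: poly_sum algebra_simps sum_distrib_left sum_distrib_right sum_negf)
  qed
  have good: "\<exists>c>0. \<forall>v\<in>D \<inter> W. c * norm v \<le> norm (A v - \<xi> *\<^sub>C v)" if "\<xi> \<in> set xs" for \<xi>
  proof (cases "\<exists>k<N. \<xi> = z k")
    case True
    then show ?thesis using bounded_below_resolvent_set z(1) by (metis Int_iff)
  next
    case False
    have "poly p \<xi> = 0"
      using poly_root_poly[OF that] unfolding p_xs by simp
    moreover have "poly \<pi> \<xi> \<noteq> 0"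
      using False unfolding \<pi>_prod by (auto simp: poly_prod)
    ultimately have "filter_fun w z N \<xi> = \<mu>" using poly_p[of \<xi>] False by auto
    then show ?thesis using below[of \<xi>] False by blast
  qed
  have "length zs = length xs" by (simp add: zs_def xs_def)
  from root_poly_op_exchange[OF lin W this good]
  obtain C where C: "C \<ge> 0" "\<And>n u q. u \<in> dom_pow D A n \<inter> W \<Longrightarrow> degree q + length zs \<le> n \<Longrightarrow>
      norm (poly_op A (root_poly zs * q) u) \<le> C * norm (poly_op A (root_poly xs * q) u)"
    by blast
  define c where "c = cmod (w N - \<mu>) / (C + 1)"
  have "c > 0" using w C(1) by (simp add: c_def add_nonneg_pos)
  have "c * norm y \<le> norm (filter_op w z N (resolvent D A) y - \<mu> *\<^sub>C y)" if "y \<in> W" for y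
  proof -
    have "\<zeta> \<in> resolvent_set D A \<and> resolvent D A \<zeta> ` W \<subseteq> W" if \<zeta>: "\<zeta> \<in> set zs" for \<zeta>
    proof -
      obtain k where "k < N" "\<zeta> = z k" using \<zeta> by (auto simp: zs_def)
      then show ?thesis using z by simp
    qed
    then have "\<exists>u\<in>dom_pow D A (0 + length zs) \<inter> W. poly_op A (root_poly zs) u = y"
      by (rule root_poly_op_surj[OF lin W(1)]) (use \<open>y \<in> W\<close> in auto)
    then obtain u where u: "u \<in> dom_pow D A N \<inter> W" "poly_op A \<pi> u = y"
      unfolding \<pi>_def[symmetric] by (auto simp: zs_def)
    have qk: "poly_op A (q k) u = - resolvent D A (z k) y" if "k < N" for k
    proof -
      obtain n where n: "N = Suc n" using \<open>k < N\<close> by (cases N) auto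
      have un: "u \<in> dom_pow D A (Suc n)" "degree (q k) \<le> n" using u(1) degq[OF that] n by auto
      define v where "v = poly_op A (q k) u"
      have "v \<in> D" unfolding v_def by (rule poly_op_pCons_0(1)[OF lin un])
      have "y = A v - z k *\<^sub>C v"
        using poly_op_linear_factor[OF lin un, of "z k"] u(2) unfolding \<pi>q[OF that] v_def by simp
      then have "resolvent D A (z k) (- y) = v"
        by (intro resolvent_eqI[OF z(1)[OF that] \<open>v \<in> D\<close>]) simp
      then show ?thesis
        using resolventD(4)[OF z(1)[OF that]] by (simp add: v_def linear_simps)
    qed
    have "poly_op A p u = (w N - \<mu>) *\<^sub>C y + (\<Sum>k<N. w k *\<^sub>C resolvent D A (z k) y)"
      unfolding p_def by (simp add: poly_op_diff poly_op_smult poly_op_sum u(2) qk sum_negf)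
    also have "\<dots> = filter_op w z N (resolvent D A) y - \<mu> *\<^sub>C y"
      by (simp add: filter_op_def complex_vs.scale_left_diff_distrib)
    finally have p: "poly_op A p u = filter_op w z N (resolvent D A) y - \<mu> *\<^sub>C y" .
    have "norm y \<le> C * norm (poly_op A (root_poly xs) u)"
      using C(2)[OF u(1), of 1] u(2) by (simp add: \<pi>_def zs_def)
    also have "\<dots> \<le> (C + 1) * norm (poly_op A (root_poly xs) u)"
      by (intro mult_right_mono) auto
    finally have "c * norm y \<le> c * ((C + 1) * norm (poly_op A (root_poly xs) u))"
      using \<open>c > 0\<close> by (intro mult_left_mono) auto
    also have "\<dots> = cmod (w N - \<mu>) * norm (poly_op A (root_poly xs) u)"
      using C(1) by (simp add: c_def)
    also have "\<dots> = norm (poly_op A p u)"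
      unfolding p_xs poly_op_smult by simp
    finally show ?thesis by (simp add: p)
  qed
  then show ?thesis using \<open>c > 0\<close> by blast
qed

section \<open>Operators that are a multiple of the identity up to finite rank\<close>

definition shift :: "('a \<Rightarrow> 'a) \<Rightarrow> complex \<Rightarrow> 'a \<Rightarrow> 'a::complex_hilbert_space"
  where "shift T \<kappa> x = T x - \<kappa> *\<^sub>C x"

definition gen_eigenspace :: "('a \<Rightarrow> 'a) \<Rightarrow> complex \<Rightarrow> 'a::complex_hilbert_space set"
  where "gen_eigenspace T \<kappa> = {x. \<exists>n. (shift T \<kappa> ^^ n) x = 0}"

abbreviation gen_eigenspan :: "('a \<Rightarrow> 'a) \<Rightarrow> 'a::complex_hilbert_space set"
  where "gen_eigenspan T \<equiv> cspan (\<Union>\<kappa>. gen_eigenspace T \<kappa>)"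

lemma funpow_linear:
  assumes "linear_op UNIV T"
  shows "(T ^^ n) (x + y) = (T ^^ n) x + (T ^^ n) y" "(T ^^ n) (c *\<^sub>C x) = c *\<^sub>C (T ^^ n) x" "(T ^^ n) 0 = 0"
proof -
  show "(T ^^ n) (x + y) = (T ^^ n) x + (T ^^ n) y" "(T ^^ n) (c *\<^sub>C x) = c *\<^sub>C (T ^^ n) x" "(T ^^ n) 0 = 0"
    by (induction n) (simp_all add: linear_opD[OF assms])
qed

lemma linear_op_shift:
  assumes "linear_op UNIV T"
  shows "linear_op UNIV (shift T \<kappa>)"
  using assms
  by (simp add: linear_op_def shift_def scaleC_add_right complex_vs.scale_right_diff_distrib mult.commute)

lemma csubspace_gen_eigenspace:
  assumes "linear_op UNIV T"
  shows "csubspace (gen_eigenspace T \<kappa>)"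
proof -
  note lin = funpow_linear[OF linear_op_shift[OF assms]]
  have "\<exists>k. (shift T \<kappa> ^^ k) (x + y) = 0" if "(shift T \<kappa> ^^ m) x = 0" "(shift T \<kappa> ^^ n) y = 0" for x y m n
  proof -
    have "(shift T \<kappa> ^^ (n + m)) x = 0"
      using that(1) by (simp add: funpow_add lin)
    moreover have "(shift T \<kappa> ^^ (m + n)) y = 0"
      using that(2) by (simp add: funpow_add lin)
    ultimately have "(shift T \<kappa> ^^ (n + m)) (x + y) = 0" by (simp add: lin add.commute)
    then show ?thesis ..
  qed
  then show ?thesis
    unfolding csubspace_iff gen_eigenspace_def by (auto simp: lin)
qed

text \<open>On the generalised eigenspace of \<open>\<kappa>\<close> the operator \<open>T - \<nu> = (T - \<kappa>) + (\<kappa> - \<nu>)\<close> is invertible for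
  \<open>\<nu> \<noteq> \<kappa>\<close>, as each vector is annihilated by a power of \<open>T - \<kappa>\<close>.\<close>

lemma gen_eigenspace_shift_surj:
  assumes lin: "linear_op UNIV T" and "\<kappa> \<noteq> \<nu>" "g \<in> gen_eigenspace T \<kappa>"
  shows "\<exists>g'\<in>gen_eigenspace T \<kappa>. shift T \<nu> g' = g"
proof -
  note sub = csubspace_gen_eigenspace[OF lin, of \<kappa>]
  have "\<exists>g'\<in>gen_eigenspace T \<kappa>. shift T \<nu> g' = g" if "(shift T \<kappa> ^^ n) g = 0" for n g
    using that
  proof (induction n arbitrary: g)
    case 0
    then show ?case
      using linear_opD(9)[OF linear_op_shift[OF lin]] complex_vs.subspace_0[OF sub] by force
  next
    case (Suc n)
    define g1 where "g1 = shift T \<kappa> g"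
    have "(shift T \<kappa> ^^ n) g1 = 0" using Suc.prems by (simp add: g1_def funpow_swap1)
    then obtain g1' where g1': "g1' \<in> gen_eigenspace T \<kappa>" "shift T \<nu> g1' = g1" using Suc.IH by blast
    have "g \<in> gen_eigenspace T \<kappa>" unfolding gen_eigenspace_def using Suc.prems by blast
    then have mem: "inverse (\<kappa> - \<nu>) *\<^sub>C (g - g1') \<in> gen_eigenspace T \<kappa>"
      using g1'(1) sub complex_vs.subspace_diff complex_vs.subspace_scale by blast
    have "shift T \<nu> g = g1 + (\<kappa> - \<nu>) *\<^sub>C g"
      by (simp add: shift_def g1_def complex_vs.scale_left_diff_distrib)
    then have "shift T \<nu> (inverse (\<kappa> - \<nu>) *\<^sub>C (g - g1')) = inverse (\<kappa> - \<nu>) *\<^sub>C (\<kappa> - \<nu>) *\<^sub>C g"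
      using g1'(2) by (simp add: linear_opD[OF linear_op_shift[OF lin]])
    also have "\<dots> = g" using \<open>\<kappa> \<noteq> \<nu>\<close> by (simp add: scaleC_scaleC)
    finally show ?case using mem by blast
  qed
  then show ?thesis using assms(3) by (auto simp: gen_eigenspace_def)
qed

text \<open>On the generalised eigenspaces for the other points, \<open>T - \<nu>\<close> is onto, so \<open>(T - \<nu>) x\<close> differs from
  some \<open>(T - \<nu>) a\<close>, with \<open>a\<close> in the span, by a vector that a power of \<open>T - \<nu>\<close> annihilates.  Then \<open>x - a\<close>
  is a generalised eigenvector for \<open>\<nu>\<close>.\<close>

lemma shift_in_gen_eigenspan:
  assumes lin: "linear_op UNIV T" and "shift T \<nu> x \<in> gen_eigenspan T"
  shows "x \<in> gen_eigenspan T"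
proof -
  let ?X = "gen_eigenspan T" and ?Y = "gen_eigenspace T \<nu>"
  note S = linear_opD[OF linear_op_shift[OF lin, of \<nu>]]
  note subY = csubspace_gen_eigenspace[OF lin, of \<nu>]
  have "\<exists>a\<in>?X. \<exists>b\<in>?Y. y = shift T \<nu> a + b" if "y \<in> ?X" for y
    using that
  proof (induction rule: complex_vs.span_induct)
    case base
    show ?case
      unfolding csubspace_iff
    proof (intro conjI ballI allI CollectI)
      show "\<exists>a\<in>?X. \<exists>b\<in>?Y. 0 = shift T \<nu> a + b"
        using complex_vs.span_zero complex_vs.subspace_0[OF subY] S(9) by (metis add_0)
    next
      fix y y' assume "y \<in> {y. \<exists>a\<in>?X. \<exists>b\<in>?Y. y = shift T \<nu> a + b}" "y' \<in> {y. \<exists>a\<in>?X. \<exists>b\<in>?Y. y = shift T \<nu> a + b}"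
      then obtain a b a' b' where *: "a \<in> ?X" "b \<in> ?Y" "y = shift T \<nu> a + b" "a' \<in> ?X" "b' \<in> ?Y" "y' = shift T \<nu> a' + b'"
        by blast
      then have "y + y' = shift T \<nu> (a + a') + (b + b')" by (simp add: S(2))
      then show "\<exists>a\<in>?X. \<exists>b\<in>?Y. y + y' = shift T \<nu> a + b"
        using * complex_vs.span_add complex_vs.subspace_add[OF subY] by blast
    next
      fix c y assume "y \<in> {y. \<exists>a\<in>?X. \<exists>b\<in>?Y. y = shift T \<nu> a + b}"
      then obtain a b where *: "a \<in> ?X" "b \<in> ?Y" "y = shift T \<nu> a + b" by blast
      then have "c *\<^sub>C y = shift T \<nu> (c *\<^sub>C a) + c *\<^sub>C b" by (simp add: S(3) scaleC_add_right)
      then show "\<exists>a\<in>?X. \<exists>b\<in>?Y. c *\<^sub>C y = shift T \<nu> a + b"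
        using * complex_vs.span_scale complex_vs.subspace_scale[OF subY] by blast
    qed
  next
    case (step y)
    then obtain \<kappa> where \<kappa>: "y \<in> gen_eigenspace T \<kappa>" by blast
    show ?case
    proof (cases "\<kappa> = \<nu>")
      case True
      then show ?thesis using \<kappa> complex_vs.span_zero S(9) by (metis add_0)
    next
      case False
      then obtain g where "g \<in> gen_eigenspace T \<kappa>" "shift T \<nu> g = y"
        using gen_eigenspace_shift_surj[OF lin _ \<kappa>] by blast
      moreover have "g \<in> ?X" using calculation(1) by (intro complex_vs.span_base) blast
      ultimately show ?thesis using complex_vs.subspace_0[OF subY] by (metis add.right_neutral)
    qed
  qed
  then obtain a b where ab: "a \<in> ?X" "b \<in> ?Y" "shift T \<nu> x = shift T \<nu> a + b"
    using assms(2) by blast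
  then have "shift T \<nu> (x - a) = b" by (simp add: S(4))
  moreover obtain n where "(shift T \<nu> ^^ n) b = 0" using ab(2) by (auto simp: gen_eigenspace_def)
  ultimately have "(shift T \<nu> ^^ Suc n) (x - a) = 0" by (simp add: funpow_swap1)
  then have "x - a \<in> ?Y" unfolding gen_eigenspace_def by blast
  then have "x - a \<in> ?X" by (intro complex_vs.span_base) blast
  then have "(x - a) + a \<in> ?X" using ab(1) by (rule complex_vs.span_add)
  then show ?thesis by simp
qed

lemma dom_pow_UNIV [simp]: "dom_pow UNIV T n = UNIV"
  by (induction n) auto

lemma root_poly_op_in_gen_eigenspan:
  assumes lin: "linear_op UNIV T"
  shows "poly_op T (root_poly zs) x \<in> gen_eigenspan T \<Longrightarrow> x \<in> gen_eigenspan T"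
proof (induction zs)
  case (Cons z zs)
  have "poly_op T (root_poly (z # zs)) x = shift T z (poly_op T (root_poly zs) x)"
    using poly_op_linear_factor[OF lin, of x "length zs" "root_poly zs" z]
    by (simp add: shift_def del: mult_pCons_left)
  then have "shift T z (poly_op T (root_poly zs) x) \<in> gen_eigenspan T" using Cons.prems by metis
  then show ?case using Cons.IH shift_in_gen_eigenspan[OF lin] by blast
qed simp

lemma poly_op_zero_in_gen_eigenspan:
  assumes lin: "linear_op UNIV T" and p: "p \<noteq> 0" "poly_op T p x = 0"
  shows "x \<in> gen_eigenspan T"
proof -
  obtain zs where zs: "mset zs = proots p" using ex_mset by blast
  have "p = smult (lead_coeff p) (\<Prod>z\<in>#proots p. [:- z, 1:])"
    by (rule complex_poly_decompose_multiset[symmetric])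
  also have "(\<Prod>z\<in>#proots p. [:- z, 1:]) = root_poly zs"
    by (subst prod_mset_prod_list[symmetric]) (simp add: zs)
  finally have "lead_coeff p *\<^sub>C poly_op T (root_poly zs) x = 0"
    using p(2) poly_op_smult by metis
  then have "poly_op T (root_poly zs) x = 0" using p(1) by simp
  then show ?thesis
    using root_poly_op_in_gen_eigenspan[OF lin, of zs x] complex_vs.span_zero by metis
qed

lemma poly_op_monom: "poly_op T (monom c i) x = c *\<^sub>C (T ^^ i) x"
proof -
  have "poly_op T (monom c i) x = (\<Sum>j\<le>i. coeff (monom c i) j *\<^sub>C (T ^^ j) x)"
    by (rule poly_op_eq_sum) (rule degree_monom_le)
  also have "\<dots> = (\<Sum>j\<le>i. if j = i then c *\<^sub>C (T ^^ j) x else 0)"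
    by (intro sum.cong) auto
  finally show ?thesis by simp
qed

text \<open>The vectors \<open>F x\<close>, \<open>F (F x)\<close>, and so on lie in a finite-dimensional space, so they are linearly
  dependent.\<close>

lemma finite_range_annihilating_poly:
  assumes L: "finite_dim L" and range: "\<And>y. F y \<in> L"
  shows "\<exists>p. p \<noteq> 0 \<and> poly_op F p x = 0"
proof -
  obtain B where B: "finite B" "L \<subseteq> cspan B" using L by (auto simp: finite_dim_def)
  define I where "I = {1..Suc (card B)}"
  define f where "f = (\<lambda>i. (F ^^ i) x)"
  have fL: "f ` I \<subseteq> cspan B"
  proof
    fix y assume "y \<in> f ` I"
    then obtain i where i: "i \<ge> 1" "y = (F ^^ i) x" by (auto simp: I_def f_def)
    then obtain j where "i = Suc j" by (cases i) auto
    then have "y = F ((F ^^ j) x)" using i(2) by simp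
    then show "y \<in> cspan B" using range B(2) by auto
  qed
  show ?thesis
  proof (cases "inj_on f I")
    case False
    then obtain i j where ij: "i \<noteq> j" "f i = f j" by (auto simp: inj_on_def)
    have "coeff (monom 1 i - monom 1 j :: complex poly) i = 1" using ij(1) by simp
    then have "monom 1 i - monom 1 j \<noteq> (0 :: complex poly)" by (metis coeff_0 zero_neq_one)
    moreover have "poly_op F (monom 1 i - monom 1 j) x = 0"
      using ij(2) by (simp add: poly_op_diff poly_op_monom f_def)
    ultimately show ?thesis by blast
  next
    case True
    have "complex_vs.dependent (f ` I)"
    proof (rule ccontr)
      assume "\<not> complex_vs.dependent (f ` I)"
      then have "card (f ` I) \<le> card B"
        using complex_vs.independent_span_bound[OF B(1) _ fL] by blast
      moreover have "card (f ` I) = Suc (card B)" using True by (simp add: card_image I_def)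
      ultimately show False by simp
    qed
    then obtain u v where u: "v \<in> f ` I" "u v \<noteq> 0" "(\<Sum>v\<in>f ` I. u v *\<^sub>C v) = 0"
      using complex_vs.dependent_finite[of "f ` I"] by (auto simp: I_def)
    obtain i where i: "i \<in> I" "v = f i" using u(1) by blast
    define p where "p = (\<Sum>j\<in>I. monom (u (f j)) j)"
    have "coeff p i = (\<Sum>j\<in>I. if j = i then u (f j) else 0)"
      unfolding p_def coeff_sum by (intro sum.cong) auto
    also have "\<dots> = u v" using i by (simp add: I_def)
    finally have "p \<noteq> 0" using u(2) by auto
    moreover have "poly_op F p x = (\<Sum>j\<in>I. u (f j) *\<^sub>C f j)"
      unfolding p_def poly_op_sum by (simp add: poly_op_monom f_def)
    then have "poly_op F p x = 0" using u(3) sum.reindex[OF True, of "\<lambda>v. u v *\<^sub>C v"] by simp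
    ultimately show ?thesis by blast
  qed
qed

text \<open>An annihilating polynomial of a vector for \<open>T - c\<close> splits into linear factors, and these can be
  cancelled one at a time without leaving the span.\<close>

theorem gen_eigenspan_finite_rank:
  assumes lin: "linear_op UNIV T" and L: "finite_dim L" and range: "\<And>y. T y - c *\<^sub>C y \<in> L"
  shows "gen_eigenspan T = UNIV"
proof -
  have "shift (shift T c) \<kappa> = shift T (c + \<kappa>)" for \<kappa>
    by (rule ext) (simp add: shift_def scaleC_add_left)
  then have "gen_eigenspace (shift T c) \<kappa> = gen_eigenspace T (c + \<kappa>)" for \<kappa>
    by (simp add: gen_eigenspace_def)
  then have "gen_eigenspan (shift T c) \<subseteq> gen_eigenspan T"
    by (intro complex_vs.span_mono) auto
  moreover have "x \<in> gen_eigenspan (shift T c)" for x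
    using finite_range_annihilating_poly[OF L, of "shift T c" x] range
      poly_op_zero_in_gen_eigenspan[OF linear_op_shift[OF lin]] by (auto simp: shift_def)
  ultimately show ?thesis by blast
qed

text \<open>The Neumann series of \<open>((\<zeta> - \<kappa>) - (T - \<kappa>))\<inverse>\<close> is finite on a generalised eigenvector.\<close>

lemma resolvent_gen_eigenvector:
  assumes "\<zeta> \<in> resolvent_set UNIV T" "linear_op UNIV T" "\<zeta> \<noteq> \<kappa>" "(shift T \<kappa> ^^ n) x = 0"
  shows "resolvent UNIV T \<zeta> x = (\<Sum>j<n. inverse (\<zeta> - \<kappa>) ^ Suc j *\<^sub>C (shift T \<kappa> ^^ j) x)"
proof (rule resolvent_eqI[OF assms(1) UNIV_I])
  let ?i = "inverse (\<zeta> - \<kappa>)" and ?S = "shift T \<kappa>"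
  let ?y = "\<Sum>j<n. ?i ^ Suc j *\<^sub>C (?S ^^ j) x"
  have "\<zeta> *\<^sub>C ?y - T ?y = (\<zeta> - \<kappa>) *\<^sub>C ?y - ?S ?y"
    by (simp add: shift_def complex_vs.scale_left_diff_distrib)
  also have "?S ?y = (\<Sum>j<n. ?i ^ Suc j *\<^sub>C ?S ((?S ^^ j) x))"
    using linear_op_sum[OF linear_op_shift[OF assms(2), of \<kappa>], of "{..<n}"] by simp
  also have "(\<zeta> - \<kappa>) *\<^sub>C ?y = (\<Sum>j<n. ?i ^ j *\<^sub>C (?S ^^ j) x)"
    using assms(3) by (simp add: complex_vs.scale_sum_right scaleC_scaleC mult.assoc[symmetric])
  also have "\<dots> - (\<Sum>j<n. ?i ^ Suc j *\<^sub>C ?S ((?S ^^ j) x)) = x"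
    using sum_lessThan_telescope'[of "\<lambda>j. ?i ^ j *\<^sub>C (?S ^^ j) x" n] assms(4)
    by (simp add: sum_subtractf[symmetric])
  finally show "\<zeta> *\<^sub>C ?y - T ?y = x" .
qed

text \<open>Of the powers of \<open>1 / (\<zeta> - \<kappa>)\<close> in the expansion of the resolvent only the first has a nonzero
  integral.\<close>

lemma riesz_projection_gen_eigenvector:
  assumes \<theta>: "path \<theta>" "pathfinish \<theta> = pathstart \<theta>" "rectifiable \<theta>"
    and T: "bounded_clinear T" "path_image \<theta> \<subseteq> resolvent_set UNIV T"
    and \<kappa>: "\<kappa> \<notin> path_image \<theta>" "x \<in> gen_eigenspace T \<kappa>"
  shows "riesz_projection \<theta> T x = winding_number \<theta> \<kappa> *\<^sub>C x"
proof (rule riesz_projection_eqI)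
  note lin = bounded_clinear_imp_linear_op[OF T(1)]
  obtain n where "(shift T \<kappa> ^^ n) x = 0" using \<kappa>(2) by (auto simp: gen_eigenspace_def)
  then have n: "(shift T \<kappa> ^^ Suc n) x = 0"
    using linear_opD(9)[OF linear_op_shift[OF lin]] by simp
  define I where "I = (\<lambda>j::nat. if j = 0 then two_pi_i * winding_number \<theta> \<kappa> else 0)"
  have "has_curve_integral (\<lambda>\<zeta>. inverse (\<zeta> - \<kappa>) ^ Suc j) (I j) \<theta>" for j
  proof (cases j)
    case 0
    then show ?thesis using has_curve_integral_winding_number[OF \<theta> \<kappa>(1)] by (simp add: I_def)
  next
    case (Suc i)
    then show ?thesis using has_curve_integral_power_zero[OF \<theta> \<kappa>(1), of i] by (simp add: I_def)
  qed
  then have "has_curve_integral (\<lambda>\<zeta>. inverse (\<zeta> - \<kappa>) ^ Suc j *\<^sub>C (shift T \<kappa> ^^ j) x) (I j *\<^sub>C (shift T \<kappa> ^^ j) x) \<theta>" for j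
    by (rule has_curve_integral_linear[OF _ bounded_clinear_scaleC_left])
  then have "has_curve_integral (\<lambda>\<zeta>. \<Sum>j<Suc n. inverse (\<zeta> - \<kappa>) ^ Suc j *\<^sub>C (shift T \<kappa> ^^ j) x)
      (\<Sum>j<Suc n. I j *\<^sub>C (shift T \<kappa> ^^ j) x) \<theta>"
    by (intro has_curve_integral_sum) auto
  moreover have "(\<Sum>j<Suc n. I j *\<^sub>C (shift T \<kappa> ^^ j) x) = two_pi_i *\<^sub>C winding_number \<theta> \<kappa> *\<^sub>C x"
    by (subst sum.lessThan_Suc_shift) (simp add: I_def)
  ultimately have "has_curve_integral (\<lambda>\<zeta>. \<Sum>j<Suc n. inverse (\<zeta> - \<kappa>) ^ Suc j *\<^sub>C (shift T \<kappa> ^^ j) x)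
      (two_pi_i *\<^sub>C winding_number \<theta> \<kappa> *\<^sub>C x) \<theta>" by simp
  then show "has_curve_integral (\<lambda>\<zeta>. resolvent UNIV T \<zeta> x) (two_pi_i *\<^sub>C winding_number \<theta> \<kappa> *\<^sub>C x) \<theta>"
  proof (rule has_curve_integral_cong)
    fix \<zeta> assume "\<zeta> \<in> path_image \<theta>"
    then have "\<zeta> \<in> resolvent_set UNIV T" "\<zeta> \<noteq> \<kappa>" using T(2) \<kappa>(1) by auto
    then show "(\<Sum>j<Suc n. inverse (\<zeta> - \<kappa>) ^ Suc j *\<^sub>C (shift T \<kappa> ^^ j) x) = resolvent UNIV T \<zeta> x"
      by (rule resolvent_gen_eigenvector[OF _ lin _ n, symmetric])
  qed
qed

text \<open>On each generalised eigenspace the Riesz projection is multiplication by \<open>s\<close> or 0.  The number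
  \<open>s\<close>, which is 1 or -1 for a simple closed curve, is the orientation.\<close>

theorem riesz_projection_square:
  assumes \<theta>: "path \<theta>" "pathfinish \<theta> = pathstart \<theta>" "rectifiable \<theta>"
    and s: "\<And>\<kappa>. \<kappa> \<notin> path_image \<theta> \<Longrightarrow> winding_number \<theta> \<kappa> = s \<or> winding_number \<theta> \<kappa> = 0"
    and T: "bounded_clinear T" "path_image \<theta> \<subseteq> resolvent_set UNIV T"
    and span: "gen_eigenspan T = UNIV"
  shows "riesz_projection \<theta> T (riesz_projection \<theta> T x) = s *\<^sub>C riesz_projection \<theta> T x"
proof -
  note lin = bounded_clinear_imp_linear_op[OF T(1)]
  note P = riesz_projection_clinear[OF \<theta>(1,3) T]
  let ?P = "riesz_projection \<theta> T"
  have "x \<in> gen_eigenspan T" using span by simp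
  then show ?thesis
  proof (induction rule: complex_vs.span_induct)
    case base
    have "?P 0 = 0" using P(2)[of 0 0] by simp
    then show ?case
      unfolding csubspace_iff by (simp add: P scaleC_add_right mult.commute)
  next
    case (step x)
    then obtain \<kappa> where x: "x \<in> gen_eigenspace T \<kappa>" by blast
    show ?case
    proof (cases "\<kappa> \<in> path_image \<theta>")
      case True
      then have \<kappa>: "\<kappa> \<in> resolvent_set UNIV T" using T(2) by blast
      have "y = 0" if "(shift T \<kappa> ^^ n) y = 0" for n y
        using that
      proof (induction n arbitrary: y)
        case (Suc n)
        then have "shift T \<kappa> y = 0" by (simp add: funpow_swap1)
        then have "\<kappa> *\<^sub>C y - T y = 0" by (simp add: shift_def)
        then have "y = resolvent UNIV T \<kappa> 0" using resolventD(3)[OF \<kappa> UNIV_I, of y] by simp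
        then show ?case using resolventD(4)[OF \<kappa>] by (simp add: linear_simps)
      qed simp
      then have "x = 0" using x by (auto simp: gen_eigenspace_def)
      moreover have "?P 0 = 0" using P(2)[of 0 0] by simp
      ultimately show ?thesis by simp
    next
      case False
      then show ?thesis
        using riesz_projection_gen_eigenvector[OF \<theta> T False x] s[OF False] P(2) by auto
    qed
  qed
qed

section \<open>The values of the filter\<close>

lemma filter_fun_tendsto_at_top:
  "((\<lambda>x. filter_fun w z N (complex_of_real x)) \<longlongrightarrow> w N) at_top"
proof -
  have "((\<lambda>x. inverse (z k - complex_of_real x)) \<longlongrightarrow> 0) at_top" for k
  proof (rule filterlim_compose[OF tendsto_inverse_0])
    show "filterlim (\<lambda>x. z k - complex_of_real x) at_infinity at_top"
    proof -
      have "filterlim (\<lambda>x. - complex_of_real x) at_infinity at_top"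
        using filterlim_of_real_at_infinity[where ?'a = complex]
        by (simp add: filterlim_at_infinity_conv_norm_at_top)
      then have "filterlim (\<lambda>x. z k + (- complex_of_real x)) at_infinity at_top"
        by (rule tendsto_add_filterlim_at_infinity[OF tendsto_const])
      then show ?thesis by simp
    qed
  qed
  then have "((\<lambda>x. filter_fun w z N (complex_of_real x)) \<longlongrightarrow> w N + (\<Sum>k<N. w k * 0)) at_top"
    unfolding filter_fun_def by (intro tendsto_intros)
  then show ?thesis by simp
qed

text \<open>Supremum and infimum are real numbers \<open>b\<close> and \<open>a\<close> because both regions contain points that
  are not poles and the quotient is less than 1.  The outer region reaches to infinity, where the filter tends to \<open>w N\<close>.  With \<open>N = 0\<close>
  the filter is constant, and its values cannot be separated.\<close>

lemma filter_separation:
  assumes \<kappa>: "kappa_hat_less_1 w z N y \<delta> \<gamma>" and "\<gamma> > 0"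
  obtains a b where "b < a"
    "\<And>x. \<bar>x - y\<bar> \<le> \<gamma> \<Longrightarrow> (\<And>k. k < N \<Longrightarrow> complex_of_real x \<noteq> z k) \<Longrightarrow> a \<le> cmod (filter_fun w z N (complex_of_real x))"
    "\<And>x. (1 + \<delta>) * \<gamma> \<le> \<bar>x - y\<bar> \<Longrightarrow> (\<And>k. k < N \<Longrightarrow> complex_of_real x \<noteq> z k) \<Longrightarrow> cmod (filter_fun w z N (complex_of_real x)) \<le> b"
    "cmod (w N) \<le> b" "N > 0"
proof -
  let ?r = "\<lambda>x. cmod (filter_fun w z N (complex_of_real x))"
  define bad where "bad = {x. \<exists>k<N. complex_of_real x = z k}"
  define X where "X = {x \<in> inner_interval y \<gamma>. \<forall>k<N. complex_of_real x \<noteq> z k}"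
  define Y where "Y = {x \<in> outer_region y \<delta> \<gamma>. \<forall>k<N. complex_of_real x \<noteq> z k}"
  define I where "I = filter_inf w z N (inner_interval y \<gamma>)"
  define J where "J = filter_sup w z N (outer_region y \<delta> \<gamma>)"
  have I: "I = (INF x\<in>X. ereal (?r x))" by (simp add: I_def X_def filter_inf_def)
  have J: "J = (SUP x\<in>Y. ereal (?r x))" by (simp add: J_def Y_def filter_sup_def)
  have IJ: "I \<noteq> 0" "J / I < 1" using \<kappa> by (auto simp: kappa_hat_less_1_def I_def J_def)
  have "bad \<subseteq> Re ` (z ` {..<N})" 
  proof
    fix x assume "x \<in> bad"
    then obtain k where "k < N" "complex_of_real x = z k" by (auto simp: bad_def)
    moreover from this have "x = Re (z k)" by (metis Re_complex_of_real)
    ultimately show "x \<in> Re ` (z ` {..<N})" by blast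
  qed
  then have "finite bad" by (rule finite_subset) auto
  moreover have "infinite {y - \<gamma>..y + \<gamma>}" using \<open>\<gamma> > 0\<close> by (simp add: infinite_Icc)
  ultimately have "\<exists>x\<in>{y - \<gamma>..y + \<gamma>}. x \<notin> bad" by (meson finite_subset subsetI)
  then obtain x0 where "x0 \<in> {y - \<gamma>..y + \<gamma>}" "x0 \<notin> bad" by blast
  then have x0: "x0 \<in> X" by (auto simp: X_def bad_def inner_interval_def abs_le_iff)
  have ev: "eventually (\<lambda>x. x \<in> Y) at_top"
  proof -
    \<comment> \<open>Every point beyond \<open>m\<close> lies in the outer region and is not a pole.\<close>
    define m where "m = Max (insert (y + \<bar>(1 + \<delta>) * \<gamma>\<bar>) bad)"
    have m: "y + \<bar>(1 + \<delta>) * \<gamma>\<bar> \<le> m" "\<And>x. x \<in> bad \<Longrightarrow> x \<le> m"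
      using \<open>finite bad\<close> by (auto simp: m_def)
    have "x \<in> Y" if "x > m" for x
      using m(1) m(2)[of x] that by (auto simp: Y_def bad_def outer_region_def)
    then show ?thesis using eventually_gt_at_top[of m] by (rule eventually_mono[rotated]) auto
  qed
  obtain y0 where y0: "y0 \<in> Y" using eventually_happens[OF ev] by auto
  have "I \<ge> 0" unfolding I by (rule INF_greatest) auto
  moreover have "I \<le> ereal (?r x0)" unfolding I by (rule INF_lower[OF x0])
  ultimately obtain a where a: "I = ereal a" "a > 0" using IJ(1) by (cases I) auto
  have "J \<ge> ereal (?r y0)" unfolding J by (rule SUP_upper[OF y0])
  moreover have "J \<noteq> \<infinity>" using IJ(2) a by auto
  ultimately obtain b where b: "J = ereal b" by (cases J) auto
  have "b < a" using IJ(2) a by (simp add: b field_simps)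
  have 1: "a \<le> ?r x" if "\<bar>x - y\<bar> \<le> \<gamma>" "\<And>k. k < N \<Longrightarrow> complex_of_real x \<noteq> z k" for x
  proof -
    have "x \<in> X" using that by (auto simp: X_def inner_interval_def)
    then have "I \<le> ereal (?r x)" unfolding I by (rule INF_lower)
    then show ?thesis by (simp add: a)
  qed
  have Y: "?r x \<le> b" if "x \<in> Y" for x
  proof -
    have "ereal (?r x) \<le> J" unfolding J using that by (rule SUP_upper)
    then show ?thesis by (simp add: b)
  qed
  have 2: "?r x \<le> b" if "(1 + \<delta>) * \<gamma> \<le> \<bar>x - y\<bar>" "\<And>k. k < N \<Longrightarrow> complex_of_real x \<noteq> z k" for x
    using that by (intro Y) (auto simp: Y_def outer_region_def)
  have 3: "cmod (w N) \<le> b"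
  proof (rule tendsto_upperbound)
    show "(?r \<longlongrightarrow> cmod (w N)) at_top" by (intro tendsto_norm filter_fun_tendsto_at_top)
    show "eventually (\<lambda>x. ?r x \<le> b) at_top" using ev Y by (rule eventually_mono)
  qed simp
  have "N > 0"
  proof (rule ccontr)
    assume "\<not> N > 0"
    then have "?r x0 = cmod (w N)" by (simp add: filter_fun_def)
    moreover have "a \<le> ?r x0" using x0 by (intro 1) (auto simp: X_def inner_interval_def)
    ultimately show False using 3 \<open>b < a\<close> by simp
  qed
  with \<open>b < a\<close> 1 2 3 that show ?thesis by blast
qed

section \<open>Gaps between the ranges of projections\<close>

lemma norm_on_upper:
  assumes "bounded_linear B" "e \<in> M"
  shows "norm (B e) \<le> norm_on M B * norm e"
proof (cases "e = 0")
  case False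
  have bdd: "bdd_above ((\<lambda>e. norm (B e) / norm e) ` (M - {0}))"
    using le_onorm[OF assms(1)] by (intro bdd_aboveI[of _ "onorm B"]) auto
  have "norm (B e) / norm e \<le> norm_on M B"
    unfolding norm_on_def using False assms(2) by (intro cSUP_upper bdd) auto
  then show ?thesis using False by (simp add: field_simps)
qed (simp add: linear_simps[OF assms(1)])

lemma norm_on_nonneg:
  assumes "bounded_linear B" "e \<in> M" "e \<noteq> 0"
  shows "0 \<le> norm_on M B"
  using norm_on_upper[OF assms(1,2)] assms(3)
  by (metis norm_ge_zero order_trans zero_le_mult_iff norm_le_zero_iff)

lemma directed_gap_le:
  assumes "0 \<le> c" "\<And>x. x \<in> M \<Longrightarrow> norm x = 1 \<Longrightarrow> \<exists>u\<in>L. norm (x - u) \<le> c"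
  shows "directed_gap M L \<le> c"
  unfolding directed_gap_def
proof (rule cSup_least)
  fix d assume "d \<in> insert 0 ((\<lambda>x. infdist x L) ` {x \<in> M. norm x = 1})"
  then show "d \<le> c"
    using assms infdist_le[of _ L] unfolding dist_norm by (fastforce intro: order_trans)
qed simp

lemma directed_gap_nonneg:
  assumes "0 \<in> L"
  shows "0 \<le> directed_gap M L"
  unfolding directed_gap_def
proof (rule cSup_upper)
  have "infdist x L \<le> 1" if "norm x = 1" for x
    using infdist_le[OF assms, of x] that by (simp add: dist_norm)
  then show "bdd_above (insert 0 ((\<lambda>x. infdist x L) ` {x \<in> M. norm x = 1}))"
    by (intro bdd_aboveI[of _ 1]) auto
qed simp

text \<open>Distances from the range of \<open>Q'\<close> to that of \<open>Q\<close> are also controlled by \<open>Q - Q'\<close> on the range of \<open>Q\<close>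
  alone.  For \<open>x\<close> in the range of \<open>Q'\<close>, the equation \<open>x = Q' (Q u)\<close> has a solution in the range of \<open>Q'\<close>,
  since there \<open>Q' Q\<close> differs from the identity by the small operator \<open>Q' (Q - Q')\<close>; then \<open>Q u\<close> is a point
  of the range of \<open>Q\<close> with distance \<open>\<parallel>(Q - Q') (Q u)\<parallel>\<close> from \<open>x\<close>.\<close>

lemma gap_range_le:
  fixes Q Q' :: "'v::complex_hilbert_space \<Rightarrow> 'v"
  assumes Q: "\<And>x. Q x \<in> E" "\<And>e. e \<in> E \<Longrightarrow> Q e = e" "\<And>x y. Q (x - y) = Q x - Q y"
    and Q': "\<And>x. Q' (Q' x) = Q' x" "\<And>x y. Q' (x - y) = Q' x - Q' y"
    and bounds: "\<And>x. norm (Q x) \<le> c * norm x" "\<And>x. norm (Q' x) \<le> B * norm x"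
    and small: "\<And>x. norm (Q x - Q' x) \<le> \<eta> * norm x" "0 \<le> B" "B * \<eta> \<le> 1 / 2"
    and \<epsilon>: "\<And>e. e \<in> E \<Longrightarrow> norm (Q e - Q' e) \<le> \<epsilon> * norm e" "0 \<le> \<epsilon>" "0 \<le> c"
  shows "gap E (range Q') \<le> \<epsilon> * (1 + 2 * c)"
proof -
  have "directed_gap E (range Q') \<le> \<epsilon>"
  proof (rule directed_gap_le[OF \<epsilon>(2)])
    fix x assume "x \<in> E" "norm x = 1"
    then have "norm (x - Q' x) \<le> \<epsilon>" using \<epsilon>(1)[of x] Q(2) by simp
    then show "\<exists>u\<in>range Q'. norm (x - u) \<le> \<epsilon>" by blast
  qed
  also have "\<epsilon> \<le> \<epsilon> * (1 + 2 * c)" using \<epsilon>(2,3) by (simp add: algebra_simps)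
  finally have 1: "directed_gap E (range Q') \<le> \<epsilon> * (1 + 2 * c)" .
  have "directed_gap (range Q') E \<le> \<epsilon> * (1 + 2 * c)"
  proof (rule directed_gap_le)
    show "0 \<le> \<epsilon> * (1 + 2 * c)" using \<epsilon>(2,3) by simp
    fix x assume x: "x \<in> range Q'" "norm x = 1"
    then have Q'x: "Q' x = x" using Q'(1) by auto
    have half: "norm (Q' (Q' u - Q u)) \<le> 1 / 2 * norm u" for u
    proof -
      have "norm (Q' (Q' u - Q u)) \<le> B * norm (Q' u - Q u)" by (rule bounds(2))
      also have "\<dots> \<le> B * (\<eta> * norm u)"
        using small(1)[of u] small(2) by (intro mult_left_mono) (auto simp: norm_minus_commute)
      also have "\<dots> \<le> 1 / 2 * norm u"
        using mult_right_mono[OF small(3), of "norm u"] by (simp add: mult.assoc)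
      finally show ?thesis .
    qed
    have "\<exists>!u. x + Q' (Q' u - Q u) = u"
    proof (rule banach_fix_type[where c = "1 / 2"])
      show "\<forall>u v. dist (x + Q' (Q' u - Q u)) (x + Q' (Q' v - Q v)) \<le> 1 / 2 * dist u v"
      proof (intro allI)
        fix u v
        have "(x + Q' (Q' u - Q u)) - (x + Q' (Q' v - Q v)) = Q' (Q' (u - v) - Q (u - v))"
          by (simp add: Q'(2) Q(3))
        then show "dist (x + Q' (Q' u - Q u)) (x + Q' (Q' v - Q v)) \<le> 1 / 2 * dist u v"
          using half[of "u - v"] by (simp add: dist_norm)
      qed
    qed auto
    then obtain u where u: "x + Q' (Q' u - Q u) = u" by blast
    have split: "u - Q' (Q' u - Q u) = x"
      by (subst (1) u[symmetric]) simp
    \<comment> \<open>The fixed point lies in the range of \<open>Q'\<close> because \<open>x\<close> does.\<close>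
    have Q'u: "Q' u = u"
    proof -
      have "Q' (x + Q' (Q' u - Q u)) = Q' x + Q' (Q' u - Q u)"
        using Q'(2)[of "x + Q' (Q' u - Q u)" "Q' (Q' u - Q u)"] by (simp add: Q'(1) algebra_simps)
      then show ?thesis using u Q'x by simp
    qed
    have "Q' (Q u) = Q' u - Q' (Q' u - Q u)" by (simp add: Q'(1,2))
    then have Q'Q: "Q' (Q u) = x" using split by (simp add: Q'u)
    have "norm u \<le> norm x + norm (Q' (Q' u - Q u))"
      using norm_triangle_ineq[of x "Q' (Q' u - Q u)"] by (simp add: u)
    then have "norm u \<le> 2" using half[of u] x(2) by simp
    have "norm (x - Q u) = norm (Q (Q u) - Q' (Q u))"
      using Q(1,2) by (simp add: Q'Q norm_minus_commute)
    also have "\<dots> \<le> \<epsilon> * norm (Q u)" by (rule \<epsilon>(1)[OF Q(1)])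
    also have "\<dots> \<le> \<epsilon> * (c * norm u)" using \<epsilon>(2) bounds(1) by (intro mult_left_mono) auto
    also have "\<dots> \<le> \<epsilon> * (c * 2)" using \<epsilon>(2,3) \<open>norm u \<le> 2\<close> by (intro mult_left_mono) auto
    also have "\<dots> \<le> \<epsilon> * (1 + 2 * c)" using \<epsilon>(2) by (intro mult_left_mono) auto
    finally show "\<exists>v\<in>E. norm (x - v) \<le> \<epsilon> * (1 + 2 * c)" using Q(1) by blast
  qed
  with 1 show ?thesis by (simp add: gap_def)
qed

section \<open>The Riesz projection on the complement of the cluster\<close>

text \<open>For \<open>x\<close> with \<open>\<iota> x\<close> in \<open>W\<close>, the function \<open>\<langle>\<iota> (\<zeta> - S)\<inverse> x, u\<rangle>\<close> is bounded near the points of \<open>M\<close>, because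
  \<open>T - \<mu>\<close> is bounded below on \<open>W\<close>.  So its singularities inside the curve are removable, and Cauchy's
  theorem applies.\<close>

theorem riesz_projection_eq_0:
  fixes S :: "'v::complex_hilbert_space \<Rightarrow> 'v" and \<iota> :: "'v \<Rightarrow> 'h::complex_hilbert_space"
  assumes \<theta>: "path \<theta>" "pathfinish \<theta> = pathstart \<theta>" "rectifiable \<theta>"
    and S: "bounded_clinear S" "path_image \<theta> \<subseteq> resolvent_set UNIV S"
    and M: "finite M" "M \<subseteq> inside (path_image \<theta>)" "inside (path_image \<theta>) \<inter> spectrum UNIV S \<subseteq> M"
    and \<iota>: "bounded_clinear \<iota>" "inj \<iota>" "\<And>v. \<iota> (S v) = T (\<iota> v)"
    and W: "\<And>\<zeta> v. \<zeta> \<in> resolvent_set UNIV S \<Longrightarrow> \<iota> v \<in> W \<Longrightarrow> \<iota> (resolvent UNIV S \<zeta> v) \<in> W"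
    and below: "\<And>\<mu>. \<mu> \<in> M \<Longrightarrow> \<exists>c>0. \<forall>y\<in>W. c * norm y \<le> norm (T y - \<mu> *\<^sub>C y)"
    and x: "\<iota> x \<in> W"
  shows "riesz_projection \<theta> S x = 0"
proof -
  define P where "P = riesz_projection \<theta> S x"
  define U where "U = resolvent_set UNIV S \<union> inside (path_image \<theta>)"
  have "open U"
    unfolding U_def using \<theta>(1) S(1)
    by (intro open_Un open_resolvent_set open_inside closed_path_image) auto
  have UM: "U - M \<subseteq> resolvent_set UNIV S" using M(3) by (auto simp: U_def spectrum_def)
  have "cinner (\<iota> P) u = 0" for u
  proof -
    define f where "f = (\<lambda>\<zeta>. cinner (\<iota> (resolvent UNIV S \<zeta> x)) u)"
    have lin: "bounded_clinear (\<lambda>v. cinner (\<iota> v) u)"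
      by (rule bounded_clinear_compose[OF bounded_clinear_cinner_left \<iota>(1)])
    have holf: "f holomorphic_on U - M"
      unfolding f_def using resolvent_holomorphic[OF S(1) lin] UM by (rule holomorphic_on_subset)
    have bound: "f \<in> O[at \<mu>](\<lambda>_. 1)" if \<mu>: "\<mu> \<in> M" for \<mu>
    proof -
      obtain c where c: "c > 0" "\<And>y. y \<in> W \<Longrightarrow> c * norm y \<le> norm (T y - \<mu> *\<^sub>C y)"
        using below[OF \<mu>] by blast
      have "open (U - (M - {\<mu>}))" using \<open>open U\<close> M(1) by (intro open_Diff finite_imp_closed) auto
      moreover have "\<mu> \<in> U - (M - {\<mu>})" using M(2) \<mu> by (auto simp: U_def)
      ultimately have "eventually (\<lambda>\<zeta>. \<zeta> \<in> U - (M - {\<mu>}) - {\<mu>}) (at \<mu>)"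
        by (rule eventually_at_in_open)
      moreover have "eventually (\<lambda>\<zeta>. \<zeta> \<in> ball \<mu> (c / 2)) (at \<mu>)"
        using c(1) by (intro eventually_at_in_open') auto
      ultimately have "eventually (\<lambda>\<zeta>. cmod (f \<zeta>) \<le> (2 / c * norm (\<iota> x) * norm u) * cmod 1) (at \<mu>)"
      proof eventually_elim
        case (elim \<zeta>)
        then have \<zeta>: "\<zeta> \<in> resolvent_set UNIV S" using UM by blast
        define v where "v = resolvent UNIV S \<zeta> x"
        have "\<zeta> *\<^sub>C v - S v = x" unfolding v_def by (rule resolventD(2)[OF \<zeta>])
        then have "\<iota> x = \<zeta> *\<^sub>C \<iota> v - T (\<iota> v)" using bounded_clinearD[OF \<iota>(1)] \<iota>(3) by metis
        then have "T (\<iota> v) - \<mu> *\<^sub>C \<iota> v = (\<zeta> - \<mu>) *\<^sub>C \<iota> v - \<iota> x"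
          by (simp add: complex_vs.scale_left_diff_distrib)
        then have "c * norm (\<iota> v) \<le> norm ((\<zeta> - \<mu>) *\<^sub>C \<iota> v - \<iota> x)"
          using c(2)[OF W[OF \<zeta> x]] by (simp add: v_def)
        also have "\<dots> \<le> cmod (\<zeta> - \<mu>) * norm (\<iota> v) + norm (\<iota> x)"
          by (metis norm_scaleC norm_triangle_ineq4)
        also have "\<dots> \<le> c / 2 * norm (\<iota> v) + norm (\<iota> x)"
          using elim by (intro add_right_mono mult_right_mono) (auto simp: dist_norm norm_minus_commute)
        finally have "norm (\<iota> v) \<le> 2 / c * norm (\<iota> x)" using c(1) by (simp add: field_simps)
        then have "norm (\<iota> v) * norm u \<le> (2 / c * norm (\<iota> x)) * norm u" by (rule mult_right_mono) simp
        then show ?case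
          using cauchy_schwarz[of "\<iota> v" u] by (simp add: f_def v_def)
      qed
      then show ?thesis using c(1) by (intro bigoI)
    qed
    obtain g where g: "g holomorphic_on U" "\<And>\<zeta>. \<zeta> \<in> U - M \<Longrightarrow> g \<zeta> = f \<zeta>"
      using removable_singularities[OF M(1) _ holf bound] \<open>open U\<close> M(2) by (auto simp: U_def interior_open)
    have "has_curve_integral g 0 \<theta>"
    proof (rule Cauchy_theorem_rectifiable[OF \<theta> \<open>open U\<close> _ g(1)])
      show "path_image \<theta> \<subseteq> U" using S(2) by (auto simp: U_def)
      fix a assume "a \<notin> U"
      then have "a \<in> outside (path_image \<theta>)"
        using S(2) union_with_outside[of "path_image \<theta>"] inside_Un_outside[of "path_image \<theta>"]
        by (auto simp: U_def)
      then show "winding_number \<theta> a = 0"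
        by (rule winding_number_zero_in_outside[OF \<theta>(1,2)])
    qed
    then have "has_curve_integral f 0 \<theta>"
    proof (rule has_curve_integral_cong)
      fix \<zeta> assume \<zeta>: "\<zeta> \<in> path_image \<theta>"
      have "\<zeta> \<notin> M" using \<zeta> M(2) inside_no_overlap[of "path_image \<theta>"] by blast
      then have "\<zeta> \<in> U - M" using \<zeta> S(2) by (auto simp: U_def)
      then show "g \<zeta> = f \<zeta>" by (rule g(2))
    qed
    moreover have "has_curve_integral f (cinner (\<iota> (two_pi_i *\<^sub>C P)) u) \<theta>"
      unfolding f_def P_def
      by (rule has_curve_integral_linear[OF has_curve_integral_riesz_projection[OF \<theta>(1,3) S] lin])
    ultimately have "cinner (\<iota> (two_pi_i *\<^sub>C P)) u = 0" using has_curve_integral_unique by metis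
    then show ?thesis by (simp add: bounded_clinearD[OF \<iota>(1)] cinner_scaleC_left)
  qed
  then have "\<iota> P = 0" by (metis Re_cinner_self norm_eq_zero power2_eq_square mult_eq_0_iff zero_complex.simps(1))
  then have "\<iota> P = \<iota> 0" using bounded_clinearD(5)[OF \<iota>(1)] by simp
  then show ?thesis using \<iota>(2) by (simp add: P_def inj_eq)
qed

section \<open>Gaps between ranges of Riesz projections\<close>

text \<open>The difference of the two projections is the integral of
  \<open>(\<zeta> - S')\<inverse> (S - S') (\<zeta> - S)\<inverse>\<close>.  As \<open>E\<close> is invariant under \<open>(\<zeta> - S)\<inverse>\<close>, only the values of \<open>S - S'\<close> on \<open>E\<close>
  enter on \<open>E\<close>.  The factor \<open>s\<close> makes both Riesz projections idempotent.\<close>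

theorem gap_riesz_projection_le:
  assumes \<theta>: "path \<theta>" "pathfinish \<theta> = pathstart \<theta>" "rectifiable \<theta>" and L: "variation_le \<theta> L"
    and s: "s = 1 \<or> s = - 1"
    and winding: "\<And>\<kappa>. \<kappa> \<notin> path_image \<theta> \<Longrightarrow> winding_number \<theta> \<kappa> = s \<or> winding_number \<theta> \<kappa> = 0"
    and S: "bounded_clinear S" and \<theta>S: "path_image \<theta> \<subseteq> resolvent_set UNIV S"
    and K: "K > 0" "\<And>\<zeta> v. \<zeta> \<in> path_image \<theta> \<Longrightarrow> norm (resolvent UNIV S \<zeta> v) \<le> K * norm v"
    and S': "bounded_clinear S'" and span: "gen_eigenspan S' = UNIV"
    and P_E: "\<And>e. e \<in> E \<Longrightarrow> riesz_projection \<theta> S e = s *\<^sub>C e"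
    and P_range: "\<And>v. s *\<^sub>C riesz_projection \<theta> S v \<in> E"
    and R_E: "\<And>\<zeta> e. \<zeta> \<in> path_image \<theta> \<Longrightarrow> e \<in> E \<Longrightarrow> resolvent UNIV S \<zeta> e \<in> E"
    and close: "\<And>v. norm (S v - S' v) \<le> \<nu> * norm v" "0 \<le> \<nu>" "2 * K * \<nu> \<le> 1" "8 * L\<^sup>2 * K ^ 3 * \<nu> \<le> 1"
    and close_E: "\<And>e. e \<in> E \<Longrightarrow> norm (S e - S' e) \<le> b * norm e" "0 \<le> b"
  shows "gap E (range (riesz_projection \<theta> S')) \<le> 2 * L * K\<^sup>2 * (1 + 2 * (L * K)) * b"
proof -
  define P where "P = riesz_projection \<theta> S"
  define P' where "P' = riesz_projection \<theta> S'"
  have "L \<ge> 0" by (rule variation_le_nonneg[OF L])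
  have s2: "s * s = 1" "cmod s = 1" using s by auto
  have R: "\<zeta> \<in> resolvent_set UNIV S'" "norm (resolvent UNIV S' \<zeta> v) \<le> 2 * K * norm v"
    if \<zeta>: "\<zeta> \<in> path_image \<theta>" for \<zeta> v
  proof -
    have \<zeta>S: "\<zeta> \<in> resolvent_set UNIV S" using \<zeta> \<theta>S by blast
    have "norm ((\<zeta> *\<^sub>C x - S x) - (\<zeta> *\<^sub>C x - S' x)) \<le> 1 / (2 * K) * norm x" for x
    proof -
      have "norm ((\<zeta> *\<^sub>C x - S x) - (\<zeta> *\<^sub>C x - S' x)) = norm (S x - S' x)"
        by (simp add: norm_minus_commute)
      also have "\<dots> \<le> \<nu> * norm x" by (rule close(1))
      also have "\<dots> \<le> 1 / (2 * K) * norm x"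
        using close(3) K(1) by (intro mult_right_mono) (auto simp: field_simps)
      finally show ?thesis .
    qed
    then show "\<zeta> \<in> resolvent_set UNIV S'" "norm (resolvent UNIV S' \<zeta> v) \<le> 2 * K * norm v"
      using resolvent_perturbation[OF S S' \<zeta>S K(1) K(2)[OF \<zeta>]] by auto
  qed
  have \<theta>S': "path_image \<theta> \<subseteq> resolvent_set UNIV S'" using R(1) by blast
  note Plin = riesz_projection_clinear[OF \<theta>(1,3) S \<theta>S, folded P_def]
  note P'lin = riesz_projection_clinear[OF \<theta>(1,3) S' \<theta>S', folded P'_def]
  have P_diff: "norm (P v - P' v) \<le> (2 * L * K\<^sup>2 * c) * norm v"
    if bnd: "\<And>\<zeta>. \<zeta> \<in> path_image \<theta> \<Longrightarrow> norm (S (resolvent UNIV S \<zeta> v) - S' (resolvent UNIV S \<zeta> v)) \<le> c * norm (resolvent UNIV S \<zeta> v)"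
      and "c \<ge> 0" for v c
  proof -
    have "norm (resolvent UNIV S \<zeta> v - resolvent UNIV S' \<zeta> v) \<le> 2 * K * (c * (K * norm v))"
      if \<zeta>: "\<zeta> \<in> path_image \<theta>" for \<zeta>
    proof -
      have "norm (resolvent UNIV S \<zeta> v - resolvent UNIV S' \<zeta> v) \<le>
          2 * K * norm (S (resolvent UNIV S \<zeta> v) - S' (resolvent UNIV S \<zeta> v))"
        using resolvent_difference[OF S S', of \<zeta> v] \<zeta> \<theta>S R[OF \<zeta>] by auto
      also have "\<dots> \<le> 2 * K * (c * (K * norm v))"
        using K(1) \<open>c \<ge> 0\<close> \<zeta>
        by (intro mult_left_mono order_trans[OF bnd[OF \<zeta>]] mult_left_mono[OF K(2)]) auto
      finally show ?thesis .
    qed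
    then have "norm (P v - P' v) \<le> L * (2 * K * (c * (K * norm v)))"
      unfolding P_def P'_def
      by (intro norm_riesz_projection_diff_le[OF \<theta>(1,3) S \<theta>S S' \<theta>S' L])
    then show ?thesis by (simp add: power2_eq_square mult_ac)
  qed
  define Q where "Q = (\<lambda>v. s *\<^sub>C P v)"
  define Q' where "Q' = (\<lambda>v. s *\<^sub>C P' v)"
  have Q_diff: "norm (Q v - Q' v) = norm (P v - P' v)" for v
    unfolding Q_def Q'_def using s2 by (simp flip: complex_vs.scale_right_diff_distrib)
  have "Q' (Q' v) = Q' v" for v
  proof -
    have "Q' (Q' v) = (s * s) *\<^sub>C P' (P' v)"
      using P'lin(2) by (simp add: Q'_def scaleC_scaleC)
    also have "P' (P' v) = s *\<^sub>C P' v"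
      unfolding P'_def by (rule riesz_projection_square[OF \<theta> winding S' \<theta>S' span])
    finally show ?thesis using s2 by (simp add: Q'_def)
  qed
  moreover have "Q (u - v) = Q u - Q v" "Q' (u - v) = Q' u - Q' v" for u v
    using Plin(1)[of "u - v" v] P'lin(1)[of "u - v" v] by (simp_all add: Q_def Q'_def scaleC_add_right)
  moreover have "Q e = e" if "e \<in> E" for e
    using P_E[OF that] s2 by (simp add: Q_def P_def scaleC_scaleC)
  moreover have "norm (Q v) \<le> (L * K) * norm v" "norm (Q' v) \<le> (2 * (L * K)) * norm v" for v
    using norm_riesz_projection_le[OF \<theta>(1,3) S \<theta>S L, of v "K * norm v"] K(2)
      norm_riesz_projection_le[OF \<theta>(1,3) S' \<theta>S' L, of v "2 * K * norm v"] R(2) s2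
    by (simp_all add: Q_def P_def Q'_def P'_def mult_ac)
  moreover have "norm (Q v - Q' v) \<le> (2 * L * K\<^sup>2 * \<nu>) * norm v" for v
    unfolding Q_diff by (rule P_diff[OF close(1,2)])
  moreover have "norm (Q e - Q' e) \<le> (2 * L * K\<^sup>2 * b) * norm e" if "e \<in> E" for e
    unfolding Q_diff using R_E that by (intro P_diff close_E) auto
  moreover have "2 * (L * K) * (2 * L * K\<^sup>2 * \<nu>) \<le> 1 / 2"
    using close(4) by (simp add: power2_eq_square power3_eq_cube algebra_simps)
  ultimately have "gap E (range Q') \<le> (2 * L * K\<^sup>2 * b) * (1 + 2 * (L * K))"
    using P_range close_E(2) \<open>L \<ge> 0\<close> K(1)
    by (intro gap_range_le[where B = "2 * (L * K)" and \<eta> = "2 * L * K\<^sup>2 * \<nu>" and Q = Q])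
       (auto simp: Q_def P_def)
  moreover have "range Q' = range P'"
  proof -
    have "P' v = Q' (s *\<^sub>C v)" for v
      using P'lin(2) s2 by (simp add: Q'_def scaleC_scaleC)
    then have 1: "range P' \<subseteq> range Q'" by (metis image_subset_iff rangeI)
    have "Q' v = P' (s *\<^sub>C v)" for v
      using P'lin(2) by (simp add: Q'_def)
    then have "range Q' \<subseteq> range P'" by (metis image_subset_iff rangeI)
    then show ?thesis using 1 by (rule equalityI)
  qed
  ultimately show ?thesis by (simp add: P'_def mult_ac)
qed

section \<open>Filters of selfadjoint operators\<close>

lemma cspan_perp:
  assumes "\<And>e. e \<in> B \<Longrightarrow> cinner y e = 0" "f \<in> cspan B"
  shows "cinner y f = 0"
  using assms(2)
proof (induction rule: complex_vs.span_induct)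
  case base
  show ?case by (simp add: csubspace_iff cinner_add_right cinner_scaleC_right)
qed (use assms(1) in auto)

lemma clinear_bounded_clinear:
  assumes "clinear f" "\<And>x. norm (f x) \<le> K * norm x"
  shows "bounded_clinear f"
proof -
  have f: "f (x + y) = f x + f y" "f (c *\<^sub>C x) = c *\<^sub>C f x" for x y c
    using assms(1) by (auto simp: clinear_iff)
  then have "bounded_linear f"
    using assms(2) by (intro bounded_linear_intro[where K = K]) (auto simp: scaleR_scaleC mult.commute)
  then show ?thesis using f by (simp add: bounded_clinear_def)
qed

lemma bounded_clinear_filter_op:
  assumes "\<And>k. k < N \<Longrightarrow> bounded_clinear (R (z k))"
  shows "bounded_clinear (filter_op w z N R)"
proof -
  have "bounded_linear (\<lambda>v. w N *\<^sub>C v + (\<Sum>k<N. w k *\<^sub>C R (z k) v))"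
    using assms
    by (intro bounded_linear_add bounded_linear_sum bounded_linear_scaleC_right
        bounded_linear_compose[OF bounded_linear_scaleC_right]) (auto simp: bounded_clinear_def)
  moreover have "filter_op w z N R (c *\<^sub>C v) = c *\<^sub>C filter_op w z N R v" for c v
  proof -
    have "(\<Sum>k<N. w k *\<^sub>C R (z k) (c *\<^sub>C v)) = (\<Sum>k<N. c *\<^sub>C w k *\<^sub>C R (z k) v)"
      by (intro sum.cong refl) (simp add: bounded_clinearD(2)[OF assms] mult.commute)
    then show ?thesis
      by (simp add: filter_op_def scaleC_add_right complex_vs.scale_sum_right mult.commute)
  qed
  ultimately show ?thesis by (simp add: bounded_clinear_def filter_op_def[abs_def])
qed

lemma norm_filter_op_diff_le:
  assumes "\<And>k. k < N \<Longrightarrow> norm (R (z k) v - R' (z k) v) \<le> b k"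
  shows "norm (filter_op w z N R v - filter_op w z N R' v) \<le> (\<Sum>k<N. cmod (w k) * b k)"
proof -
  have "filter_op w z N R v - filter_op w z N R' v = (\<Sum>k<N. w k *\<^sub>C (R (z k) v - R' (z k) v))"
    by (simp add: filter_op_def complex_vs.scale_right_diff_distrib sum_subtractf)
  also have "norm \<dots> \<le> (\<Sum>k<N. cmod (w k) * b k)"
    by (rule sum_norm_le) (auto intro!: mult_left_mono assms)
  finally show ?thesis .
qed

lemma filter_op_eigenvector:
  assumes lin: "linear_op D A" and z: "\<And>k. k < N \<Longrightarrow> z k \<in> resolvent_set D A"
    and e: "e \<in> eigenspace D A \<mu>" and \<mu>: "\<And>k. k < N \<Longrightarrow> z k \<noteq> \<mu>"
  shows "filter_op w z N (resolvent D A) e = filter_fun w z N \<mu> *\<^sub>C e"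
proof -
  have "resolvent D A (z k) e = inverse (z k - \<mu>) *\<^sub>C e" if "k < N" for k
  proof (rule resolvent_eqI[OF z[OF that]])
    have e: "e \<in> D" "A e = \<mu> *\<^sub>C e" using assms(3) by (auto simp: eigenspace_def)
    show "inverse (z k - \<mu>) *\<^sub>C e \<in> D" using linear_opD(6)[OF lin e(1)] .
    have "z k *\<^sub>C inverse (z k - \<mu>) *\<^sub>C e - A (inverse (z k - \<mu>) *\<^sub>C e) = ((z k - \<mu>) * inverse (z k - \<mu>)) *\<^sub>C e"
      by (simp add: linear_opD(3)[OF lin e(1)] e(2) left_diff_distrib mult.commute
          flip: complex_vs.scale_left_diff_distrib)
    then show "z k *\<^sub>C inverse (z k - \<mu>) *\<^sub>C e - A (inverse (z k - \<mu>) *\<^sub>C e) = e"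
      using \<mu>[OF that] by simp
  qed
  then show ?thesis
    by (simp add: filter_op_def filter_fun_def scaleC_add_left complex_vs.scale_sum_left scaleC_scaleC)
qed

text \<open>The part of a selfadjoint operator in the orthogonal complement of the eigenvectors of the cluster
  has its spectrum in the outer region, where the filter stays away from its values at the cluster.\<close>

theorem filter_op_bounded_below_off_cluster:
  fixes \<Lambda> :: "complex set"
  assumes A: "linear_op D A" "closed_op D A" "symmetric_op D A"
    and \<Lambda>: "finite \<Lambda>" "\<Lambda> \<subseteq> spectrum D A"
    and pos: "\<delta> > 0" "\<gamma> > 0"
    and inner: "\<Lambda> \<subseteq> complex_of_real ` inner_interval y \<gamma>"
    and outer: "spectrum D A - \<Lambda> \<subseteq> complex_of_real ` outer_region y \<delta> \<gamma>"
    and z: "\<And>k. k < N \<Longrightarrow> z k \<in> resolvent_set D A"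
    and \<kappa>: "kappa_hat_less_1 w z N y \<delta> \<gamma>"
    and l: "l \<in> \<Lambda>"
    and W: "csubspace W" "\<And>v. v \<in> D \<Longrightarrow> v \<in> W \<Longrightarrow> A v \<in> W" "\<And>k. k < N \<Longrightarrow> resolvent D A (z k) ` W \<subseteq> W"
      "\<And>v l' e. v \<in> W \<Longrightarrow> l' \<in> \<Lambda> \<Longrightarrow> e \<in> eigenspace D A l' \<Longrightarrow> cinner v e = 0"
  shows "\<exists>c>0. \<forall>v\<in>W. c * norm v \<le> norm (filter_op w z N (resolvent D A) v - filter_fun w z N l *\<^sub>C v)"
proof -
  obtain a b where ab: "b < a"
    "\<And>x. \<bar>x - y\<bar> \<le> \<gamma> \<Longrightarrow> (\<And>k. k < N \<Longrightarrow> complex_of_real x \<noteq> z k) \<Longrightarrow> a \<le> cmod (filter_fun w z N (complex_of_real x))"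
    "\<And>x. (1 + \<delta>) * \<gamma> \<le> \<bar>x - y\<bar> \<Longrightarrow> (\<And>k. k < N \<Longrightarrow> complex_of_real x \<noteq> z k) \<Longrightarrow> cmod (filter_fun w z N (complex_of_real x)) \<le> b"
    "cmod (w N) \<le> b"
    by (rule filter_separation[OF \<kappa> pos(2)]) blast
  have nopole: "\<xi> \<noteq> z k" if "\<xi> \<in> spectrum D A" "k < N" for \<xi> k
    using z[OF that(2)] that(1) by (auto simp: spectrum_def)
  have real: "\<exists>x. \<xi> = complex_of_real x \<and> \<bar>x - y\<bar> \<le> \<gamma>" if "\<xi> \<in> \<Lambda>" for \<xi>
    using inner that by (auto simp: inner_interval_def)
  have out: "\<exists>x. \<xi> = complex_of_real x \<and> (1 + \<delta>) * \<gamma> \<le> \<bar>x - y\<bar>" if "\<xi> \<in> spectrum D A" "\<xi> \<notin> \<Lambda>" for \<xi>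
    using outer that by (auto simp: outer_region_def)
  have nonreal: "\<xi> \<in> resolvent_set D A" if "Im \<xi> \<noteq> 0" for \<xi>
    using real[of \<xi>] out[of \<xi>] that by (force simp: spectrum_def)
  define \<mu> where "\<mu> = filter_fun w z N l"
  have "a \<le> cmod \<mu>"
    using real[OF l] ab(2) nopole l \<Lambda>(2) unfolding \<mu>_def by blast
  show ?thesis
    unfolding \<mu>_def[symmetric]
  proof (rule filter_op_bounded_below[OF A(1) W(1,2) z W(3)])
    show "w N \<noteq> \<mu>" using ab(1,4) \<open>a \<le> cmod \<mu>\<close> by auto
    fix \<xi> assume \<xi>: "\<And>k. k < N \<Longrightarrow> \<xi> \<noteq> z k" "filter_fun w z N \<xi> = \<mu>"
    consider "\<xi> \<in> resolvent_set D A" | "\<xi> \<in> spectrum D A" "\<xi> \<notin> \<Lambda>" | "\<xi> \<in> \<Lambda>"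
      by (auto simp: spectrum_def)
    then show "\<exists>c>0. \<forall>v\<in>D \<inter> W. c * norm v \<le> norm (A v - \<xi> *\<^sub>C v)"
    proof cases
      case 1
      then show ?thesis using bounded_below_resolvent_set by blast
    next
      case 2
      then obtain x where "\<xi> = complex_of_real x" "(1 + \<delta>) * \<gamma> \<le> \<bar>x - y\<bar>" using out by blast
      then have "cmod \<mu> \<le> b" using ab(3)[of x] \<xi> by auto
      then show ?thesis using ab(1) \<open>a \<le> cmod \<mu>\<close> by simp
    next
      case 3
      then obtain x where x: "\<xi> = complex_of_real x" "\<bar>x - y\<bar> \<le> \<gamma>" using real by blast
      obtain d where d: "d > 0" "\<And>l'. l' \<in> \<Lambda> \<Longrightarrow> l' \<noteq> \<xi> \<Longrightarrow> d \<le> dist \<xi> l'"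
        using finite_set_avoid[OF \<Lambda>(1), of \<xi>] by blast
      define r where "r = min d (\<delta> * \<gamma>)"
      have "r > 0" using d(1) pos by (simp add: r_def)
      have gap: "complex_of_real t \<in> resolvent_set D A" if "0 < \<bar>t - x\<bar>" "\<bar>t - x\<bar> < r" for t
      proof (rule ccontr)
        assume "complex_of_real t \<notin> resolvent_set D A"
        then have t: "complex_of_real t \<in> spectrum D A" by (simp add: spectrum_def)
        show False
        proof (cases "complex_of_real t \<in> \<Lambda>")
          case True
          moreover have "complex_of_real t \<noteq> \<xi>" using that(1) x(1) by auto
          ultimately have "d \<le> dist \<xi> (complex_of_real t)" by (rule d(2))
          also have "\<dots> = \<bar>t - x\<bar>"
            unfolding x(1) dist_norm by (metis abs_minus_commute norm_of_real of_real_diff)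
          finally show ?thesis using that(2) by (simp add: r_def)
        next
          case False
          then obtain t' where "complex_of_real t = complex_of_real t'" "(1 + \<delta>) * \<gamma> \<le> \<bar>t' - y\<bar>"
            using out[OF t] by blast
          then have "(1 + \<delta>) * \<gamma> \<le> \<bar>t - y\<bar>" by simp
          then show ?thesis
            using x(2) that(2) abs_triangle_ineq[of "t - x" "x - y"] by (simp add: r_def algebra_simps)
        qed
      qed
      have "r * norm v \<le> norm (A v - \<xi> *\<^sub>C v)" if "v \<in> D \<inter> W" for v
        unfolding x(1)
      proof (rule bounded_below_isolated_point[OF A \<open>r > 0\<close> gap nonreal])
        show "cinner v e = 0" if "e \<in> eigenspace D A (complex_of_real x)" for e
          using W(4)[of v \<xi> e] \<open>v \<in> D \<inter> W\<close> 3 that x(1) by simp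
      qed (use that in auto)
      then show ?thesis using \<open>r > 0\<close> by blast
    qed
  qed
qed

section \<open>The approximation of the eigenspace\<close>

theorem theorem4p1:
  fixes D :: "'h::complex_hilbert_space set" and A :: "'h \<Rightarrow> 'h"
    and \<Lambda> :: "complex set" and E :: "'h set"
    and w z :: "nat \<Rightarrow> complex" and N :: nat and y \<delta> \<gamma> :: real
    and \<iota> :: "'v::complex_hilbert_space \<Rightarrow> 'h" and C\<^sub>V :: real
    and V\<^sub>h :: "real \<Rightarrow> 'v set" and R\<^sub>h :: "real \<Rightarrow> complex \<Rightarrow> 'h \<Rightarrow> 'v"
    and \<theta> :: "real \<Rightarrow> complex"
  defines "R\<^sub>V \<equiv> \<lambda>\<zeta>. restrict_op \<iota> (resolvent D A \<zeta>)"
    and "E\<^sub>V \<equiv> \<iota> -` E"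
    and "S \<equiv> filter_op w z N (\<lambda>\<zeta>. restrict_op \<iota> (resolvent D A \<zeta>))"
    and "E\<^sub>h \<equiv> \<lambda>h. range (riesz_projection \<theta> (filter_op w z N (\<lambda>\<zeta> v. R\<^sub>h h \<zeta> (\<iota> v))))"
    and "M \<equiv> filter_fun w z N ` \<Lambda>"
  (* the operator and the eigenvalue cluster *)
  assumes A: "linear_op D A" "closed_op D A" "selfadjoint_op D A"
    and \<Lambda>: "finite \<Lambda>" "\<Lambda> \<subseteq> spectrum D A"
      "\<And>l. l \<in> \<Lambda> \<Longrightarrow> eigenspace D A l \<noteq> {0} \<and> finite_dim (eigenspace D A l)"
    and E: "E = cspan (\<Union>l\<in>\<Lambda>. eigenspace D A l)" "finite_dim E" "E \<noteq> {0}"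
  (* Assumption 1 *)
    and "\<delta> > 0" "\<gamma> > 0"
    and "\<Lambda> \<subseteq> complex_of_real ` inner_interval y \<gamma>"
    and "spectrum D A - \<Lambda> \<subseteq> complex_of_real ` outer_region y \<delta> \<gamma>"
    and "\<And>k. k < N \<Longrightarrow> z k \<notin> closure (spectrum D A)"
    and "kappa_hat_less_1 w z N y \<delta> \<gamma>"
  (* Assumption 2 *)
    and "clinear \<iota>" "inj \<iota>" "E \<subseteq> range \<iota>"
    and "C\<^sub>V > 0" "\<And>u. norm (\<iota> u) \<le> C\<^sub>V * norm u"
    and "\<And>\<zeta>. \<zeta> \<in> resolvent_set D A \<Longrightarrow> resolvent D A \<zeta> ` range \<iota> \<subseteq> range \<iota>"
  (* discretization *)
    and "\<And>h. h > 0 \<Longrightarrow> csubspace (V\<^sub>h h) \<and> finite_dim (V\<^sub>h h)"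
    and "\<And>h \<zeta>. h > 0 \<Longrightarrow> \<zeta> \<in> resolvent_set D A \<Longrightarrow> clinear (R\<^sub>h h \<zeta>) \<and> range (R\<^sub>h h \<zeta>) \<subseteq> V\<^sub>h h"
  (* Assumption 3 *)
    and "\<And>k. k < N \<Longrightarrow> bounded_linear (R\<^sub>V (z k))"
    and "\<And>h k. h > 0 \<Longrightarrow> k < N \<Longrightarrow> bounded_linear (\<lambda>v. R\<^sub>h h (z k) (\<iota> v))"
    and "\<And>k. k < N \<Longrightarrow>
      ((\<lambda>h. onorm (\<lambda>v. R\<^sub>h h (z k) (\<iota> v) - R\<^sub>V (z k) v)) \<longlongrightarrow> 0) (at_right 0)"
  (* the contour *)
    and "simple_path \<theta>" "pathfinish \<theta> = pathstart \<theta>" "rectifiable \<theta>"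
    and "M \<subseteq> inside (path_image \<theta>)"
    and "\<And>\<zeta>. \<zeta> \<in> path_image \<theta> \<Longrightarrow> radius_outside S M < cmod \<zeta>"
    and "inside (path_image \<theta>) \<inter> spectrum UNIV S \<subseteq> M" "0 \<notin> inside (path_image \<theta>)"
  shows "(\<exists>C\<^sub>N>0. \<exists>h\<^sub>0>0. \<forall>h. 0 < h \<and> h < h\<^sub>0 \<longrightarrow>
        gap E\<^sub>V (E\<^sub>h h) \<le> C\<^sub>N * filter_weight w N *
          Max ((\<lambda>k. norm_on E\<^sub>V (\<lambda>v. R\<^sub>V (z k) v - R\<^sub>h h (z k) (\<iota> v))) ` {..<N}))
      \<and> ((\<lambda>h. gap E\<^sub>V (E\<^sub>h h)) \<longlongrightarrow> 0) (at_right 0)"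
proof -
  note \<delta> = \<open>\<delta> > 0\<close> and \<gamma> = \<open>\<gamma> > 0\<close>
  note kappa = \<open>kappa_hat_less_1 w z N y \<delta> \<gamma>\<close>
  note inner = \<open>\<Lambda> \<subseteq> complex_of_real ` inner_interval y \<gamma>\<close>
  note outer = \<open>spectrum D A - \<Lambda> \<subseteq> complex_of_real ` outer_region y \<delta> \<gamma>\<close>
  note \<iota>_inj = \<open>inj \<iota>\<close>
  have path: "path \<theta>" using \<open>simple_path \<theta>\<close> by (rule simple_path_imp_path)
  note loop = \<open>pathfinish \<theta> = pathstart \<theta>\<close> and rect = \<open>rectifiable \<theta>\<close>
  note R_invariant = \<open>\<And>\<zeta>. \<zeta> \<in> resolvent_set D A \<Longrightarrow> resolvent D A \<zeta> ` range \<iota> \<subseteq> range \<iota>\<close>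
  note V\<^sub>h = \<open>\<And>h. h > 0 \<Longrightarrow> csubspace (V\<^sub>h h) \<and> finite_dim (V\<^sub>h h)\<close>
  note R\<^sub>h_V\<^sub>h = \<open>\<And>h \<zeta>. h > 0 \<Longrightarrow> \<zeta> \<in> resolvent_set D A \<Longrightarrow> clinear (R\<^sub>h h \<zeta>) \<and> range (R\<^sub>h h \<zeta>) \<subseteq> V\<^sub>h h\<close>
  note conv = \<open>\<And>k. k < N \<Longrightarrow> ((\<lambda>h. onorm (\<lambda>v. R\<^sub>h h (z k) (\<iota> v) - R\<^sub>V (z k) v)) \<longlongrightarrow> 0) (at_right 0)\<close>
  note M_inside = \<open>M \<subseteq> inside (path_image \<theta>)\<close>
  have \<iota>: "bounded_clinear \<iota>"
    by (rule clinear_bounded_clinear) fact+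
  note \<iota>D = bounded_clinearD[OF \<iota>]
  have sym: "symmetric_op D A" using A(3) by (rule selfadjoint_imp_symmetric)
  have z: "z k \<in> resolvent_set D A" if "k < N" for k
    using \<open>\<And>k. k < N \<Longrightarrow> z k \<notin> closure (spectrum D A)\<close>[OF that] closure_subset
    unfolding spectrum_def by blast
  have "N > 0" by (rule filter_separation[OF kappa \<gamma>]) auto

  have \<iota>R: "\<iota> (R\<^sub>V (z k) v) = resolvent D A (z k) (\<iota> v)" if "k < N" for k v
  proof -
    have "resolvent D A (z k) (\<iota> v) \<in> range \<iota>"
      using R_invariant[OF z[OF that]] by blast
    then show ?thesis by (simp add: R\<^sub>V_def restrict_op_def f_inv_into_f)
  qed
  have R\<^sub>V: "bounded_clinear (R\<^sub>V (z k))" if "k < N" for k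
  proof -
    have "R\<^sub>V (z k) (c *\<^sub>C v) = c *\<^sub>C R\<^sub>V (z k) v" for c v
      by (rule injD[OF \<iota>_inj]) (simp add: \<iota>R[OF that] \<iota>D resolvent_scaleC[OF A(1) z[OF that]])
    then show ?thesis
      using \<open>\<And>k. k < N \<Longrightarrow> bounded_linear (R\<^sub>V (z k))\<close>[OF that] by (simp add: bounded_clinear_def)
  qed
  have S_filter: "S = filter_op w z N R\<^sub>V" unfolding S_def R\<^sub>V_def ..
  have S: "bounded_clinear S" unfolding S_filter by (rule bounded_clinear_filter_op) (rule R\<^sub>V)
  define T where "T = filter_op w z N (resolvent D A)"
  have \<iota>S: "\<iota> (S v) = T (\<iota> v)" for v
  proof -
    have "\<iota> (\<Sum>k<N. w k *\<^sub>C R\<^sub>V (z k) v) = (\<Sum>k<N. \<iota> (w k *\<^sub>C R\<^sub>V (z k) v))"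
      using \<iota> by (simp add: bounded_clinear_def linear_sum bounded_linear.linear)
    then show ?thesis by (simp add: S_filter T_def filter_op_def \<iota>D \<iota>R)
  qed
  have Tlin: "bounded_clinear T"
    unfolding T_def by (rule bounded_clinear_filter_op) (rule bounded_clinear_resolvent[OF A(1) z])

  define W where "W = {v. \<forall>f\<in>E. cinner v f = 0}"
  have E_sub: "csubspace E" unfolding E(1) by (rule complex_vs.subspace_span)
  have E_eig: "e \<in> E" if "l \<in> \<Lambda>" "e \<in> eigenspace D A l" for l e
    unfolding E(1) using that by (intro complex_vs.span_base) blast
  have W_iff: "v \<in> W \<longleftrightarrow> (\<forall>l\<in>\<Lambda>. \<forall>e\<in>eigenspace D A l. cinner v e = 0)" for v
  proof
    assume v: "\<forall>l\<in>\<Lambda>. \<forall>e\<in>eigenspace D A l. cinner v e = 0"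
    have "cinner v f = 0" if "f \<in> E" for f
      by (rule cspan_perp[OF _ that[unfolded E(1)]]) (use v in auto)
    then show "v \<in> W" by (simp add: W_def)
  qed (use E_eig in \<open>auto simp: W_def\<close>)
  have W_sub: "csubspace W"
    by (auto simp: csubspace_iff W_def cinner_add_left cinner_scaleC_left)
  have real: "cnj l = l" if "l \<in> \<Lambda>" for l using inner that by auto
  have AW: "A v \<in> W" if "v \<in> D" "v \<in> W" for v
    unfolding W_iff
  proof (intro ballI)
    fix l e assume "l \<in> \<Lambda>" "e \<in> eigenspace D A l"
    then have "cinner (A v) e = cnj l * cinner v e" "cinner v e = 0"
      using sym that by (auto simp: symmetric_op_def eigenspace_def cinner_scaleC_right W_iff)
    then show "cinner (A v) e = 0" by simp
  qed
  have RW: "resolvent D A (z k) ` W \<subseteq> W" if "k < N" for k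
  proof clarify
    fix v assume v: "v \<in> W"
    define x where "x = resolvent D A (z k) v"
    have x: "x \<in> D" "z k *\<^sub>C x - A x = v" using resolventD[OF z[OF that]] by (auto simp: x_def)
    show "resolvent D A (z k) v \<in> W"
      unfolding W_iff x_def[symmetric]
    proof (intro ballI)
      fix l e assume le: "l \<in> \<Lambda>" "e \<in> eigenspace D A l"
      have "cinner (z k *\<^sub>C x - A x) e = 0" using v le by (simp add: x(2) W_iff)
      moreover have "cinner (A x) e = l * cinner x e"
        using sym le x(1) real by (auto simp: symmetric_op_def eigenspace_def cinner_scaleC_right)
      ultimately have "(z k - l) * cinner x e = 0"
        by (simp add: cinner_diff_left cinner_scaleC_left left_diff_distrib)
      moreover have "z k \<noteq> l" using z[OF that] le(1) \<Lambda>(2) by (auto simp: spectrum_def)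
      ultimately show "cinner x e = 0" by simp
    qed
  qed
  have TW: "T v \<in> W" if "v \<in> W" for v
    unfolding T_def filter_op_def using that RW
    by (intro complex_vs.subspace_add complex_vs.subspace_sum complex_vs.subspace_scale W_sub) auto
  have below: "\<exists>c>0. \<forall>v\<in>W. c * norm v \<le> norm (T v - \<mu> *\<^sub>C v)" if \<mu>: "\<mu> \<in> M" for \<mu>
  proof -
    obtain l where l: "l \<in> \<Lambda>" "\<mu> = filter_fun w z N l" using \<mu> by (auto simp: M_def)
    show ?thesis
      unfolding l(2) T_def
      by (rule filter_op_bounded_below_off_cluster[OF A(1,2) sym \<Lambda>(1,2) \<delta> \<gamma> inner outer z kappa l(1) W_sub AW RW])
         (auto simp: W_iff)
  qed
  have T_eig: "T e = filter_fun w z N l *\<^sub>C e" if "l \<in> \<Lambda>" "e \<in> eigenspace D A l" for l e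
    unfolding T_def
  proof (rule filter_op_eigenvector[OF A(1) z that(2)])
    show "z k \<noteq> l" if "k < N" for k using z[OF that] \<open>l \<in> \<Lambda>\<close> \<Lambda>(2) by (auto simp: spectrum_def)
  qed
  have E\<^sub>V_sub: "csubspace E\<^sub>V"
    using E_sub unfolding csubspace_iff E\<^sub>V_def by (auto simp: \<iota>D)
  \<comment> \<open>Properties of vectors of \<open>E\<close>, seen as elements of \<open>V\<close>, may be checked on eigenvectors.\<close>
  have E\<^sub>V_induct: "\<phi> v" if "v \<in> E\<^sub>V" "csubspace {v. \<phi> v}"
      and eig: "\<And>l e. l \<in> \<Lambda> \<Longrightarrow> \<iota> e \<in> eigenspace D A l \<Longrightarrow> \<phi> e" for \<phi> v
  proof -
    have "\<iota> v \<in> cspan (\<Union>l\<in>\<Lambda>. eigenspace D A l)" using that(1) by (simp add: E\<^sub>V_def E(1))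
    then have "\<exists>v'. \<iota> v' = \<iota> v \<and> \<phi> v'"
    proof (induction rule: complex_vs.span_induct)
      case base
      show ?case
        unfolding csubspace_iff
      proof (intro conjI ballI allI CollectI)
        show "\<exists>v'. \<iota> v' = 0 \<and> \<phi> v'" using that(2) \<iota>D(5) by (auto simp: csubspace_iff)
        fix x x' assume "x \<in> {x. \<exists>v'. \<iota> v' = x \<and> \<phi> v'}" "x' \<in> {x. \<exists>v'. \<iota> v' = x \<and> \<phi> v'}"
        then obtain u u' where "\<iota> u = x" "\<phi> u" "\<iota> u' = x'" "\<phi> u'" by blast
        then have "\<iota> (u + u') = x + x'" "\<phi> (u + u')" using that(2) by (auto simp: csubspace_iff \<iota>D)
        then show "\<exists>v'. \<iota> v' = x + x' \<and> \<phi> v'" by blast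
      next
        fix c x assume "x \<in> {x. \<exists>v'. \<iota> v' = x \<and> \<phi> v'}"
        then obtain u where "\<iota> u = x" "\<phi> u" by blast
        then have "\<iota> (c *\<^sub>C u) = c *\<^sub>C x" "\<phi> (c *\<^sub>C u)" using that(2) by (auto simp: csubspace_iff \<iota>D)
        then show "\<exists>v'. \<iota> v' = c *\<^sub>C x \<and> \<phi> v'" by blast
      qed
    next
      case (step x)
      then obtain l where l: "l \<in> \<Lambda>" "x \<in> eigenspace D A l" by blast
      then obtain e where "\<iota> e = x" using E_eig \<open>E \<subseteq> range \<iota>\<close> by blast
      then show ?case using eig l by blast
    qed
    then show ?thesis using \<iota>_inj by (auto simp: inj_eq)
  qed
  have S_eig: "S e = filter_fun w z N l *\<^sub>C e" if "l \<in> \<Lambda>" "\<iota> e \<in> eigenspace D A l" for l e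
    by (rule injD[OF \<iota>_inj]) (simp add: \<iota>S T_eig[OF that] \<iota>D)
  have SE: "S e \<in> E\<^sub>V" if "e \<in> E\<^sub>V" for e
  proof (rule E\<^sub>V_induct[OF that])
    show "csubspace {v. S v \<in> E\<^sub>V}"
      using E\<^sub>V_sub by (auto simp: csubspace_iff bounded_clinearD[OF S])
    show "S e \<in> E\<^sub>V" if "l \<in> \<Lambda>" "\<iota> e \<in> eigenspace D A l" for l e
      using S_eig[OF that] E_eig[OF that] complex_vs.subspace_scale[OF E\<^sub>V_sub] by (simp add: E\<^sub>V_def)
  qed
  have decomp: "\<exists>e\<in>E\<^sub>V. \<iota> (v - e) \<in> W" for v
  proof -
    obtain e where "e \<in> E" "\<forall>f\<in>E. cinner (\<iota> v - e) f = 0"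
      using orthogonal_projection_finite_dim[OF E_sub E(2)] by blast
    moreover obtain e' where "\<iota> e' = e" using \<open>E \<subseteq> range \<iota>\<close> calculation(1) by blast
    ultimately show ?thesis by (intro bexI[of _ e']) (auto simp: W_def E\<^sub>V_def \<iota>D)
  qed

  have M_disj: "\<zeta> \<notin> M" if "\<zeta> \<in> path_image \<theta>" for \<zeta>
    using that M_inside inside_no_overlap[of "path_image \<theta>"] by blast
  have \<theta>S: "path_image \<theta> \<subseteq> resolvent_set UNIV S"
  proof
    fix \<zeta> assume \<zeta>: "\<zeta> \<in> path_image \<theta>"
    show "\<zeta> \<in> resolvent_set UNIV S"
    proof (rule ccontr)
      assume "\<zeta> \<notin> resolvent_set UNIV S"
      then have mem: "cmod \<zeta> \<in> insert 0 (cmod ` (spectrum UNIV S - M))"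
        using M_disj[OF \<zeta>] by (auto simp: spectrum_def)
      obtain B where "\<And>\<xi>. \<xi> \<in> spectrum UNIV S \<Longrightarrow> cmod \<xi> \<le> B" using spectrum_bounded[OF S] by blast
      then have "bdd_above (insert 0 (cmod ` (spectrum UNIV S - M)))" by (auto intro!: bdd_aboveI[of _ B])
      then have "cmod \<zeta> \<le> radius_outside S M" unfolding radius_outside_def by (rule cSup_upper[OF mem])
      then show False
        using \<open>\<And>\<zeta>. \<zeta> \<in> path_image \<theta> \<Longrightarrow> radius_outside S M < cmod \<zeta>\<close>[OF \<zeta>] by simp
    qed
  qed
  \<comment> \<open>\<open>V0\<close> is invariant under the resolvents: by the splitting of \<open>V\<close>, the component \<open>e\<close> in \<open>E\<close> of
    \<open>(\<zeta> - S)\<inverse> v\<close> satisfies \<open>(\<zeta> - S) e = 0\<close> if \<open>v\<close> is in \<open>V0\<close>.\<close>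
  have W_resolvent: "\<iota> (resolvent UNIV S \<zeta> v) \<in> W" if \<zeta>: "\<zeta> \<in> resolvent_set UNIV S" and v: "\<iota> v \<in> W" for \<zeta> v
  proof -
    define u where "u = resolvent UNIV S \<zeta> v"
    have u: "\<zeta> *\<^sub>C u - S u = v" unfolding u_def by (rule resolventD(2)[OF \<zeta>])
    obtain e where e: "e \<in> E\<^sub>V" "\<iota> (u - e) \<in> W" using decomp by blast
    define f where "f = \<zeta> *\<^sub>C e - S e"
    have "f \<in> E\<^sub>V" unfolding f_def
      using e(1) SE complex_vs.subspace_diff[OF E\<^sub>V_sub] complex_vs.subspace_scale[OF E\<^sub>V_sub] by blast
    moreover have "\<iota> f = \<iota> v - (\<zeta> *\<^sub>C \<iota> (u - e) - T (\<iota> (u - e)))"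
      unfolding u[symmetric] f_def \<iota>S[symmetric]
      by (simp add: \<iota>D bounded_clinearD[OF S] complex_vs.scale_right_diff_distrib)
    then have "\<iota> f \<in> W"
      using v e(2) TW complex_vs.subspace_diff[OF W_sub] complex_vs.subspace_scale[OF W_sub] by simp
    ultimately have "cinner (\<iota> f) (\<iota> f) = 0" by (auto simp: W_def E\<^sub>V_def)
    then have "\<iota> f = \<iota> 0" by (simp add: cinner_self \<iota>D)
    then have "f = 0" using \<iota>_inj by (simp add: inj_eq)
    then have "e = resolvent UNIV S \<zeta> 0"
      using resolvent_eqI[OF \<zeta> UNIV_I, of e 0] by (simp add: f_def)
    also have "\<dots> = 0" using resolventD(4)[OF \<zeta>] by (simp add: linear_simps)
    finally show ?thesis using e(2) by (simp add: u_def)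
  qed

  define P where "P = riesz_projection \<theta> S"
  note Plin = riesz_projection_clinear[OF path rect S \<theta>S, folded P_def]
  obtain s where s: "s = 1 \<or> s = - 1" "\<And>\<kappa>. \<kappa> \<in> inside (path_image \<theta>) \<Longrightarrow> winding_number \<theta> \<kappa> = s"
    by (rule simple_closed_path_winding_number_inside[OF \<open>simple_path \<theta>\<close>]) blast+
  have s2: "s * s = 1" "cmod s = 1" using s(1) by auto
  have winding: "winding_number \<theta> \<kappa> = s \<or> winding_number \<theta> \<kappa> = 0" if "\<kappa> \<notin> path_image \<theta>" for \<kappa>
    using s(2)[of \<kappa>] winding_number_zero_in_outside[OF path loop, of \<kappa>] that
      inside_Un_outside[of "path_image \<theta>"] by blast
  have PE: "P e = s *\<^sub>C e" if "e \<in> E\<^sub>V" for e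
  proof (rule E\<^sub>V_induct[OF that])
    have "P 0 = 0" using Plin(2)[of 0 0] by simp
    then show "csubspace {v. P v = s *\<^sub>C v}"
      by (auto simp: csubspace_iff Plin scaleC_add_right mult.commute)
    fix l e assume le: "l \<in> \<Lambda>" "\<iota> e \<in> eigenspace D A l"
    then have \<mu>: "filter_fun w z N l \<in> M" by (simp add: M_def)
    have "(shift S (filter_fun w z N l) ^^ 1) e = 0" using S_eig[OF le] by (simp add: shift_def)
    then have "e \<in> gen_eigenspace S (filter_fun w z N l)" unfolding gen_eigenspace_def by blast
    moreover have "filter_fun w z N l \<notin> path_image \<theta>" using M_disj \<mu> by blast
    ultimately show "P e = s *\<^sub>C e"
      unfolding P_def using riesz_projection_gen_eigenvector[OF path loop rect S \<theta>S] s(2) \<mu> M_inside by auto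
  qed
  have P0: "P v = 0" if "\<iota> v \<in> W" for v
    unfolding P_def
    by (rule riesz_projection_eq_0[OF path loop rect S \<theta>S _ M_inside _ \<iota> \<iota>_inj \<iota>S W_resolvent below that])
       (use \<Lambda>(1) \<open>inside (path_image \<theta>) \<inter> spectrum UNIV S \<subseteq> M\<close> in \<open>auto simp: M_def\<close>)
  have P_range: "s *\<^sub>C P v \<in> E\<^sub>V" for v
  proof -
    obtain e where e: "e \<in> E\<^sub>V" "\<iota> (v - e) \<in> W" using decomp by blast
    have "P v = P (v - e) + P e" using Plin(1)[of "v - e" e] by simp
    then have "s *\<^sub>C P v = e" using P0[OF e(2)] PE[OF e(1)] s2 by (simp add: scaleC_scaleC)
    then show ?thesis using e(1) by simp
  qed

  obtain L where L: "variation_le \<theta> L" using rect by (auto simp: rectifiable_variation_le)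
  have "L \<ge> 0" by (rule variation_le_nonneg[OF L])
  obtain K where K: "K > 0" "\<And>\<zeta> v. \<zeta> \<in> path_image \<theta> \<Longrightarrow> norm (resolvent UNIV S \<zeta> v) \<le> K * norm v"
    using resolvent_bounded_on_compact[OF S compact_path_image[OF path] \<theta>S] by blast
  have RE: "resolvent UNIV S \<zeta> e \<in> E\<^sub>V" if \<zeta>: "\<zeta> \<in> path_image \<theta>" and "e \<in> E\<^sub>V" for \<zeta> e
  proof (rule E\<^sub>V_induct[OF that(2)])
    have \<zeta>S: "\<zeta> \<in> resolvent_set UNIV S" using \<zeta> \<theta>S by blast
    note R = bounded_clinearD[OF bounded_clinear_resolvent[OF bounded_clinear_imp_linear_op[OF S] \<zeta>S]]
    show "csubspace {v. resolvent UNIV S \<zeta> v \<in> E\<^sub>V}"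
      using E\<^sub>V_sub by (auto simp: csubspace_iff R)
    fix l e assume le: "l \<in> \<Lambda>" "\<iota> e \<in> eigenspace D A l"
    let ?\<mu> = "filter_fun w z N l"
    have "\<zeta> \<noteq> ?\<mu>" using M_disj[OF \<zeta>] le(1) by (auto simp: M_def)
    have "resolvent UNIV S \<zeta> e = inverse (\<zeta> - ?\<mu>) *\<^sub>C e"
    proof (rule resolvent_eqI[OF \<zeta>S UNIV_I])
      have "\<zeta> *\<^sub>C inverse (\<zeta> - ?\<mu>) *\<^sub>C e - S (inverse (\<zeta> - ?\<mu>) *\<^sub>C e) = ((\<zeta> - ?\<mu>) * inverse (\<zeta> - ?\<mu>)) *\<^sub>C e"
        by (simp add: bounded_clinearD[OF S] S_eig[OF le] left_diff_distrib mult.commute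
            flip: complex_vs.scale_left_diff_distrib)
      then show "\<zeta> *\<^sub>C inverse (\<zeta> - ?\<mu>) *\<^sub>C e - S (inverse (\<zeta> - ?\<mu>) *\<^sub>C e) = e"
        using \<open>\<zeta> \<noteq> ?\<mu>\<close> by simp
    qed
    then show "resolvent UNIV S \<zeta> e \<in> E\<^sub>V"
      using E_eig[OF le] complex_vs.subspace_scale[OF E\<^sub>V_sub] by (simp add: E\<^sub>V_def)
  qed

  define S\<^sub>h where "S\<^sub>h = (\<lambda>h. filter_op w z N (\<lambda>\<zeta> v. R\<^sub>h h \<zeta> (\<iota> v)))"
  define \<Delta> where "\<Delta> = (\<lambda>h k v. R\<^sub>V (z k) v - R\<^sub>h h (z k) (\<iota> v))"
  define \<nu> where "\<nu> = (\<lambda>h. \<Sum>k<N. cmod (w k) * onorm (\<lambda>v. R\<^sub>h h (z k) (\<iota> v) - R\<^sub>V (z k) v))"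
  define dd where "dd = (\<lambda>h. Max ((\<lambda>k. norm_on E\<^sub>V (\<Delta> h k)) ` {..<N}))"
  have R\<^sub>h: "bounded_clinear (\<lambda>v. R\<^sub>h h (z k) (\<iota> v))" if "h > 0" "k < N" for h k
    using R\<^sub>h_V\<^sub>h[OF that(1) z[OF that(2)]]
      \<open>\<And>h k. h > 0 \<Longrightarrow> k < N \<Longrightarrow> bounded_linear (\<lambda>v. R\<^sub>h h (z k) (\<iota> v))\<close>[OF that]
    by (simp add: bounded_clinear_def clinear_iff \<iota>D)
  have S\<^sub>h: "bounded_clinear (S\<^sub>h h)" if "h > 0" for h
    unfolding S\<^sub>h_def by (rule bounded_clinear_filter_op) (rule R\<^sub>h[OF that])
  have \<Delta>: "bounded_linear (\<Delta> h k)" if "h > 0" "k < N" for h k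
    using R\<^sub>V[OF that(2)] R\<^sub>h[OF that] unfolding \<Delta>_def bounded_clinear_def by (intro bounded_linear_sub) auto
  have span: "gen_eigenspan (S\<^sub>h h) = UNIV" if "h > 0" for h
  proof (rule gen_eigenspan_finite_rank[OF bounded_clinear_imp_linear_op[OF S\<^sub>h[OF that]]])
    show "finite_dim (V\<^sub>h h)" using V\<^sub>h[OF that] by blast
    have "R\<^sub>h h (z k) (\<iota> v) \<in> V\<^sub>h h" if "k < N" for k v
      using R\<^sub>h_V\<^sub>h[OF \<open>h > 0\<close> z[OF that]] by blast
    then show "S\<^sub>h h v - w N *\<^sub>C v \<in> V\<^sub>h h" for v
      using V\<^sub>h[OF that]
      unfolding S\<^sub>h_def filter_op_def
      by (auto intro!: complex_vs.subspace_sum complex_vs.subspace_scale)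
  qed
  have diff_norm: "norm (S v - S\<^sub>h h v) \<le> \<nu> h * norm v" if "h > 0" for h v
  proof -
    have "norm (S v - S\<^sub>h h v) \<le> (\<Sum>k<N. cmod (w k) * (onorm (\<lambda>v. R\<^sub>h h (z k) (\<iota> v) - R\<^sub>V (z k) v) * norm v))"
      unfolding S_filter S\<^sub>h_def
    proof (rule norm_filter_op_diff_le)
      fix k assume k: "k < N"
      have "bounded_linear (\<lambda>v. R\<^sub>h h (z k) (\<iota> v) - R\<^sub>V (z k) v)"
        using R\<^sub>V[OF k] R\<^sub>h[OF that k] unfolding bounded_clinear_def by (intro bounded_linear_sub) auto
      then show "norm (R\<^sub>V (z k) v - R\<^sub>h h (z k) (\<iota> v)) \<le> onorm (\<lambda>v. R\<^sub>h h (z k) (\<iota> v) - R\<^sub>V (z k) v) * norm v"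
        using onorm[of "\<lambda>v. R\<^sub>h h (z k) (\<iota> v) - R\<^sub>V (z k) v" v] by (simp add: norm_minus_commute)
    qed
    then show ?thesis by (simp add: \<nu>_def sum_distrib_right mult.assoc)
  qed
  \<comment> \<open>A nonzero vector of \<open>E\<close> is needed to see that the suprema in \<open>dd\<close> and the numbers \<open>\<nu> h\<close> are not negative.\<close>
  obtain e0 where e0: "e0 \<in> E\<^sub>V" "e0 \<noteq> 0"
  proof -
    obtain f where "f \<in> E" "f \<noteq> 0" using E(3) complex_vs.subspace_0[OF E_sub] by blast
    moreover obtain e where "\<iota> e = f" using calculation(1) \<open>E \<subseteq> range \<iota>\<close> by blast
    ultimately show ?thesis using that[of e] \<iota>D(5) by (auto simp: E\<^sub>V_def)
  qed
  have dd: "dd h \<ge> 0" "\<And>k. k < N \<Longrightarrow> norm_on E\<^sub>V (\<Delta> h k) \<le> dd h" if "h > 0" for h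
  proof -
    show le: "norm_on E\<^sub>V (\<Delta> h k) \<le> dd h" if "k < N" for k
      unfolding dd_def using that by (intro Max_ge) auto
    show "dd h \<ge> 0"
      using le[OF \<open>N > 0\<close>] norm_on_nonneg[OF \<Delta>[OF that \<open>N > 0\<close>] e0] by linarith
  qed
  have diff_E: "norm (S e - S\<^sub>h h e) \<le> filter_weight w N * dd h * norm e" if "h > 0" "e \<in> E\<^sub>V" for h e
  proof -
    have "norm (S e - S\<^sub>h h e) \<le> (\<Sum>k<N. cmod (w k) * (dd h * norm e))"
      unfolding S_filter S\<^sub>h_def
    proof (rule norm_filter_op_diff_le)
      fix k assume k: "k < N"
      have "norm (\<Delta> h k e) \<le> norm_on E\<^sub>V (\<Delta> h k) * norm e"
        by (rule norm_on_upper[OF \<Delta>[OF that(1) k] that(2)])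
      also have "\<dots> \<le> dd h * norm e" by (intro mult_right_mono dd(2)[OF that(1) k]) auto
      finally show "norm (R\<^sub>V (z k) e - R\<^sub>h h (z k) (\<iota> e)) \<le> dd h * norm e" by (simp add: \<Delta>_def)
    qed
    also have "\<dots> = (\<Sum>k<N. cmod (w k)) * (dd h * norm e)" by (simp add: sum_distrib_right)
    also have "\<dots> \<le> filter_weight w N * (dd h * norm e)"
      unfolding filter_weight_def using dd(1)[OF that(1)]
      by (intro mult_right_mono sum_mono2) auto
    finally show ?thesis by (simp add: mult.assoc)
  qed

  define C where "C = 2 * L * K\<^sup>2 * (1 + 2 * (L * K))"
  have "C \<ge> 0" using \<open>L \<ge> 0\<close> K(1) by (simp add: C_def)
  have \<nu>0: "(\<nu> \<longlongrightarrow> 0) (at_right 0)"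
  proof -
    have "(\<nu> \<longlongrightarrow> (\<Sum>k<N. cmod (w k) * 0)) (at_right 0)"
      unfolding \<nu>_def by (intro tendsto_intros conv) auto
    then show ?thesis by simp
  qed
  \<comment> \<open>The bound \<open>1 / m\<close> keeps the curve in the resolvent set of \<open>S\<^sub>h h\<close>, by \<open>2 K\<close>, and makes the contraction
    in the estimate of the gap work, by \<open>8 L\<^sup>2 K\<^sup>3\<close>.\<close>
  define m where "m = max (2 * K) (8 * L\<^sup>2 * K ^ 3)"
  have "m > 0" using K(1) by (simp add: m_def less_max_iff_disj)
  have gap: "gap E\<^sub>V (E\<^sub>h h) \<le> C * (filter_weight w N * dd h)" "gap E\<^sub>V (E\<^sub>h h) \<le> C * \<nu> h"
    if h: "h > 0" "\<nu> h < 1 / m" for h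
  proof -
    have \<nu>_nonneg: "0 \<le> \<nu> h"
      using order_trans[OF norm_ge_zero diff_norm[OF h(1), of e0]] e0(2) by (simp add: zero_le_mult_iff)
    have "m * \<nu> h \<le> 1" using h(2) \<open>m > 0\<close> by (simp add: field_simps)
    moreover have "2 * K * \<nu> h \<le> m * \<nu> h" "8 * L\<^sup>2 * K ^ 3 * \<nu> h \<le> m * \<nu> h"
      using \<nu>_nonneg by (auto simp: m_def intro!: mult_right_mono)
    ultimately have small: "2 * K * \<nu> h \<le> 1" "8 * L\<^sup>2 * K ^ 3 * \<nu> h \<le> 1" by auto
    have E\<^sub>h: "E\<^sub>h h = range (riesz_projection \<theta> (S\<^sub>h h))" by (simp add: E\<^sub>h_def S\<^sub>h_def)
    note gap_le = gap_riesz_projection_le[OF path loop rect L s(1) winding S \<theta>S K S\<^sub>h[OF h(1)] span[OF h(1)]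
        PE[unfolded P_def] P_range[unfolded P_def] RE diff_norm[OF h(1)] \<nu>_nonneg small, folded E\<^sub>h C_def]
    show "gap E\<^sub>V (E\<^sub>h h) \<le> C * (filter_weight w N * dd h)"
      using dd(1)[OF h(1)]
      by (intro gap_le diff_E[OF h(1)]) (auto simp: filter_weight_def intro!: mult_nonneg_nonneg sum_nonneg)
    show "gap E\<^sub>V (E\<^sub>h h) \<le> C * \<nu> h"
      by (intro gap_le diff_norm[OF h(1)] \<nu>_nonneg)
  qed
  have "eventually (\<lambda>h. \<nu> h < 1 / m) (at_right 0)"
    using order_tendstoD(2)[OF \<nu>0] \<open>m > 0\<close> by simp
  then obtain h\<^sub>0 where h\<^sub>0: "h\<^sub>0 > 0" "\<And>h. 0 < h \<Longrightarrow> h < h\<^sub>0 \<Longrightarrow> \<nu> h < 1 / m"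
    unfolding eventually_at_right_field by auto
  \<comment> \<open>\<open>C + 1\<close> because \<open>C\<close> is only known to be nonnegative.\<close>
  have "gap E\<^sub>V (E\<^sub>h h) \<le> (C + 1) * filter_weight w N *
      Max ((\<lambda>k. norm_on E\<^sub>V (\<lambda>v. R\<^sub>V (z k) v - R\<^sub>h h (z k) (\<iota> v))) ` {..<N})" if h: "0 < h" "h < h\<^sub>0" for h
  proof -
    have "gap E\<^sub>V (E\<^sub>h h) \<le> C * (filter_weight w N * dd h)" by (rule gap(1)[OF h(1) h\<^sub>0(2)[OF h]])
    also have "\<dots> \<le> (C + 1) * (filter_weight w N * dd h)"
      using dd(1)[OF h(1)]
      by (intro mult_right_mono) (auto simp: filter_weight_def intro!: mult_nonneg_nonneg sum_nonneg)
    finally show ?thesis by (simp add: dd_def \<Delta>_def mult.assoc)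
  qed
  moreover have "((\<lambda>h. gap E\<^sub>V (E\<^sub>h h)) \<longlongrightarrow> 0) (at_right 0)"
  proof (rule tendsto_sandwich)
    have "0 \<in> E\<^sub>V" using complex_vs.subspace_0[OF E\<^sub>V_sub] .
    then show "eventually (\<lambda>h. 0 \<le> gap E\<^sub>V (E\<^sub>h h)) (at_right 0)"
      by (simp add: gap_def le_max_iff_disj directed_gap_nonneg)
    show "eventually (\<lambda>h. gap E\<^sub>V (E\<^sub>h h) \<le> C * \<nu> h) (at_right 0)"
      unfolding eventually_at_right_field using h\<^sub>0 gap(2) by (intro exI[of _ h\<^sub>0]) auto
    show "((\<lambda>h. C * \<nu> h) \<longlongrightarrow> 0) (at_right 0)" using tendsto_mult_left[OF \<nu>0, of C] by simp
  qed auto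
  ultimately show ?thesis
    using \<open>C \<ge> 0\<close> h\<^sub>0(1) by (intro conjI exI[of _ "C + 1"] exI[of _ h\<^sub>0]) auto
qed

end
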